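(* Let $\Bbbk$ be a field or $\Bbbk=\mathbb{Z}$. Fix integers $d\ge 1$ and $j\ge d+1$, and fix $p\in(0,1)$. For each integer $n\ge j$ let $Y^d_{n;p}$ be a random simplicial $d$-complex on $[n]$ with parameter $p$, all of these being defined on a common probability space $(\Omega,\mathcal{F},\mathbb{P})$. Then, as $n\to\infty$, $$ \frac{\beta^{-j+d,\,2j}\big(\Bbbk(Y^d_{n;p})\big)}{\binom{n}{j}}\longrightarrow f_j(p) \qquad\text{and}\qquad \frac{\beta^{-j+d+1,\,2j}\big(\Bbbk(Y^d_{n;p})\big)}{\binom{n}{j}}\longrightarrow g_j(p) $$ almost surely, where $$ f_j(p)=\mathbb{E}\big(\dim_{\Bbbk}\widetilde H_{d-1}(Y^d_{j;p};\Bbbk)\big),\qquad g_j(p)=\mathbb{E}\big(\dim_{\Bbbk}\widetilde H_{d}(Y^d_{j;p};\Bbbk)\big), $$ and $f_j$ and $g_j$ are both polynomials in $p$ of degree at most $\binom{j}{d+1}$.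
   Context: Notation: $[n]=\{1,\dots,n\}$; $\Delta^n$ is the standard $(n-1)$-simplex on the vertex set $[n]$, and $\Delta^n_i$ is its $i$-skeleton (all faces of dimension at most $i$). Random simplicial $d$-complex (Linial–Meshulam): $Y^d_{n;p}$ is a random simplicial complex on $[n]$ taking values in the complexes $K$ with $\Delta^n_{d-1}\subset K\subset \Delta^n_d$, such that each of the $\binom{n}{d+1}$ possible $d$-simplices of $\Delta^n_d$ belongs to $Y^d_{n;p}$ with probability $p$, independently of the others. No particular joint distribution of the complexes for different $n$ is prescribed. Bigraded Betti numbers: for a simplicial complex $K$ on $[n]$, the Stanley–Reisner ring is $\Bbbk[K]=\Bbbk[v_1,\dots,v_n]/\mathcal{I}_K$, where $\deg v_i=2$ and $\mathcal{I}_K$ is the ideal generated by the square-free monomials $v_{i_1}\cdots v_{i_k}$ with $\{i_1,\dots,i_k\}\notin K$. The bigraded Betti numbers are $$\beta^{-i,2j}(\Bbbk(K)):=\dim_{\Bbbk}\mathrm{Tor}^{-i,2j}_{\Bbbk[v_1,\dots,v_n]}(\Bbbk[K];\Bbbk),$$ where $-i$ refers to homological degree $i$ and $2j$ to the internal degree, and $\dim_{\Bbbk}$ means the rank when $\Bbbk=\mathbb{Z}$. By Hochster's formula (a known result), equivalently $$\beta^{-i,2j}(\Bbbk(K))=\sum_{J\subset[n],\,|J|=j}\dim_{\Bbbk}\widetilde H_{j-i-1}(K_J;\Bbbk),$$ where $K_J=\{\sigma\in K:\sigma\subset J\}$ is the full subcomplex of $K$ on $J$ and $\widetilde H_*$ denotes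 reduced simplicial homology. These numbers are the ranks of the bigraded (co)homology groups of the moment-angle complex $\mathcal{Z}_K$. *)

theory Defs
  imports
    "HOL-Probability.Probability"
    "HOL-Library.Poly_Mapping"
    "HOL-Computational_Algebra.Polynomial"
begin

section \<open>Free modules, linear maps and ranks\<close>

text \<open>
  The free module on a set \<open>B\<close> with coefficients in a subring \<open>R\<close> consists of finitely supported
  functions; the ring \<open>R\<close> is a set because below it is a polynomial ring in a varying number of
  variables.
\<close>

definition free_module :: "'r::comm_ring_1 set \<Rightarrow> 'b set \<Rightarrow> ('b \<Rightarrow>\<^sub>0 'r) set" where
  "free_module R B =
     {x. Poly_Mapping.keys x \<subseteq> B \<and> (\<forall>b. Poly_Mapping.lookup x b \<in> R)}"

definition scale :: "'r::comm_ring_1 \<Rightarrow> ('b \<Rightarrow>\<^sub>0 'r) \<Rightarrow> ('b \<Rightarrow>\<^sub>0 'r)" where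
  "scale c x = Poly_Mapping.map (\<lambda>a. c * a) x"

definition lin_ext :: "('b \<Rightarrow> ('c \<Rightarrow>\<^sub>0 'r)) \<Rightarrow> ('b \<Rightarrow>\<^sub>0 'r) \<Rightarrow> ('c \<Rightarrow>\<^sub>0 'r::comm_ring_1)" where
  "lin_ext D x = (\<Sum>b\<in>Poly_Mapping.keys x. scale (Poly_Mapping.lookup x b) (D b))"

text \<open>
  The rank of the quotient module \<open>Z / W\<close> over a domain: the largest number of elements of \<open>Z\<close>
  that are linearly independent modulo \<open>W\<close>. Over a field this is the dimension, over the integers
  the rank of the abelian group. It is only meaningful when the rank is finite.
\<close>

definition quotient_rank :: "('b \<Rightarrow>\<^sub>0 'k::idom) set \<Rightarrow> ('b \<Rightarrow>\<^sub>0 'k) set \<Rightarrow> nat" where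
  "quotient_rank Z W =
     Sup {card X | X. finite X \<and> X \<subseteq> Z \<and>
            (\<forall>c. (\<Sum>x\<in>X. scale (c x) x) \<in> W \<longrightarrow> (\<forall>x\<in>X. c x = 0))}"

section \<open>Simplicial complexes and reduced simplicial homology\<close>

definition simplicial_complex :: "'a set \<Rightarrow> 'a set set \<Rightarrow> bool" where
  "simplicial_complex V K \<longleftrightarrow>
     {} \<in> K \<and> (\<forall>\<sigma>\<in>K. finite \<sigma> \<and> \<sigma> \<subseteq> V \<and> (\<forall>\<tau>. \<tau> \<subseteq> \<sigma> \<longrightarrow> \<tau> \<in> K))"

definition simplices :: "nat set set \<Rightarrow> nat \<Rightarrow> nat set set" where
  "simplices K q = {\<sigma>\<in>K. finite \<sigma> \<and> card \<sigma> = q + 1}"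

definition boundary :: "nat set \<Rightarrow> (nat set \<Rightarrow>\<^sub>0 'k::idom)" where
  "boundary \<sigma> = (\<Sum>v\<in>\<sigma>. Poly_Mapping.single (\<sigma> - {v}) ((-1) ^ card {u\<in>\<sigma>. u < v}))"

text \<open>
  \<open>reduced_homology_rank TYPE('k) K q\<close> is the rank of the \<open>q\<close>-th reduced homology of \<open>K\<close> with
  coefficients in \<open>'k\<close>, for \<open>q \<ge> 0\<close>. Homology is reduced because the boundary of a vertex is
  the empty simplex, not \<open>0\<close>.
\<close>

definition reduced_homology_rank :: "'k::idom itself \<Rightarrow> nat set set \<Rightarrow> nat \<Rightarrow> nat" where
  "reduced_homology_rank (_ :: 'k itself) K q =
     quotient_rank {x \<in> free_module (UNIV :: 'k set) (simplices K q). lin_ext boundary x = 0}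
                   (lin_ext boundary ` free_module UNIV (simplices K (q + 1)))"

section \<open>The Stanley--Reisner ideal\<close>

text \<open>
  Polynomials are finitely supported functions on monomials, with the convolution product; the
  variables are \<open>v\<^sub>0, v\<^sub>1, \<dots>\<close>, and \<open>poly_ring n\<close> is the subring of polynomials in
  \<open>v\<^sub>1, \<dots>, v\<^sub>n\<close>. Every variable has degree 2.
\<close>

type_synonym 'k mpoly = "(nat \<Rightarrow>\<^sub>0 nat) \<Rightarrow>\<^sub>0 'k"

definition var :: "nat \<Rightarrow> 'k::idom mpoly" where
  "var i = Poly_Mapping.single (Poly_Mapping.single i 1) 1"

definition poly_ring :: "nat \<Rightarrow> 'k::idom mpoly set" where
  "poly_ring n = {f. \<forall>m\<in>Poly_Mapping.keys f. Poly_Mapping.keys m \<subseteq> {1..n}}"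

definition monomial_degree :: "(nat \<Rightarrow>\<^sub>0 nat) \<Rightarrow> nat" where
  "monomial_degree m = (\<Sum>i\<in>Poly_Mapping.keys m. 2 * Poly_Mapping.lookup m i)"

definition constant_term :: "'k::idom mpoly \<Rightarrow> 'k" where
  "constant_term f = Poly_Mapping.lookup f 0"

definition stanley_reisner_ideal :: "nat \<Rightarrow> nat set set \<Rightarrow> 'k::idom mpoly set" where
  "stanley_reisner_ideal n K =
     {(\<Sum>\<sigma>\<in>Pow {1..n} - K. q \<sigma> * (\<Prod>i\<in>\<sigma>. var i)) | q. \<forall>\<sigma>. q \<sigma> \<in> poly_ring n}"

section \<open>Graded free resolutions, Tor and bigraded Betti numbers\<close>

text \<open>
  With \<open>S = poly_ring n\<close> and \<open>I\<close> a homogeneous ideal of \<open>S\<close>, this describes an exact sequence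
  \<open>\<dots> \<rightarrow> F\<^sub>2 \<rightarrow> F\<^sub>1 \<rightarrow> F\<^sub>0 \<rightarrow> S/I \<rightarrow> 0\<close> of graded \<open>S\<close>-modules. The module \<open>F\<^sub>i\<close> is free on \<open>B i\<close>,
  the basis element \<open>b \<in> B i\<close> has degree \<open>deg i b\<close> and, if \<open>i = k + 1\<close>, is mapped to
  \<open>D k b \<in> F\<^sub>k\<close>. The map \<open>F\<^sub>0 \<rightarrow> S/I\<close> is given by representatives \<open>\<epsilon> b \<in> S\<close> of the images of
  the basis elements. All maps preserve degrees. Countable bases are enough for such a resolution
  to exist when \<open>'k\<close> is Noetherian, since then all the \<open>F\<^sub>i\<close> can be chosen of finite rank.
\<close>

definition graded_free_resolution ::
  "nat \<Rightarrow> 'k::idom mpoly set \<Rightarrow> (nat \<Rightarrow> nat set) \<Rightarrow> (nat \<Rightarrow> nat \<Rightarrow> nat) \<Rightarrow>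
   (nat \<Rightarrow> nat \<Rightarrow> (nat \<Rightarrow>\<^sub>0 'k mpoly)) \<Rightarrow> (nat \<Rightarrow> 'k mpoly) \<Rightarrow> bool" where
  "graded_free_resolution n I B deg D \<epsilon> \<longleftrightarrow>
     (let S = poly_ring n;
          F = (\<lambda>i. free_module S (B i));
          aug = (\<lambda>x. \<Sum>b\<in>Poly_Mapping.keys x. Poly_Mapping.lookup x b * \<epsilon> b)
      in
        (\<forall>b\<in>B 0. \<epsilon> b \<in> S \<and> (\<forall>m\<in>Poly_Mapping.keys (\<epsilon> b). monomial_degree m = deg 0 b)) \<and>
        (\<forall>i. \<forall>b\<in>B (Suc i). D i b \<in> F i \<and>
           (\<forall>c\<in>B i. \<forall>m\<in>Poly_Mapping.keys (Poly_Mapping.lookup (D i b) c).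
              deg i c + monomial_degree m = deg (Suc i) b)) \<and>
        (\<forall>f\<in>S. \<exists>x\<in>F 0. aug x - f \<in> I) \<and>
        lin_ext (D 0) ` F 1 = {x \<in> F 0. aug x \<in> I} \<and>
        (\<forall>i. lin_ext (D (Suc i)) ` F (Suc (Suc i)) = {x \<in> F (Suc i). lin_ext (D i) x = 0}))"

text \<open>
  The rank of the homology in homological degree \<open>i\<close> and internal degree \<open>e\<close> of the complex
  \<open>F \<otimes>\<^sub>S 'k\<close>, where \<open>'k = S / (v\<^sub>1, \<dots>, v\<^sub>n)\<close>: it consists of the free \<open>'k\<close>-modules on the same
  bases, and its differentials are obtained by replacing the matrix entries by their constant terms.
\<close>

definition tensor_homology_rank ::
  "(nat \<Rightarrow> nat set) \<Rightarrow> (nat \<Rightarrow> nat \<Rightarrow> nat) \<Rightarrow> (nat \<Rightarrow> nat \<Rightarrow> (nat \<Rightarrow>\<^sub>0 'k::idom mpoly)) \<Rightarrow>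
   nat \<Rightarrow> nat \<Rightarrow> nat" where
  "tensor_homology_rank B deg D i e =
     (let C = (\<lambda>k. free_module (UNIV :: 'k set) {b \<in> B k. deg k b = e});
          bd = (\<lambda>k. lin_ext (\<lambda>b. Poly_Mapping.map constant_term (D k b)))
      in quotient_rank {x \<in> C i. \<forall>k. i = Suc k \<longrightarrow> bd k x = 0} (bd i ` C (Suc i)))"

text \<open>
  \<open>bigraded_betti TYPE('k) n K i e\<close> is the number \<open>\<beta>\<^sup>-\<^sup>i\<^sup>,\<^sup>e('k(K))\<close> of a complex \<open>K\<close> on
  \<open>{1..n}\<close>, that is, the rank of \<open>Tor\<close> of the Stanley--Reisner ring and \<open>'k\<close> in homological
  degree \<open>i\<close> and internal degree \<open>e\<close>; it does not depend on the resolution.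
\<close>

definition bigraded_betti :: "'k::idom itself \<Rightarrow> nat \<Rightarrow> nat set set \<Rightarrow> nat \<Rightarrow> nat \<Rightarrow> nat" where
  "bigraded_betti (_ :: 'k itself) n K i e =
     (THE r. \<exists>B deg D \<epsilon>.
        graded_free_resolution n (stanley_reisner_ideal n K :: 'k mpoly set) B deg D \<epsilon> \<and>
        r = tensor_homology_rank B deg D i e)"

section \<open>Linial--Meshulam random complexes\<close>

definition skeleton :: "nat \<Rightarrow> nat \<Rightarrow> nat set set" where
  "skeleton n i = {\<sigma>. \<sigma> \<subseteq> {1..n} \<and> card \<sigma> \<le> i + 1}"

definition d_simplices :: "nat \<Rightarrow> nat \<Rightarrow> nat set set" where
  "d_simplices n d = {\<sigma>. \<sigma> \<subseteq> {1..n} \<and> card \<sigma> = d + 1}"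

definition lm_complexes :: "nat \<Rightarrow> nat \<Rightarrow> nat set set set" where
  "lm_complexes n d =
     {K. simplicial_complex {1..n} K \<and> skeleton n (d - 1) \<subseteq> K \<and> K \<subseteq> skeleton n d}"

definition random_d_complex ::
  "'w measure \<Rightarrow> nat \<Rightarrow> nat \<Rightarrow> real \<Rightarrow> ('w \<Rightarrow> nat set set) \<Rightarrow> bool" where
  "random_d_complex M n d p Y \<longleftrightarrow>
     Y \<in> measurable M (count_space (lm_complexes n d)) \<and>
     prob_space.indep_events M (\<lambda>\<sigma>. {\<omega> \<in> space M. \<sigma> \<in> Y \<omega>}) (d_simplices n d) \<and>
     (\<forall>\<sigma>\<in>d_simplices n d. measure M {\<omega> \<in> space M. \<sigma> \<in> Y \<omega>} = p)"

text \<open>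
  The distribution of such a complex, used to speak of expectations as functions of \<open>p\<close>.
\<close>

definition lm_pmf :: "nat \<Rightarrow> nat \<Rightarrow> real \<Rightarrow> nat set set pmf" where
  "lm_pmf n d p =
     map_pmf (\<lambda>present. skeleton n (d - 1) \<union> {\<sigma>. present \<sigma>})
       (Pi_pmf (d_simplices n d) False (\<lambda>_. bernoulli_pmf p))"

definition expected_homology_rank :: "'k::idom itself \<Rightarrow> nat \<Rightarrow> nat \<Rightarrow> nat \<Rightarrow> real \<Rightarrow> real" where
  "expected_homology_rank k q n d p =
     measure_pmf.expectation (lm_pmf n d p) (\<lambda>K. real (reduced_homology_rank k K q))"

end

theory Submission
  imports Defs
begin

text \<open>
  Let \<open>\<Lambda>\<close> be the exterior algebra. The Koszul complex of the elements \<open>x\<^sub>t \<otimes> 1 - 1 \<otimes> x\<^sub>t\<close> on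
  \<open>S \<otimes> \<Lambda> \<otimes> S/I\<close> is a free resolution of the Stanley--Reisner ring, over any coefficient domain.
  Modulo the variables it becomes a complex graded
  by multidegrees: it is acyclic in multidegrees that are not squarefree, and the simplicial cochain
  complex of \<open>K\<^sub>J\<close> in the multidegree of a vertex set \<open>J\<close>. Since the rank of \<open>Tor\<close> does not depend on the
  resolution, this is Hochster's formula, and the normalised Betti number is the average over all
  \<open>j\<close>-subsets \<open>J\<close> of a bounded function of the \<open>d\<close>-simplices inside \<open>J\<close>. Two such functions are
  independent unless the two subsets share at least \<open>d + 1 \<ge> 2\<close> vertices, so the variance of the average
  is \<open>O(n\<^sup>-\<^sup>2)\<close>. This is summable in \<open>n\<close>, which gives almost sure convergence whatever the joint
  distribution of the complexes for different \<open>n\<close>.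
\<close>

text \<open>The diagonal Koszul complex is chosen because killing the variables of its left factor
  leaves the Koszul complex of S/I: Tor is read off from a resolution of S/I without having to prove
  that Tor is balanced. The price is infinite bases, but only finitely many basis elements have a
  given internal degree, so the ranks stay finite. The differential involves both copies of the
  variables, while an explicit contraction is at hand only for the left copy. Its error lowers the
  degree of the left coefficients, so exactness follows by iteration. The squarefree pieces are
  cochain complexes whereas the claim concerns homology. Only ranks have to agree, and these are
  compared by a pairing and by linear forms with cleared denominators, so that no fraction field has
  to be constructed. Increasing relabellings turn every full subcomplex on j vertices into a complex
  on \<open>{1..j}\<close> and preserve all orientation signs. One function of the set of present
  \<open>d\<close>-simplices then serves all \<open>J\<close>, and its mean is a finite sum of terms
  \<open>p ^ a * (1 - p) ^ b\<close>, which explains both the common limit and its being a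
  polynomial.\<close>

abbreviation lookup where "lookup \<equiv> Poly_Mapping.lookup"
abbreviation keys where "keys \<equiv> Poly_Mapping.keys"
abbreviation single where "single \<equiv> Poly_Mapping.single"

section \<open>Linear maps between free modules\<close>

lemma lookup_scale [simp]: "lookup (scale c x) b = c * lookup x b"
  by (simp add: scale_def Poly_Mapping.map.rep_eq when_def)

lemma scale_zero [simp]: "scale c 0 = 0"
  and scale_zero_left [simp]: "scale 0 x = 0"
  and scale_one [simp]: "scale 1 x = x"
  and scale_scale [simp]: "scale c (scale d x) = scale (c * d) x"
  and scale_add: "scale c (x + y) = scale c x + scale c y"
  and scale_add_left: "scale (c + d) x = scale c x + scale d x"
  and scale_diff: "scale c (x - y) = scale c x - scale c y"
  and scale_diff_left: "scale (c - d) x = scale c x - scale d x"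
  and scale_minus: "scale c (- x) = - scale c x"
  and scale_minus_left: "scale (- c) x = - scale c x"
  by (auto intro!: poly_mapping_eqI simp: lookup_add lookup_minus algebra_simps)

lemma scale_single [simp]: "scale c (single b d) = single b (c * d)"
  by (auto intro!: poly_mapping_eqI simp: lookup_single when_def)

lemma scale_sum: "scale c (sum f A) = (\<Sum>a\<in>A. scale c (f a))"
  by (induction A rule: infinite_finite_induct) (auto simp: scale_add)

lemma scale_sum_left: "scale (sum f A) x = (\<Sum>a\<in>A. scale (f a) x)"
  by (induction A rule: infinite_finite_induct) (auto simp: scale_add_left)

lemma keys_scale: "keys (scale c x) \<subseteq> keys x"
  by (auto simp: in_keys_iff)

lemma keys_minus_subset: "keys (x - y) \<subseteq> keys x \<union> keys (y :: 'b \<Rightarrow>\<^sub>0 'r::ab_group_add)"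
  by (auto simp: in_keys_iff lookup_minus)

lemma keys_sum_subset: "keys (sum f A) \<subseteq> (\<Union>a\<in>A. keys (f a :: 'b \<Rightarrow>\<^sub>0 'r::comm_monoid_add))"
  by (induction A rule: infinite_finite_induct) (use keys_add in fastforce)+

lemma poly_mapping_sum_single:
  assumes "finite A" "keys x \<subseteq> A"
  shows "x = (\<Sum>b\<in>A. single b (lookup x b))"
  using assms
  by (auto intro!: poly_mapping_eqI simp: lookup_sum lookup_single when_def sum.delta in_keys_iff)

section \<open>Additive maps determined on single basis elements\<close>

lemma additive_sum:
  fixes f :: "'a::ab_group_add \<Rightarrow> 'b::ab_group_add"
  assumes "\<And>x y. f (x + y) = f x + f y"
  shows "f (sum g A) = (\<Sum>a\<in>A. f (g a))"
proof -
  have "f 0 = 0" using assms[of 0 0] by simp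
  then show ?thesis by (induction A rule: infinite_finite_induct) (auto simp: assms)
qed

lemma additive_diff:
  fixes f :: "'a::ab_group_add \<Rightarrow> 'b::ab_group_add"
  assumes "\<And>x y. f (x + y) = f x + f y"
  shows "f (x - y) = f x - f y"
  by (metis assms add_diff_cancel diff_add_cancel)

text \<open>An element is the sum of its one-term parts, so additivity alone suffices for the
  comparison. Restricting \<open>b\<close> to the keys of \<open>x\<close> makes support conditions
  on \<open>x\<close> available in the check.\<close>

lemma additive_eqI:
  fixes f g :: "('b \<Rightarrow>\<^sub>0 'r::ab_group_add) \<Rightarrow> 'c::ab_group_add"
  assumes "\<And>x y. f (x + y) = f x + f y" "\<And>x y. g (x + y) = g x + g y"
    and "\<And>b r. b \<in> keys x \<Longrightarrow> r = lookup x b \<Longrightarrow> f (single b r) = g (single b r)"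
  shows "f x = g x"
proof -
  have x: "x = (\<Sum>b\<in>keys x. single b (lookup x b))"
    by (rule poly_mapping_sum_single) auto
  show ?thesis
    by (subst (1 2) x) (use assms in \<open>simp add: additive_sum[of f] additive_sum[of g]\<close>)
qed

text \<open>More general than \<open>lin_ext\<close>: the coefficient enters through an arbitrary
  additive function. This covers maps such as \<open>restrict_keys\<close> and \<open>htpy\<close>,
  the latter of which is not linear over the polynomial ring.\<close>

definition additive_ext :: "('b \<Rightarrow> 'r::ab_group_add \<Rightarrow> 'c::ab_group_add) \<Rightarrow> ('b \<Rightarrow>\<^sub>0 'r) \<Rightarrow> 'c" where
  "additive_ext f x = (\<Sum>b\<in>keys x. f b (lookup x b))"

lemma additive_ext_superset:
  assumes "\<And>b. f b 0 = 0" "finite A" "keys x \<subseteq> A"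
  shows "additive_ext f x = (\<Sum>b\<in>A. f b (lookup x b))"
  unfolding additive_ext_def using assms
  by (intro sum.mono_neutral_left) (auto simp: in_keys_iff)

lemma additive_ext_add:
  assumes "\<And>b r s. f b (r + s) = f b r + f b s"
  shows "additive_ext f (x + y) = additive_ext f x + additive_ext f y"
proof -
  have 0: "f b 0 = 0" for b using assms[of b 0 0] by simp
  let ?A = "keys x \<union> keys y"
  have "additive_ext f z = (\<Sum>b\<in>?A. f b (lookup z b))" if "keys z \<subseteq> ?A" for z
    using that by (intro additive_ext_superset) (auto simp: 0)
  moreover have "keys (x + y) \<subseteq> ?A" by (rule keys_add)
  ultimately show ?thesis by (simp add: lookup_add assms sum.distrib)
qed

lemma additive_ext_single:
  assumes "f b 0 = 0"
  shows "additive_ext f (single b r) = f b r"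
  by (cases "r = 0") (auto simp: additive_ext_def assms)

lemma lin_ext_eq: "lin_ext D = additive_ext (\<lambda>b r. scale r (D b))"
  by (auto simp: lin_ext_def additive_ext_def)

lemma lin_ext_superset:
  assumes "finite A" "keys x \<subseteq> A"
  shows "lin_ext D x = (\<Sum>b\<in>A. scale (lookup x b) (D b))"
  unfolding lin_ext_eq using assms by (intro additive_ext_superset) auto

lemma lin_ext_add: "lin_ext D (x + y) = lin_ext D x + lin_ext D y"
  unfolding lin_ext_eq by (rule additive_ext_add) (simp add: scale_add_left)

lemma lin_ext_single [simp]: "lin_ext D (single b r) = scale r (D b)"
  unfolding lin_ext_eq by (rule additive_ext_single) simp

lemma lin_ext_zero [simp]: "lin_ext D 0 = 0"
  by (simp add: lin_ext_def)

lemmas lin_ext_sum = additive_sum[of "lin_ext D" for D, OF lin_ext_add]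
lemmas lin_ext_diff = additive_diff[of "lin_ext D" for D, OF lin_ext_add]

lemma lin_ext_scale: "lin_ext D (scale c x) = scale c (lin_ext D x)"
  by (rule additive_eqI[of "\<lambda>x. lin_ext D (scale c x)" "\<lambda>x. scale c (lin_ext D x)"])
     (simp_all add: scale_add lin_ext_add)

lemma lin_ext_comp: "lin_ext E (lin_ext D x) = lin_ext (\<lambda>b. lin_ext E (D b)) x"
  by (rule additive_eqI[of "\<lambda>x. lin_ext E (lin_ext D x)"])
     (simp_all add: lin_ext_add lin_ext_scale)

lemma lin_ext_cong: "(\<And>b. b \<in> keys x \<Longrightarrow> D b = E b) \<Longrightarrow> lin_ext D x = lin_ext E x"
  by (simp add: lin_ext_def)

lemma lin_ext_single_one [simp]: "lin_ext (\<lambda>b. single b 1) x = x"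
  by (rule additive_eqI[of "lin_ext (\<lambda>b. single b 1)" "\<lambda>x. x"]) (auto simp: lin_ext_add)

lemma lin_ext_fun_diff: "lin_ext (\<lambda>b. D b - E b) x = lin_ext D x - lin_ext E x"
  by (simp add: lin_ext_def scale_diff sum_subtractf)

lemma lin_ext_fun_add: "lin_ext (\<lambda>b. D b + E b) x = lin_ext D x + lin_ext E x"
  by (simp add: lin_ext_def scale_add sum.distrib)

lemma keys_lin_ext: "keys (lin_ext D x) \<subseteq> (\<Union>b\<in>keys x. keys (D b))"
  unfolding lin_ext_def using keys_scale by (fastforce dest: subsetD[OF keys_sum_subset])

lemma free_module_UNIV [simp]: "x \<in> free_module UNIV B \<longleftrightarrow> keys x \<subseteq> B"
  by (simp add: free_module_def)

section \<open>Ranks over a domain\<close>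

definition submodule :: "('b \<Rightarrow>\<^sub>0 'k::idom) set \<Rightarrow> bool" where
  "submodule W \<longleftrightarrow> 0 \<in> W \<and> (\<forall>x\<in>W. \<forall>y\<in>W. x + y \<in> W) \<and> (\<forall>c. \<forall>x\<in>W. scale c x \<in> W)"

definition indep_mod :: "('b \<Rightarrow>\<^sub>0 'k::idom) set \<Rightarrow> ('b \<Rightarrow>\<^sub>0 'k) set \<Rightarrow> bool" where
  "indep_mod X W \<longleftrightarrow> (\<forall>c. (\<Sum>x\<in>X. scale (c x) x) \<in> W \<longrightarrow> (\<forall>x\<in>X. c x = 0))"

text \<open>The span over the fraction field modulo \<open>W\<close>, expressed without fractions:
  \<open>q\<close> is a common denominator. Together with \<open>indep_mod\<close> it describes
  bases of the quotient after tensoring with the fraction field.\<close>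

definition torsion_span :: "('b \<Rightarrow>\<^sub>0 'k::idom) set \<Rightarrow> ('b \<Rightarrow>\<^sub>0 'k) set \<Rightarrow> ('b \<Rightarrow>\<^sub>0 'k) set" where
  "torsion_span X W = {z. \<exists>q c. q \<noteq> 0 \<and> scale q z - (\<Sum>x\<in>X. scale (c x) x) \<in> W}"

lemma submodule_0: "submodule W \<Longrightarrow> 0 \<in> W"
  and submodule_add: "submodule W \<Longrightarrow> x \<in> W \<Longrightarrow> y \<in> W \<Longrightarrow> x + y \<in> W"
  and submodule_scale: "submodule W \<Longrightarrow> x \<in> W \<Longrightarrow> scale c x \<in> W"
  by (auto simp: submodule_def)

lemma submodule_sum: "submodule W \<Longrightarrow> (\<And>a. a \<in> A \<Longrightarrow> f a \<in> W) \<Longrightarrow> sum f A \<in> W"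
  by (induction A rule: infinite_finite_induct) (auto simp: submodule_def)

lemma submodule_diff: "submodule W \<Longrightarrow> x \<in> W \<Longrightarrow> y \<in> W \<Longrightarrow> x - y \<in> W"
  using submodule_add[of W x "scale (-1) y"] submodule_scale[of W y "-1"]
  by (simp add: scale_minus_left)

lemma submodule_image: "submodule (lin_ext D ` free_module UNIV B)"
proof -
  have "lin_ext D x + lin_ext D y \<in> lin_ext D ` free_module UNIV B"
    if "keys x \<subseteq> B" "keys y \<subseteq> B" for x y
    using that keys_add[of x y] by (intro image_eqI[of _ _ "x + y"]) (auto simp: lin_ext_add)
  moreover have "scale c (lin_ext D x) \<in> lin_ext D ` free_module UNIV B"
    if "keys x \<subseteq> B" for x c
    using that keys_scale[of c x] by (intro image_eqI[of _ _ "scale c x"]) (auto simp: lin_ext_scale)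
  moreover have "0 \<in> lin_ext D ` free_module UNIV B"
    by (rule image_eqI[of _ _ 0]) auto
  ultimately show ?thesis by (auto simp: submodule_def)
qed

text \<open>Gaussian elimination without division: columns are cross-multiplied with a pivot, so all
  coefficients stay in the domain.\<close>

lemma homogeneous_system:
  fixes a :: "'x \<Rightarrow> 'y \<Rightarrow> 'k::idom"
  assumes "finite Y" "finite X" "card Y < card X"
  shows "\<exists>c. (\<exists>x\<in>X. c x \<noteq> 0) \<and> (\<forall>y\<in>Y. (\<Sum>x\<in>X. c x * a x y) = 0)"
  using assms
proof (induction Y arbitrary: X a rule: finite_induct)
  case empty
  then obtain x where "x \<in> X" by fastforce
  then show ?case by (intro exI[of _ "\<lambda>_. 1"]) auto
next
  case (insert y Y)
  show ?case
  proof (cases "\<forall>x\<in>X. a x y = 0")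
    case True
    have "card Y < card X" using insert by simp
    with insert.IH[OF \<open>finite X\<close> this, of a] True show ?thesis by auto
  next
    case False
    then obtain x0 where x0: "x0 \<in> X" "a x0 y \<noteq> 0" by auto
    define X' where "X' = X - {x0}"
    have X': "finite X'" "X = insert x0 X'" "x0 \<notin> X'" "card Y < card X'"
      using insert x0 by (auto simp: X'_def)
    define a' where "a' = (\<lambda>x z. a x0 y * a x z - a x y * a x0 z)"
    obtain c' where c': "\<exists>x\<in>X'. c' x \<noteq> 0" "\<forall>z\<in>Y. (\<Sum>x\<in>X'. c' x * a' x z) = 0"
      using insert.IH[of X' a'] X' by blast
    \<comment> \<open>The value at the pivot column is forced by the equation \<open>y\<close>. The
      other values carry the factor \<open>a x0 y\<close>, which would otherwise have to be divided
      out.\<close>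
    define c where "c = (\<lambda>x. if x = x0 then - (\<Sum>x\<in>X'. c' x * a x y) else a x0 y * c' x)"
    have "(\<Sum>x\<in>X. c x * a x z) = (\<Sum>x\<in>X'. c' x * a' x z)" for z
    proof -
      have "(\<Sum>x\<in>X'. c x * a x z) = (\<Sum>x\<in>X'. a x0 y * c' x * a x z)"
        using X' by (intro sum.cong) (auto simp: c_def)
      then have "(\<Sum>x\<in>X. c x * a x z)
          = - (\<Sum>x\<in>X'. c' x * a x y) * a x0 z + (\<Sum>x\<in>X'. a x0 y * c' x * a x z)"
        using X' by (simp add: c_def)
      also have "\<dots> = (\<Sum>x\<in>X'. c' x * a' x z)"
        by (simp add: a'_def sum_distrib_right sum_distrib_left sum_subtractf algebra_simps)
      finally show ?thesis .
    qed
    moreover have "(\<Sum>x\<in>X'. c' x * a' x y) = 0" by (simp add: a'_def mult.commute)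
    moreover have "\<exists>x\<in>X. c x \<noteq> 0" using c' X' x0 by (auto simp: c_def)
    ultimately show ?thesis using c' by (intro exI[of _ c]) auto
  qed
qed

text \<open>Steinitz' bound by counting: multiples of the elements of \<open>X\<close> are expressed
  through \<open>Y\<close>, and with more unknowns than equations some nontrivial combination of
  them has all \<open>Y\<close>-coefficients zero, hence lies in \<open>W\<close>.\<close>

lemma card_le_torsion_span:
  assumes "finite X" "finite Y" "submodule W" "indep_mod X W" "X \<subseteq> torsion_span Y W"
  shows "card X \<le> card Y"
proof (rule ccontr)
  assume "\<not> card X \<le> card Y"
  have "\<forall>x\<in>X. \<exists>q a. q \<noteq> 0 \<and> scale q x - (\<Sum>y\<in>Y. scale (a y) y) \<in> W"
    using assms by (auto simp: torsion_span_def)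
  then obtain q a where qa: "\<And>x. x \<in> X \<Longrightarrow> q x \<noteq> 0"
      "\<And>x. x \<in> X \<Longrightarrow> scale (q x) x - (\<Sum>y\<in>Y. scale (a x y) y) \<in> W"
    by metis
  obtain c where c: "\<exists>x\<in>X. c x \<noteq> 0" "\<forall>y\<in>Y. (\<Sum>x\<in>X. c x * a x y) = 0"
    using homogeneous_system[OF assms(2,1), of a] \<open>\<not> card X \<le> card Y\<close> by auto
  have "(\<Sum>x\<in>X. scale (c x * q x) x)
      = (\<Sum>x\<in>X. scale (c x) (scale (q x) x - (\<Sum>y\<in>Y. scale (a x y) y)))
        + (\<Sum>y\<in>Y. scale (\<Sum>x\<in>X. c x * a x y) y)"
    by (simp add: scale_diff sum_subtractf scale_sum scale_sum_left sum.swap[of _ Y X])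
  also have "\<dots> = (\<Sum>x\<in>X. scale (c x) (scale (q x) x - (\<Sum>y\<in>Y. scale (a x y) y)))"
    using c by simp
  also have "\<dots> \<in> W" using qa assms by (intro submodule_sum submodule_scale) auto
  finally have "\<forall>x\<in>X. c x * q x = 0"
    using assms(4)[unfolded indep_mod_def, rule_format, of "\<lambda>x. c x * q x"] by blast
  with c qa show False by auto
qed

lemma quotient_rank_alt:
  "quotient_rank Z W = Sup {card X | X. finite X \<and> X \<subseteq> Z \<and> indep_mod X W}"
  by (simp add: quotient_rank_def indep_mod_def)

lemma quotient_rank_eq_card:
  assumes "finite X" "X \<subseteq> Z" "submodule W" "indep_mod X W" "Z \<subseteq> torsion_span X W"
  shows "quotient_rank Z W = card X"
  unfolding quotient_rank_alt
  by (rule cSup_eq_maximum) (use assms in \<open>auto intro: card_le_torsion_span\<close>)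

lemma inj_single_one: "single a (1::'k::zero_neq_one) = single b 1 \<longleftrightarrow> a = b"
  by (metis lookup_single_eq lookup_single_not_eq zero_neq_one)

lemma subset_torsion_span_singles:
  assumes "finite A" "submodule W" "Z \<subseteq> free_module UNIV A"
  shows "Z \<subseteq> torsion_span ((\<lambda>a. single a 1) ` A) W"
proof
  fix z assume "z \<in> Z"
  \<comment> \<open>Coefficients in \<open>torsion_span\<close> are indexed by vectors, so the
    coefficient of a basis vector is found through the index that it determines.\<close>
  define c where "c = (\<lambda>x. lookup z (THE a. x = single a (1::'b)))"
  have "(\<Sum>x\<in>(\<lambda>a. single a 1) ` A. scale (c x) x) = (\<Sum>a\<in>A. single a (lookup z a))"
    by (subst sum.reindex) (auto simp: inj_on_def c_def inj_single_one)
  also have "\<dots> = z"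
    using assms \<open>z \<in> Z\<close> by (intro poly_mapping_sum_single[symmetric]) (auto simp: free_module_def)
  finally show "z \<in> torsion_span ((\<lambda>a. single a 1) ` A) W"
    using submodule_0[OF assms(2)] by (auto simp: torsion_span_def intro!: exI[of _ 1] exI[of _ c])
qed

lemma indep_mod_card_le:
  assumes "finite A" "submodule W" "X \<subseteq> free_module UNIV A" "finite X" "indep_mod X W"
  shows "card X \<le> card A"
proof -
  have "card X \<le> card ((\<lambda>a. single a 1 :: _ \<Rightarrow>\<^sub>0 'b) ` A)"
    using assms by (intro card_le_torsion_span[OF _ _ assms(2) assms(5)] subset_torsion_span_singles) auto
  also have "\<dots> \<le> card A" using assms by (intro card_image_le)
  finally show ?thesis .
qed

text \<open>Independent sets have at most \<open>card A\<close> elements, so one of greatest size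
  exists. Enlarging it by \<open>z\<close> produces a relation in which the coefficient of
  \<open>z\<close> cannot vanish, and this coefficient is the denominator for
  \<open>z\<close>.\<close>

lemma rank_basis_exists:
  assumes "finite A" "submodule W" "Z \<subseteq> free_module UNIV A"
  obtains X where "finite X" "X \<subseteq> Z" "indep_mod X W" "Z \<subseteq> torsion_span X W"
    "card X = quotient_rank Z W"
proof -
  let ?P = "\<lambda>X. finite X \<and> X \<subseteq> Z \<and> indep_mod X W"
  have "?P {}" by (simp add: indep_mod_def)
  moreover have "\<forall>X. ?P X \<longrightarrow> card X \<le> card A"
    using assms indep_mod_card_le[of A W] by (auto simp del: free_module_UNIV)
  ultimately have "\<exists>X. ?P X \<and> (\<forall>X'. ?P X' \<longrightarrow> card X' \<le> card X)"
    by (intro ex_has_greatest_nat[of ?P "{}" card "Suc (card A)"]) (auto simp only: less_Suc_eq_le)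
  then obtain X where X: "?P X" "\<And>X'. ?P X' \<Longrightarrow> card X' \<le> card X"
    by metis
  have "z \<in> torsion_span X W" if z: "z \<in> Z" for z
  proof (cases "z \<in> X")
    case True
    have "(\<Sum>x\<in>X. scale (if x = z then 1 else 0) x) = z"
      using X(1) True by (simp add: if_distrib[of "\<lambda>c. scale c _"] sum.delta cong: if_cong)
    then show ?thesis using submodule_0[OF assms(2)]
      by (auto simp: torsion_span_def intro!: exI[of _ 1] exI[of _ "\<lambda>x. if x = z then 1 else 0"])
  next
    case False
    then have "\<not> ?P (insert z X)" using X(2)[of "insert z X"] X(1) by auto
    then have "\<not> indep_mod (insert z X) W" using X(1) z by auto
    then obtain c where c: "(\<Sum>x\<in>insert z X. scale (c x) x) \<in> W" "\<exists>x\<in>insert z X. c x \<noteq> 0"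
      by (auto simp: indep_mod_def)
    have sum: "scale (c z) z + (\<Sum>x\<in>X. scale (c x) x) \<in> W" using c(1) False X(1) by simp
    have "c z \<noteq> 0"
      using c(2) sum X(1) by (auto simp: indep_mod_def)
    moreover have "scale (c z) z - (\<Sum>x\<in>X. scale (- c x) x) \<in> W"
      using sum by (simp add: scale_minus_left sum_negf)
    ultimately show ?thesis by (auto simp: torsion_span_def)
  qed
  then have *: "Z \<subseteq> torsion_span X W" by blast
  show thesis
    using X(1) quotient_rank_eq_card[OF _ _ assms(2) _ *] by (intro that[of X] *) auto
qed

lemma indep_mod_notin:
  assumes "indep_mod X W" "finite X" "x \<in> X"
  shows "x \<notin> W"
proof
  assume "x \<in> W"
  moreover have "(\<Sum>y\<in>X. scale (if y = x then 1 else 0) y) = x"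
    using assms by (simp add: if_distrib[of "\<lambda>c. scale c _"] sum.delta cong: if_cong)
  ultimately have "\<forall>y\<in>X. (if y = x then 1 else 0) = (0 :: 'b)"
    using assms(1)[unfolded indep_mod_def, rule_format, of "\<lambda>y. if y = x then 1 else 0"] by auto
  then show False using assms(3) by auto
qed

lemma quotient_rank_self:
  assumes "Z \<subseteq> W" shows "quotient_rank Z W = 0"
proof -
  have "X = {}" if "finite X" "X \<subseteq> Z" "indep_mod X W" for X
    using that indep_mod_notin[of X W] assms by blast
  moreover have "indep_mod {} W" by (simp add: indep_mod_def)
  ultimately have "{card X |X. finite X \<and> X \<subseteq> Z \<and> indep_mod X W} = {0}"
    by (auto intro!: exI[of _ "{}"])
  then show ?thesis by (simp add: quotient_rank_alt)
qed

lemma torsion_span_add: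
  assumes "submodule W" "x \<in> torsion_span X W" "y \<in> torsion_span X W"
  shows "x + y \<in> torsion_span X W"
proof -
  obtain q c where q: "q \<noteq> 0" "scale q x - (\<Sum>x\<in>X. scale (c x) x) \<in> W"
    using assms by (auto simp: torsion_span_def)
  obtain r d where r: "r \<noteq> 0" "scale r y - (\<Sum>x\<in>X. scale (d x) x) \<in> W"
    using assms by (auto simp: torsion_span_def)
  have "scale r (scale q x - (\<Sum>x\<in>X. scale (c x) x)) + scale q (scale r y - (\<Sum>x\<in>X. scale (d x) x)) \<in> W"
    using q r assms by (intro submodule_add submodule_scale)
  also have "scale r (scale q x - (\<Sum>x\<in>X. scale (c x) x)) + scale q (scale r y - (\<Sum>x\<in>X. scale (d x) x))
     = scale (q * r) (x + y) - (\<Sum>x\<in>X. scale (r * c x + q * d x) x)"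
    by (simp add: scale_add scale_diff scale_sum scale_add_left sum.distrib mult.commute)
  finally show ?thesis using q r unfolding torsion_span_def
    by (intro CollectI exI[of _ "q * r"] exI[of _ "\<lambda>x. r * c x + q * d x"]) auto
qed

lemma torsion_span_sum:
  assumes "submodule W" "\<And>a. a \<in> A \<Longrightarrow> f a \<in> torsion_span X W"
  shows "sum f A \<in> torsion_span X W"
proof -
  have "0 \<in> torsion_span X W"
    using submodule_0[OF assms(1)] unfolding torsion_span_def
    by (intro CollectI exI[of _ 1] exI[of _ "\<lambda>_. 0"]) auto
  then show ?thesis using assms(2)
    by (induction A rule: infinite_finite_induct) (auto intro: torsion_span_add[OF assms(1)])
qed

section \<open>Ranks of graded quotients\<close>

definition restrict_keys :: "('b \<Rightarrow> bool) \<Rightarrow> ('b \<Rightarrow>\<^sub>0 'r::ab_group_add) \<Rightarrow> 'b \<Rightarrow>\<^sub>0 'r" where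
  "restrict_keys P = additive_ext (\<lambda>b r. if P b then single b r else 0)"

lemma restrict_keys_add: "restrict_keys P (x + y) = restrict_keys P x + restrict_keys P y"
  unfolding restrict_keys_def by (rule additive_ext_add) (simp add: single_add)

lemma lookup_restrict_keys: "lookup (restrict_keys P x) b = (if P b then lookup x b else 0)"
proof -
  have "lookup (restrict_keys P x) b = (\<Sum>a\<in>keys x. if a = b then (if P b then lookup x b else 0) else 0)"
    unfolding restrict_keys_def additive_ext_def lookup_sum
    by (intro sum.cong) (auto simp: lookup_single)
  then show ?thesis by (simp add: in_keys_iff)
qed

lemma keys_restrict_keys: "keys (restrict_keys P x) = {b \<in> keys x. P b}"
  by (auto simp: in_keys_iff lookup_restrict_keys split: if_splits)

lemma restrict_keys_scale: "restrict_keys P (scale c x) = scale c (restrict_keys P x)"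
  by (rule poly_mapping_eqI) (simp add: lookup_restrict_keys)

lemma restrict_keys_id: "(\<And>b. b \<in> keys x \<Longrightarrow> P b) \<Longrightarrow> restrict_keys P x = x"
  by (rule poly_mapping_eqI) (auto simp: lookup_restrict_keys in_keys_iff)

lemma restrict_keys_0: "(\<And>b. b \<in> keys x \<Longrightarrow> \<not> P b) \<Longrightarrow> restrict_keys P x = 0"
  by (rule poly_mapping_eqI) (auto simp: lookup_restrict_keys in_keys_iff)

lemma submodule_graded_part:
  assumes "submodule W"
  shows "submodule {w \<in> W. \<forall>b\<in>keys w. \<gamma> b = g}"
  unfolding submodule_def
proof (intro conjI ballI allI)
  show "0 \<in> {w \<in> W. \<forall>b\<in>keys w. \<gamma> b = g}" using submodule_0[OF assms] by simp
next
  fix x y assume "x \<in> {w \<in> W. \<forall>b\<in>keys w. \<gamma> b = g}" "y \<in> {w \<in> W. \<forall>b\<in>keys w. \<gamma> b = g}"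
  then show "x + y \<in> {w \<in> W. \<forall>b\<in>keys w. \<gamma> b = g}"
    using keys_add[of x y] submodule_add[OF assms, of x y] by blast
next
  fix c x assume "x \<in> {w \<in> W. \<forall>b\<in>keys w. \<gamma> b = g}"
  then show "scale c x \<in> {w \<in> W. \<forall>b\<in>keys w. \<gamma> b = g}"
    using keys_scale[of c x] submodule_scale[OF assms, of x c] by blast
qed

text \<open>Bases of the graded pieces are pairwise disjoint, because a nonzero element has at most
  one degree, and their union is a basis: projecting a relation to degree \<open>g\<close> isolates
  the part that involves \<open>X g\<close>.\<close>

lemma quotient_rank_graded:
  fixes \<gamma> :: "'b \<Rightarrow> 'g" and Z W :: "('b \<Rightarrow>\<^sub>0 'k::idom) set"
  assumes "finite A" "finite G" "\<gamma> ` A \<subseteq> G" "Z \<subseteq> free_module UNIV A" "submodule W"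
    and Z: "\<And>g z. z \<in> Z \<Longrightarrow> restrict_keys (\<lambda>b. \<gamma> b = g) z \<in> Z"
    and W: "\<And>g w. w \<in> W \<Longrightarrow> restrict_keys (\<lambda>b. \<gamma> b = g) w \<in> W"
  shows "quotient_rank Z W = (\<Sum>g\<in>G. quotient_rank {z \<in> Z. \<forall>b\<in>keys z. \<gamma> b = g} {w \<in> W. \<forall>b\<in>keys w. \<gamma> b = g})"
proof -
  define P where "P g = (restrict_keys (\<lambda>b. \<gamma> b = g) :: ('b \<Rightarrow>\<^sub>0 'k) \<Rightarrow> _)" for g
  define Zg where "Zg g = {z \<in> Z. \<forall>b\<in>keys z. \<gamma> b = g}" for g
  define Wg where "Wg g = {w \<in> W. \<forall>b\<in>keys w. \<gamma> b = g}" for g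
  have sub: "submodule (Wg g)" for g
    unfolding Wg_def using \<open>submodule W\<close> by (rule submodule_graded_part)
  have "\<exists>X. finite X \<and> X \<subseteq> Zg g \<and> indep_mod X (Wg g) \<and> Zg g \<subseteq> torsion_span X (Wg g)
      \<and> card X = quotient_rank (Zg g) (Wg g)" for g
  proof -
    have "Zg g \<subseteq> free_module UNIV A" using \<open>Z \<subseteq> _\<close> unfolding Zg_def by blast
    then show ?thesis by (rule rank_basis_exists[OF \<open>finite A\<close> sub]) blast
  qed
  then have "\<exists>X. \<forall>g. finite (X g) \<and> X g \<subseteq> Zg g \<and> indep_mod (X g) (Wg g)
      \<and> Zg g \<subseteq> torsion_span (X g) (Wg g) \<and> card (X g) = quotient_rank (Zg g) (Wg g)"
    by (intro choice allI)
  then obtain X where X: "\<And>g. finite (X g)" "\<And>g. X g \<subseteq> Zg g" "\<And>g. indep_mod (X g) (Wg g)"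
     "\<And>g. Zg g \<subseteq> torsion_span (X g) (Wg g)" "\<And>g. card (X g) = quotient_rank (Zg g) (Wg g)"
    by blast
  have nonzero: "x \<noteq> 0" if "x \<in> X g" for x g
    using indep_mod_notin[OF X(3,1) that] submodule_0[OF sub[of g]] by metis
  have disj: "X g \<inter> X h = {}" if "g \<noteq> h" for g h
  proof (rule ccontr)
    assume "X g \<inter> X h \<noteq> {}"
    then obtain x where x: "x \<in> X g" "x \<in> X h" by auto
    then obtain b where "b \<in> keys x" using nonzero[of x g] by fastforce
    moreover have "x \<in> Zg g" "x \<in> Zg h" using x X(2) by blast+
    ultimately show False using that by (auto simp: Zg_def)
  qed
  define U where "U = (\<Union>g\<in>G. X g)"
  have Pg: "P g x = (if g = h then x else 0)" if "x \<in> X h" for g h x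
  proof -
    have "\<forall>b\<in>keys x. \<gamma> b = h" using that X(2)[of h] unfolding Zg_def by blast
    then show ?thesis unfolding P_def by (auto intro: restrict_keys_id restrict_keys_0)
  qed
  have sumU: "sum f U = (\<Sum>h\<in>G. sum f (X h))" for f :: "('b \<Rightarrow>\<^sub>0 'k) \<Rightarrow> ('b \<Rightarrow>\<^sub>0 'k)"
    unfolding U_def using \<open>finite G\<close> X(1) disj by (intro sum.UNION_disjoint) auto
  have P_sum: "P g (\<Sum>x\<in>U. scale (c x) x) = (\<Sum>x\<in>X g. scale (c x) x)" if "g \<in> G" for g c
  proof -
    have "P g (\<Sum>x\<in>U. scale (c x) x) = (\<Sum>x\<in>U. scale (c x) (P g x))"
      unfolding P_def by (subst additive_sum) (simp_all add: restrict_keys_add restrict_keys_scale)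
    also have "\<dots> = (\<Sum>h\<in>G. \<Sum>x\<in>X h. scale (c x) (P g x))" by (rule sumU)
    also have "\<dots> = (\<Sum>h\<in>G. if h = g then (\<Sum>x\<in>X g. scale (c x) x) else 0)"
      by (intro sum.cong) (auto simp: Pg)
    finally show ?thesis using that \<open>finite G\<close> by simp
  qed
  have "indep_mod U W"
    unfolding indep_mod_def
  proof (intro allI impI ballI)
    fix c x assume c: "(\<Sum>x\<in>U. scale (c x) x) \<in> W" and "x \<in> U"
    then obtain g where g: "g \<in> G" "x \<in> X g" by (auto simp: U_def)
    have "(\<Sum>x\<in>X g. scale (c x) x) \<in> W"
      using W[OF c, of g] P_sum[OF g(1), of c] by (simp add: P_def)
    moreover have "\<forall>b\<in>keys (\<Sum>x\<in>X g. scale (c x) x). \<gamma> b = g"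
      unfolding P_sum[OF g(1), symmetric] P_def by (auto simp: keys_restrict_keys)
    ultimately show "c x = 0" using X(3)[of g] g by (auto simp: indep_mod_def Wg_def)
  qed
  moreover have "Z \<subseteq> torsion_span U W"
  proof
    fix z assume z: "z \<in> Z"
    have "z = (\<Sum>g\<in>G. P g z)"
    proof (rule poly_mapping_eqI)
      fix b
      show "lookup z b = lookup (\<Sum>g\<in>G. P g z) b"
        using z assms(1-4)
        by (cases "b \<in> keys z") (auto simp: lookup_sum P_def lookup_restrict_keys sum.delta' in_keys_iff subset_iff)
    qed
    moreover have "P g z \<in> torsion_span U W" if "g \<in> G" for g
    proof -
      have "P g z \<in> Zg g" using Z[OF z, of g] by (auto simp: P_def Zg_def keys_restrict_keys)
      then obtain q c where qc: "q \<noteq> 0" "scale q (P g z) - (\<Sum>x\<in>X g. scale (c x) x) \<in> Wg g"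
        using X(4)[of g] by (auto simp: torsion_span_def)
      \<comment> \<open>Extending the coefficients by zero turns a combination over
        \<open>X g\<close> into one over \<open>U\<close>; disjointness removes the other
        summands.\<close>
      have "(\<Sum>x\<in>U. scale (if x \<in> X g then c x else 0) x) = (\<Sum>x\<in>X g. scale (c x) x)"
        unfolding sumU
      proof -
        have "(\<Sum>h\<in>G. \<Sum>x\<in>X h. scale (if x \<in> X g then c x else 0) x)
            = (\<Sum>h\<in>G. if h = g then (\<Sum>x\<in>X g. scale (c x) x) else 0)"
        proof (intro sum.cong refl)
          fix h
          show "(\<Sum>x\<in>X h. scale (if x \<in> X g then c x else 0) x)
              = (if h = g then (\<Sum>x\<in>X g. scale (c x) x) else 0)"
          proof (cases "h = g")
            case False
            then have "x \<notin> X g" if "x \<in> X h" for x using disj[of h g] that by blast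
            then show ?thesis using False by (auto intro!: sum.neutral)
          qed (auto intro!: sum.cong)
        qed
        then show "(\<Sum>h\<in>G. \<Sum>x\<in>X h. scale (if x \<in> X g then c x else 0) x) = (\<Sum>x\<in>X g. scale (c x) x)"
          using that \<open>finite G\<close> by simp
      qed
      then show ?thesis using qc unfolding torsion_span_def Wg_def
        by (intro CollectI exI[of _ q] exI[of _ "\<lambda>x. if x \<in> X g then c x else 0"]) auto
    qed
    ultimately show "z \<in> torsion_span U W"
      using torsion_span_sum[OF \<open>submodule W\<close>, of G "\<lambda>g. P g z"] by simp
  qed
  moreover have "finite U" "U \<subseteq> Z" using \<open>finite G\<close> X by (auto simp: U_def Zg_def)
  ultimately have "quotient_rank Z W = card U"
    using \<open>submodule W\<close> by (intro quotient_rank_eq_card)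
  also have "\<dots> = (\<Sum>g\<in>G. card (X g))"
    unfolding U_def using \<open>finite G\<close> X(1) disj by (intro card_UN_disjoint) auto
  finally show ?thesis using X(5) by (simp add: Zg_def Wg_def)
qed

section \<open>Duality of ranks\<close>

definition linear_form :: "('b \<Rightarrow> 'k::idom) \<Rightarrow> ('b \<Rightarrow>\<^sub>0 'k) \<Rightarrow> 'k" where
  "linear_form F = additive_ext (\<lambda>b r. r * F b)"

lemma linear_form_add: "linear_form F (x + y) = linear_form F x + linear_form F y"
  unfolding linear_form_def by (rule additive_ext_add) (simp add: algebra_simps)

lemma linear_form_scale: "linear_form F (scale c x) = c * linear_form F x"
  by (rule additive_eqI[of "\<lambda>x. linear_form F (scale c x)"])
     (simp_all add: scale_add linear_form_add algebra_simps, simp add: linear_form_def additive_ext_single)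

lemmas linear_form_diff = additive_diff[of "linear_form F" for F, OF linear_form_add]

lemma linear_form_combination:
  "linear_form (\<lambda>b. c * F b - d * G b) x = c * linear_form F x - d * linear_form G x"
  by (simp add: linear_form_def additive_ext_def sum_distrib_left sum_subtractf algebra_simps)

text \<open>Over a fraction field this is the fact that a vector outside a subspace is detected by a
  functional vanishing on the subspace. If \<open>m\<close> depends on \<open>S\<close>, either
  alternative for \<open>S\<close> passes to \<open>insert m S\<close>; otherwise a form
  \<open>G\<close> detecting \<open>m\<close> is used to correct both the vector and the
  functional.\<close>

lemma separating_linear_form:
  fixes z :: "'b \<Rightarrow>\<^sub>0 'k::idom"
  assumes "finite S"
  shows "(\<exists>q c. q \<noteq> 0 \<and> scale q z = (\<Sum>s\<in>S. scale (c s) s))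
       \<or> (\<exists>F. (\<forall>s\<in>S. linear_form F s = 0) \<and> linear_form F z \<noteq> 0)"
  using assms
proof (induction S arbitrary: z rule: finite_induct)
  case empty
  show ?case
  proof (cases "z = 0")
    case True
    then show ?thesis by (intro disjI1 exI[of _ 1]) auto
  next
    case False
    then obtain b where "b \<in> keys z" by fastforce
    then have "linear_form (\<lambda>a. if a = b then 1 else 0) z \<noteq> 0"
      by (simp add: linear_form_def additive_ext_def if_distrib[of "\<lambda>x. _ * x"] sum.delta in_keys_iff cong: if_cong)
    then show ?thesis by blast
  qed
next
  case (insert m S)
  consider (1) q c where "q \<noteq> 0" "scale q m = (\<Sum>s\<in>S. scale (c s) s)"
    | (2) G where "\<forall>s\<in>S. linear_form G s = 0" "linear_form G m \<noteq> 0"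
    using insert.IH[of m] by blast
  then show ?case
  proof cases
    case 1
    show ?thesis using insert.IH[of z]
    proof (elim disjE exE conjE)
      fix r d assume "r \<noteq> 0" "scale r z = (\<Sum>s\<in>S. scale (d s) s)"
      then show ?thesis using insert.hyps
        by (intro disjI1 exI[of _ r] exI[of _ "d(m := 0)"]) (auto intro!: sum.cong)
    next
      fix F assume F: "\<forall>s\<in>S. linear_form F s = 0" "linear_form F z \<noteq> 0"
      have "q * linear_form F m = linear_form F (\<Sum>s\<in>S. scale (c s) s)"
        by (simp flip: 1(2) add: linear_form_scale)
      also have "\<dots> = 0"
        using F(1) by (subst additive_sum) (simp_all add: linear_form_add linear_form_scale)
      finally show ?thesis using F 1(1) by auto
    qed
  next
    case 2
    define g where "g = linear_form G m"
    \<comment> \<open>Multiplied by \<open>g\<close> to avoid a quotient, \<open>z\<close> is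
      corrected by \<open>m\<close> so that \<open>G\<close> vanishes on it.\<close>
    define z' where "z' = scale g z - scale (linear_form G z) m"
    show ?thesis using insert.IH[of z']
    proof (elim disjE exE conjE)
      fix q c assume q: "q \<noteq> 0" "scale q z' = (\<Sum>s\<in>S. scale (c s) s)"
      define c' where "c' = c(m := q * linear_form G z)"
      have "scale (q * g) z = scale q z' + scale (q * linear_form G z) m"
        by (simp add: z'_def scale_diff)
      also have "\<dots> = (\<Sum>s\<in>insert m S. scale (c' s) s)"
        using insert.hyps by (auto simp: q c'_def add.commute intro!: sum.cong)
      finally show ?thesis using q 2 by (intro disjI1 exI[of _ "q * g"] exI[of _ c']) (auto simp: g_def)
    next
      fix F assume F: "\<forall>s\<in>S. linear_form F s = 0" "linear_form F z' \<noteq> 0"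
      \<comment> \<open>The dual correction: \<open>F'\<close> vanishes on \<open>m\<close>, and its
        value at \<open>z\<close> is that of \<open>F\<close> at \<open>z'\<close>.\<close>
      define F' where "F' = (\<lambda>b. g * F b - linear_form F m * G b)"
      have F': "linear_form F' x = g * linear_form F x - linear_form F m * linear_form G x" for x
        unfolding F'_def by (rule linear_form_combination)
      have "linear_form F' z = linear_form F z'"
        by (simp add: F' z'_def linear_form_diff linear_form_scale mult.commute)
      moreover have "\<forall>s\<in>insert m S. linear_form F' s = 0" using F 2 by (auto simp: F' g_def)
      ultimately show ?thesis using F by (intro disjI2 exI[of _ F']) auto
    qed
  qed
qed

section \<open>Dual complexes and their pairing\<close>

definition pairing :: "'a set \<Rightarrow> ('a \<Rightarrow> 'k::idom) \<Rightarrow> ('a \<Rightarrow> 'b) \<Rightarrow> ('a \<Rightarrow> 'c) \<Rightarrow> ('b \<Rightarrow>\<^sub>0 'k) \<Rightarrow> ('c \<Rightarrow>\<^sub>0 'k) \<Rightarrow> 'k" where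
  "pairing A w f g x y = (\<Sum>a\<in>A. w a * lookup x (f a) * lookup y (g a))"

lemma pairing_swap: "pairing A w f g x y = pairing A w g f y x"
  unfolding pairing_def by (intro sum.cong) (simp_all add: mult_ac)

lemma pairing_add: "pairing A w f g (x + x') y = pairing A w f g x y + pairing A w f g x' y"
  by (simp add: pairing_def lookup_add algebra_simps sum.distrib)

lemma pairing_scale: "pairing A w f g (scale c x) y = c * pairing A w f g x y"
  by (simp add: pairing_def algebra_simps sum_distrib_left)

lemma pairing_sum_left: "pairing A w f g (\<Sum>x\<in>X. scale (c x) (h x)) y = (\<Sum>x\<in>X. c x * pairing A w f g (h x) y)"
  by (subst additive_sum[of "\<lambda>x. pairing A w f g x y"]) (simp_all add: pairing_add pairing_scale)

lemma pairing_sum_right: "pairing A w f g x (\<Sum>y\<in>Y. scale (c y) (h y)) = (\<Sum>y\<in>Y. c y * pairing A w f g x (h y))"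
  by (simp add: pairing_swap[of A w f] pairing_sum_left)

text \<open>If \<open>X\<close> were larger than \<open>Y\<close>, a nontrivial combination
  \<open>z\<close> of \<open>X\<close> would pair to zero with \<open>Y\<close>, hence with all of
  \<open>Z'\<close>. A linear form that vanishes on all \<open>D b\<close> is represented by an
  element of \<open>Z'\<close>, so it vanishes at \<open>z\<close>. By
  \<open>separating_linear_form\<close> a nonzero multiple of \<open>z\<close> lies in
  \<open>W\<close>, against the independence of \<open>X\<close>.\<close>

lemma quotient_rank_dual_le:
  assumes "finite A" "inj_on f A" "inj_on g A" and w: "\<And>a. a \<in> A \<Longrightarrow> w a * w a = 1"
    and "finite S"
    and Z: "\<And>x. x \<in> Z \<longleftrightarrow> x \<in> free_module UNIV (f ` A) \<and> (\<forall>b\<in>T. pairing A w f g x (E b) = 0)"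
    and Z': "\<And>y. y \<in> Z' \<longleftrightarrow> y \<in> free_module UNIV (g ` A) \<and> (\<forall>b\<in>S. pairing A w f g (D b) y = 0)"
    and D: "\<And>b. b \<in> S \<Longrightarrow> D b \<in> free_module UNIV (f ` A)"
    and "W = lin_ext D ` free_module UNIV S" "W' = lin_ext E ` free_module UNIV T"
  shows "quotient_rank Z W \<le> quotient_rank Z' W'"
proof -
  let ?B = "pairing A w f g"
  have subZ: "Z \<subseteq> free_module UNIV (f ` A)" and subZ': "Z' \<subseteq> free_module UNIV (g ` A)"
    using Z Z' by blast+
  have W: "submodule W" "submodule W'" unfolding assms(9,10) by (rule submodule_image)+
  obtain X where X: "finite X" "X \<subseteq> Z" "indep_mod X W" "card X = quotient_rank Z W"
    by (rule rank_basis_exists[OF finite_imageI[OF \<open>finite A\<close>] W(1) subZ])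
  obtain Y where Y: "finite Y" "Y \<subseteq> Z'" "Z' \<subseteq> torsion_span Y W'" "card Y = quotient_rank Z' W'"
    by (rule rank_basis_exists[OF finite_imageI[OF \<open>finite A\<close>] W(2) subZ'])
  have "card X \<le> card Y"
  proof (rule ccontr)
    assume "\<not> card X \<le> card Y"
    then obtain c where c: "\<exists>x\<in>X. c x \<noteq> 0" "\<forall>y\<in>Y. (\<Sum>x\<in>X. c x * ?B x y) = 0"
      using homogeneous_system[OF Y(1) X(1), of ?B] by auto
    define z where "z = (\<Sum>x\<in>X. scale (c x) x)"
    have zE: "?B z (E b) = 0" if "b \<in> T" for b
      using that X(2) Z by (auto simp: z_def pairing_sum_left intro!: sum.neutral)
    have z_free: "z \<in> free_module UNIV (f ` A)"
      using X(2) subZ unfolding z_def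
      by (auto simp: subset_iff dest!: subsetD[OF keys_sum_subset] subsetD[OF keys_scale])
    have zW': "?B z y = 0" if y: "y \<in> W'" for y
    proof -
      obtain u where u: "y = lin_ext E u" "keys u \<subseteq> T" using y assms(10) by auto
      then show ?thesis using zE by (simp add: lin_ext_def pairing_sum_right subset_iff)
    qed
    have zZ': "?B z y = 0" if y: "y \<in> Z'" for y
    proof -
      obtain q d where q: "q \<noteq> 0" "scale q y - (\<Sum>y\<in>Y. scale (d y) y) \<in> W'"
        using y Y(3) by (auto simp: torsion_span_def)
      have "q * ?B z y = ?B z (scale q y - (\<Sum>y\<in>Y. scale (d y) y) + (\<Sum>y\<in>Y. scale (d y) y))"
        by (simp add: pairing_swap[of A w f g] pairing_scale)
      also have "\<dots> = (\<Sum>y\<in>Y. d y * ?B z y)"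
        using zW'[OF q(2)]
        by (simp only: pairing_swap[of A w f g] pairing_add) (simp add: pairing_sum_left)
      also have "\<dots> = 0" using c(2) by (simp add: z_def pairing_sum_left)
      finally show ?thesis using q(1) by simp
    qed
    show False using separating_linear_form[OF finite_imageI[OF \<open>finite S\<close>, of D], of z]
    proof (elim disjE exE conjE)
      fix q e assume q: "q \<noteq> 0" "scale q z = (\<Sum>s\<in>D ` S. scale (e s) s)"
      have "(\<Sum>s\<in>D ` S. scale (e s) s) \<in> W"
      proof (intro submodule_sum[OF W(1)] submodule_scale[OF W(1)])
        fix s assume "s \<in> D ` S"
        then obtain b where "b \<in> S" "s = D b" by auto
        then show "s \<in> W" unfolding assms(9) by (intro image_eqI[of _ _ "single b 1"]) auto
      qed
      then have "(\<Sum>x\<in>X. scale (q * c x) x) \<in> W"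
        by (simp flip: q(2) add: z_def scale_sum)
      then have "\<forall>x\<in>X. q * c x = 0"
        using X(3)[unfolded indep_mod_def, rule_format, of "\<lambda>x. q * c x"] by blast
      then show False using q(1) c(1) by auto
    next
      fix F assume F: "\<forall>s\<in>D ` S. linear_form F s = 0" "linear_form F z \<noteq> 0"
      \<comment> \<open>This element represents \<open>F\<close> under the pairing; the weight
        appears once more in the pairing and cancels because its square is 1.\<close>
      define y where "y = (\<Sum>a\<in>A. single (g a) (w a * F (f a)))"
      have lookup_y: "lookup y (g a) = w a * F (f a)" if "a \<in> A" for a
      proof -
        have "lookup y (g a) = (\<Sum>a'\<in>A. if a' = a then w a * F (f a) else 0)"
          unfolding y_def lookup_sum using that \<open>inj_on g A\<close>
          by (intro sum.cong) (auto simp: lookup_single when_def inj_on_def)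
        then show ?thesis using that \<open>finite A\<close> by simp
      qed
      have By: "?B x y = linear_form F x" if "x \<in> free_module UNIV (f ` A)" for x
      proof -
        have "?B x y = (\<Sum>a\<in>A. lookup x (f a) * F (f a))"
          unfolding pairing_def
        proof (intro sum.cong refl)
          fix a assume a: "a \<in> A"
          have "w a * lookup x (f a) * lookup y (g a) = (w a * w a) * (lookup x (f a) * F (f a))"
            by (simp add: lookup_y[OF a] mult_ac)
          then show "w a * lookup x (f a) * lookup y (g a) = lookup x (f a) * F (f a)"
            by (simp add: w[OF a])
        qed
        also have "\<dots> = (\<Sum>b\<in>f ` A. lookup x b * F b)"
          using \<open>inj_on f A\<close> by (simp add: sum.reindex)
        also have "\<dots> = linear_form F x"
          unfolding linear_form_def using that \<open>finite A\<close>
          by (intro additive_ext_superset[symmetric]) auto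
        finally show ?thesis .
      qed
      have "keys y \<subseteq> g ` A" unfolding y_def by (auto dest!: subsetD[OF keys_sum_subset] split: if_splits)
      then have "y \<in> Z'" using F D By by (auto simp: Z')
      then show False using zZ' By[OF z_free] F(2) by simp
    qed
  qed
  then show ?thesis using X Y by simp
qed

text \<open>
  The same cells index both complexes, via \<open>f\<close> and \<open>g\<close>; the weights \<open>w\<close> absorb signs.
\<close>

lemma quotient_rank_dual:
  assumes "finite A" "inj_on f A" "inj_on g A" and w: "\<And>a. a \<in> A \<Longrightarrow> w a * w a = 1"
    and "finite S" "finite T"
    and Z: "\<And>x. x \<in> Z \<longleftrightarrow> x \<in> free_module UNIV (f ` A) \<and> (\<forall>b\<in>T. pairing A w f g x (E b) = 0)"
    and Z': "\<And>y. y \<in> Z' \<longleftrightarrow> y \<in> free_module UNIV (g ` A) \<and> (\<forall>b\<in>S. pairing A w f g (D b) y = 0)"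
    and D: "\<And>b. b \<in> S \<Longrightarrow> D b \<in> free_module UNIV (f ` A)"
    and E: "\<And>b. b \<in> T \<Longrightarrow> E b \<in> free_module UNIV (g ` A)"
    and "W = lin_ext D ` free_module UNIV S" "W' = lin_ext E ` free_module UNIV T"
  shows "quotient_rank Z W = quotient_rank Z' W'"
proof (rule antisym)
  show "quotient_rank Z W \<le> quotient_rank Z' W'"
    by (rule quotient_rank_dual_le[OF assms(1-4,5,7-9,11-12)])
  show "quotient_rank Z' W' \<le> quotient_rank Z W"
    by (rule quotient_rank_dual_le[OF assms(1,3,2,4,6) _ _ E assms(12,11)])
       (simp_all add: Z Z' pairing_swap[of A w f g])
qed

section \<open>Polynomials and homogeneity\<close>

lemma poly_ring_0 [simp]: "0 \<in> poly_ring n"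
  and poly_ring_1 [simp]: "1 \<in> poly_ring n"
  by (auto simp: poly_ring_def)

lemma poly_ring_add: "f \<in> poly_ring n \<Longrightarrow> g \<in> poly_ring n \<Longrightarrow> f + g \<in> poly_ring n"
  by (auto simp: poly_ring_def dest!: subsetD[OF keys_add])

lemma poly_ring_diff: "f \<in> poly_ring n \<Longrightarrow> g \<in> poly_ring n \<Longrightarrow> f - g \<in> poly_ring n"
  by (auto simp: poly_ring_def dest!: subsetD[OF keys_minus_subset])

lemma keys_add_nat: "keys (m + m') = keys m \<union> keys (m' :: 'a \<Rightarrow>\<^sub>0 nat)"
  by (auto simp: in_keys_iff lookup_add)

lemma poly_ring_mult:
  assumes "f \<in> poly_ring n" "g \<in> poly_ring n"
  shows "f * g \<in> poly_ring n"
  unfolding poly_ring_def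
proof (intro CollectI ballI)
  fix m assume "m \<in> keys (f * g)"
  then obtain a b where "m = a + b" "a \<in> keys f" "b \<in> keys g"
    using keys_mult[of f g] by blast
  then show "keys m \<subseteq> {1..n}" using assms by (simp add: poly_ring_def keys_add_nat)
qed

lemma poly_ring_sum: "(\<And>a. a \<in> A \<Longrightarrow> f a \<in> poly_ring n) \<Longrightarrow> sum f A \<in> poly_ring n"
  by (induction A rule: infinite_finite_induct) (auto intro: poly_ring_add)

lemma poly_ring_restrict_keys: "f \<in> poly_ring n \<Longrightarrow> restrict_keys P f \<in> poly_ring n"
  by (auto simp: poly_ring_def keys_restrict_keys)

lemma monomial_degree_superset:
  "finite A \<Longrightarrow> keys m \<subseteq> A \<Longrightarrow> monomial_degree m = (\<Sum>i\<in>A. 2 * lookup m i)"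
  unfolding monomial_degree_def by (intro sum.mono_neutral_left) (auto simp: in_keys_iff)

lemma monomial_degree_add: "monomial_degree (m + m') = monomial_degree m + monomial_degree m'"
  by (simp add: monomial_degree_superset[of "keys m \<union> keys m'"] keys_add_nat lookup_add
      sum.distrib[symmetric])

lemma monomial_degree_0 [simp]: "monomial_degree 0 = 0"
  by (simp add: monomial_degree_def)

text \<open>Multiplication by the homogeneous \<open>g\<close> shifts degrees by
  \<open>d - a\<close>. The shift is written additively to avoid subtraction of naturals, and
  \<open>a\<close> and \<open>d\<close> will be degrees of basis elements.\<close>

lemma restrict_keys_mult:
  fixes f g :: "'k::idom mpoly"
  assumes g: "\<And>m. m \<in> keys g \<Longrightarrow> a + monomial_degree m = d"
  shows "restrict_keys (\<lambda>m. a + monomial_degree m = e) (f * g)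
       = restrict_keys (\<lambda>m. d + monomial_degree m = e) f * g"
proof (rule additive_eqI[of "\<lambda>f. restrict_keys (\<lambda>m. a + monomial_degree m = e) (f * g)"])
  fix s and r :: 'k
  show "restrict_keys (\<lambda>m. a + monomial_degree m = e) (single s r * g)
       = restrict_keys (\<lambda>m. d + monomial_degree m = e) (single s r) * g"
  proof (rule additive_eqI[of "\<lambda>g. restrict_keys (\<lambda>m. a + monomial_degree m = e) (single s r * g)"])
    fix m q assume "m \<in> keys g"
    then have "a + monomial_degree (s + m) = d + monomial_degree s"
      using g[of m] by (simp add: monomial_degree_add)
    then show "restrict_keys (\<lambda>m. a + monomial_degree m = e) (single s r * single m q)
       = restrict_keys (\<lambda>m. d + monomial_degree m = e) (single s r) * single m q"
      by (simp add: mult_single restrict_keys_def additive_ext_single)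
  qed (simp_all add: distrib_left restrict_keys_add)
qed (simp_all add: distrib_right restrict_keys_add)

section \<open>Homogeneous elements of graded free modules\<close>

definition homogeneous :: "('b \<Rightarrow> nat) \<Rightarrow> nat \<Rightarrow> ('b \<Rightarrow>\<^sub>0 'k::idom mpoly) \<Rightarrow> bool" where
  "homogeneous deg e x \<longleftrightarrow> (\<forall>b. \<forall>m\<in>keys (lookup x b). deg b + monomial_degree m = e)"

definition homogeneous_part :: "('b \<Rightarrow> nat) \<Rightarrow> nat \<Rightarrow> ('b \<Rightarrow>\<^sub>0 'k::idom mpoly) \<Rightarrow> ('b \<Rightarrow>\<^sub>0 'k mpoly)" where
  "homogeneous_part deg e x = Poly_Mapping.mapp (\<lambda>b. restrict_keys (\<lambda>m. deg b + monomial_degree m = e)) x"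

lemma restrict_keys_zero [simp]: "restrict_keys P 0 = 0"
  by (rule restrict_keys_0) simp

lemma lookup_homogeneous_part:
  "lookup (homogeneous_part deg e x) b = restrict_keys (\<lambda>m. deg b + monomial_degree m = e) (lookup x b)"
  by (auto simp: homogeneous_part_def lookup_mapp when_def in_keys_iff)

lemma keys_homogeneous_part: "keys (homogeneous_part deg e x) \<subseteq> keys x"
  by (auto simp: in_keys_iff lookup_homogeneous_part)

lemma homogeneous_homogeneous_part: "homogeneous deg e (homogeneous_part deg e x)"
  by (auto simp: homogeneous_def lookup_homogeneous_part keys_restrict_keys)

lemma homogeneous_part_id: "homogeneous deg e x \<Longrightarrow> homogeneous_part deg e x = x"
  by (rule poly_mapping_eqI) (auto simp: homogeneous_def lookup_homogeneous_part intro: restrict_keys_id)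

lemma homogeneous_add: "homogeneous deg e x \<Longrightarrow> homogeneous deg e y \<Longrightarrow> homogeneous deg e (x + y)"
  unfolding homogeneous_def by (auto simp: lookup_add dest!: subsetD[OF keys_add])

lemma homogeneous_diff: "homogeneous deg e x \<Longrightarrow> homogeneous deg e y \<Longrightarrow> homogeneous deg e (x - y)"
  unfolding homogeneous_def by (auto simp: lookup_minus dest!: subsetD[OF keys_minus_subset])

lemma homogeneous_single_one: "homogeneous deg (deg b) (single b 1)"
  by (auto simp: homogeneous_def lookup_single when_def split: if_splits)

text \<open>This allows a homogeneous preimage to be cut out of an arbitrary one.\<close>

lemma homogeneous_part_lin_ext:
  assumes "\<And>b. b \<in> keys x \<Longrightarrow> homogeneous deg' (deg b) (D b)"
  shows "lin_ext D (homogeneous_part deg e x) = homogeneous_part deg' e (lin_ext D x)"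
proof (rule poly_mapping_eqI)
  fix c
  have "lookup (lin_ext D (homogeneous_part deg e x)) c
      = (\<Sum>b\<in>keys x. restrict_keys (\<lambda>m. deg b + monomial_degree m = e) (lookup x b) * lookup (D b) c)"
    using keys_homogeneous_part[of deg e x]
    by (subst lin_ext_superset[of "keys x"]) (auto simp: lookup_sum lookup_homogeneous_part)
  also have "\<dots> = (\<Sum>b\<in>keys x. restrict_keys (\<lambda>m. deg' c + monomial_degree m = e) (lookup x b * lookup (D b) c))"
    using assms by (intro sum.cong refl restrict_keys_mult[symmetric]) (auto simp: homogeneous_def)
  also have "\<dots> = lookup (homogeneous_part deg' e (lin_ext D x)) c"
    by (subst additive_sum[of "restrict_keys P" for P, symmetric])
       (simp_all add: restrict_keys_add lookup_homogeneous_part lin_ext_def lookup_sum)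
  finally show "lookup (lin_ext D (homogeneous_part deg e x)) c
      = lookup (homogeneous_part deg' e (lin_ext D x)) c" .
qed

lemma homogeneous_lin_ext:
  assumes "homogeneous deg e x" "\<And>b. b \<in> keys x \<Longrightarrow> homogeneous deg' (deg b) (D b)"
  shows "homogeneous deg' e (lin_ext D x)"
proof -
  have "lin_ext D x = homogeneous_part deg' e (lin_ext D x)"
    using homogeneous_part_lin_ext[of x deg' deg D e, OF assms(2)]
    unfolding homogeneous_part_id[OF assms(1)] .
  then show ?thesis by (metis homogeneous_homogeneous_part)
qed

lemma free_module_add:
  "x \<in> free_module (poly_ring n) B \<Longrightarrow> y \<in> free_module (poly_ring n) B \<Longrightarrow> x + y \<in> free_module (poly_ring n) B"
  unfolding free_module_def using keys_add[of x y] by (auto simp: lookup_add intro!: poly_ring_add)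

lemma free_module_diff:
  "x \<in> free_module (poly_ring n) B \<Longrightarrow> y \<in> free_module (poly_ring n) B \<Longrightarrow> x - y \<in> free_module (poly_ring n) B"
  unfolding free_module_def using keys_minus_subset[of x y] by (auto simp: lookup_minus intro!: poly_ring_diff)

lemma free_module_scale:
  "c \<in> poly_ring n \<Longrightarrow> x \<in> free_module (poly_ring n) B \<Longrightarrow> scale c x \<in> free_module (poly_ring n) B"
  unfolding free_module_def using keys_scale[of c x] by (auto intro!: poly_ring_mult)

lemma free_module_0 [simp]: "0 \<in> free_module (poly_ring n) B"
  by (simp add: free_module_def)

lemma free_module_single:
  "b \<in> B \<Longrightarrow> c \<in> poly_ring n \<Longrightarrow> single b c \<in> free_module (poly_ring n) B"
  by (auto simp: free_module_def lookup_single when_def)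

lemma free_module_sum:
  "(\<And>a. a \<in> A \<Longrightarrow> f a \<in> free_module (poly_ring n) B) \<Longrightarrow> sum f A \<in> free_module (poly_ring n) B"
  by (induction A rule: infinite_finite_induct) (auto intro: free_module_add)

lemma free_module_lin_ext:
  "x \<in> free_module (poly_ring n) B \<Longrightarrow> (\<And>b. b \<in> B \<Longrightarrow> D b \<in> free_module (poly_ring n) C) \<Longrightarrow>
    lin_ext D x \<in> free_module (poly_ring n) C"
  unfolding lin_ext_def by (intro free_module_sum free_module_scale) (auto simp: free_module_def)

lemma free_module_homogeneous_part:
  "x \<in> free_module (poly_ring n) B \<Longrightarrow> homogeneous_part deg e x \<in> free_module (poly_ring n) B"
  unfolding free_module_def using keys_homogeneous_part[of deg e x]
  by (auto simp: lookup_homogeneous_part intro!: poly_ring_restrict_keys)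

section \<open>Comparison of graded free resolutions\<close>

definition augmentation :: "('b \<Rightarrow> 'k::idom mpoly) \<Rightarrow> ('b \<Rightarrow>\<^sub>0 'k mpoly) \<Rightarrow> 'k mpoly" where
  "augmentation \<epsilon> = additive_ext (\<lambda>b f. f * \<epsilon> b)"

lemma augmentation_add: "augmentation \<epsilon> (x + y) = augmentation \<epsilon> x + augmentation \<epsilon> y"
  unfolding augmentation_def by (rule additive_ext_add) (simp add: algebra_simps)

lemma augmentation_single [simp]: "augmentation \<epsilon> (single b f) = f * \<epsilon> b"
  unfolding augmentation_def by (rule additive_ext_single) simp

lemmas augmentation_diff = additive_diff[of "augmentation \<epsilon>" for \<epsilon>, OF augmentation_add]

lemma augmentation_scale: "augmentation \<epsilon> (scale c x) = c * augmentation \<epsilon> x"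
  by (rule additive_eqI[of "\<lambda>x. augmentation \<epsilon> (scale c x)"])
     (simp_all add: scale_add augmentation_add distrib_left mult.assoc)

lemma augmentation_lin_ext: "augmentation \<epsilon> (lin_ext D x) = augmentation (\<lambda>b. augmentation \<epsilon> (D b)) x"
  by (rule additive_eqI[of "\<lambda>x. augmentation \<epsilon> (lin_ext D x)"])
     (simp_all add: lin_ext_add augmentation_add augmentation_scale)

definition homogeneous_ideal :: "nat \<Rightarrow> 'k::idom mpoly set \<Rightarrow> bool" where
  "homogeneous_ideal n I \<longleftrightarrow> 0 \<in> I \<and> (\<forall>f\<in>I. \<forall>g\<in>I. f + g \<in> I) \<and> (\<forall>f\<in>poly_ring n. \<forall>g\<in>I. f * g \<in> I)
     \<and> (\<forall>e. \<forall>f\<in>I. restrict_keys (\<lambda>m. monomial_degree m = e) f \<in> I)"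

lemma homogeneous_ideal_sum:
  "homogeneous_ideal n I \<Longrightarrow> (\<And>a. a \<in> A \<Longrightarrow> f a \<in> I) \<Longrightarrow> sum f A \<in> I"
  by (induction A rule: infinite_finite_induct) (auto simp: homogeneous_ideal_def)

lemma poly_ring_uminus: "f \<in> poly_ring n \<Longrightarrow> - f \<in> poly_ring n"
  using poly_ring_diff[of 0 n f] by simp

lemma homogeneous_ideal_diff:
  assumes "homogeneous_ideal n I" "f \<in> I" "g \<in> I" shows "f - g \<in> I"
proof -
  have "- 1 * g \<in> I" using assms poly_ring_uminus[OF poly_ring_1, of n] unfolding homogeneous_ideal_def by blast
  then have "f + - 1 * g \<in> I" using assms unfolding homogeneous_ideal_def by blast
  then show ?thesis by simp
qed

locale graded_resolution =
  fixes n :: nat and I :: "'k::idom mpoly set" and B deg D \<epsilon>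
  assumes resolution: "graded_free_resolution n I B deg D \<epsilon>" and ideal: "homogeneous_ideal n I"
begin

abbreviation F where "F k \<equiv> free_module (poly_ring n) (B k)"

text \<open>At index 0 the map to S/I takes the place of the previous differential, which gives
  exactness the same form for every \<open>k\<close>.\<close>

definition cycle :: "nat \<Rightarrow> (nat \<Rightarrow>\<^sub>0 'k mpoly) \<Rightarrow> bool" where
  "cycle k x \<longleftrightarrow> (case k of 0 \<Rightarrow> augmentation \<epsilon> x \<in> I | Suc i \<Rightarrow> lin_ext (D i) x = 0)"

lemma aug_mem: "b \<in> B 0 \<Longrightarrow> \<epsilon> b \<in> poly_ring n"
  and aug_deg: "b \<in> B 0 \<Longrightarrow> m \<in> keys (\<epsilon> b) \<Longrightarrow> monomial_degree m = deg 0 b"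
  using resolution unfolding graded_free_resolution_def Let_def by blast+

lemma diff_mem: "b \<in> B (Suc i) \<Longrightarrow> D i b \<in> F i"
  using resolution unfolding graded_free_resolution_def Let_def by blast

lemma diff_homogeneous: "b \<in> B (Suc i) \<Longrightarrow> homogeneous (deg i) (deg (Suc i) b) (D i b)"
proof -
  assume b: "b \<in> B (Suc i)"
  have "\<forall>i. \<forall>b\<in>B (Suc i). D i b \<in> F i \<and>
      (\<forall>c\<in>B i. \<forall>m\<in>keys (lookup (D i b) c). deg i c + monomial_degree m = deg (Suc i) b)"
    using resolution unfolding graded_free_resolution_def Let_def by (elim conjE)
  with b have *: "\<forall>c\<in>B i. \<forall>m\<in>keys (lookup (D i b) c). deg i c + monomial_degree m = deg (Suc i) b"
    by blast
  show ?thesis unfolding homogeneous_def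
  proof (intro allI ballI)
    fix c m assume m: "m \<in> keys (lookup (D i b) c)"
    then have "c \<in> keys (D i b)" by (auto simp: in_keys_iff)
    then have "c \<in> B i" using diff_mem[OF b] by (auto simp: free_module_def)
    then show "deg i c + monomial_degree m = deg (Suc i) b" using * m by blast
  qed
qed

lemma surjective: "f \<in> poly_ring n \<Longrightarrow> \<exists>x\<in>F 0. augmentation \<epsilon> x - f \<in> I"
  using resolution unfolding graded_free_resolution_def Let_def augmentation_def additive_ext_def by blast

lemma exact: "lin_ext (D k) ` F (Suc k) = {x \<in> F k. cycle k x}"
  using resolution unfolding graded_free_resolution_def Let_def augmentation_def additive_ext_def cycle_def
  by (cases k) auto

lemma cycle_diff: "b \<in> B (Suc k) \<Longrightarrow> cycle k (D k b)"
proof -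
  assume "b \<in> B (Suc k)"
  then have "single b 1 \<in> F (Suc k)" by (intro free_module_single) auto
  then have "lin_ext (D k) (single b 1) \<in> {x \<in> F k. cycle k x}" using exact by blast
  then show ?thesis by simp
qed

text \<open>Exactness gives some preimage. Since the differential preserves degrees, its part of
  degree \<open>e\<close> is a preimage as well.\<close>

lemma lift:
  assumes "x \<in> F k" "cycle k x" "homogeneous (deg k) e x"
  shows "\<exists>y. y \<in> F (Suc k) \<and> homogeneous (deg (Suc k)) e y \<and> lin_ext (D k) y = x"
proof -
  have "x \<in> lin_ext (D k) ` F (Suc k)" unfolding exact using assms by simp
  then obtain y where y: "y \<in> F (Suc k)" "lin_ext (D k) y = x" by blast
  have "lin_ext (D k) (homogeneous_part (deg (Suc k)) e y) = homogeneous_part (deg k) e (lin_ext (D k) y)"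
    using y(1) by (intro homogeneous_part_lin_ext diff_homogeneous) (auto simp: free_module_def)
  also have "\<dots> = x" using y(2) assms(3) by (simp add: homogeneous_part_id)
  finally show ?thesis using y(1) free_module_homogeneous_part homogeneous_homogeneous_part by blast
qed

lemma augmentation_homogeneous_part:
  assumes "x \<in> F 0"
  shows "augmentation \<epsilon> (homogeneous_part (deg 0) e x)
     = restrict_keys (\<lambda>m. monomial_degree m = e) (augmentation \<epsilon> x)"
proof -
  have keys: "keys x \<subseteq> B 0" using assms by (simp add: free_module_def)
  have "augmentation \<epsilon> (homogeneous_part (deg 0) e x)
     = (\<Sum>b\<in>keys x. restrict_keys (\<lambda>m. deg 0 b + monomial_degree m = e) (lookup x b) * \<epsilon> b)"
    unfolding augmentation_def using keys_homogeneous_part[of "deg 0" e x]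
    by (subst additive_ext_superset[of _ "keys x"]) (auto simp: lookup_homogeneous_part)
  also have "\<dots> = (\<Sum>b\<in>keys x. restrict_keys (\<lambda>m. 0 + monomial_degree m = e) (lookup x b * \<epsilon> b))"
    using aug_deg keys by (intro sum.cong refl restrict_keys_mult[symmetric]) auto
  also have "\<dots> = restrict_keys (\<lambda>m. monomial_degree m = e) (augmentation \<epsilon> x)"
    unfolding augmentation_def additive_ext_def
    by (subst additive_sum[of "restrict_keys P" for P, symmetric]) (simp_all add: restrict_keys_add)
  finally show ?thesis .
qed

text \<open>Surjectivity gives a preimage modulo \<open>I\<close>; passing to degree
  \<open>e\<close> keeps the congruence because \<open>I\<close> is homogeneous.\<close>

lemma lift_augmentation:
  assumes "f \<in> poly_ring n" "\<And>m. m \<in> keys f \<Longrightarrow> monomial_degree m = e"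
  shows "\<exists>x. x \<in> F 0 \<and> homogeneous (deg 0) e x \<and> augmentation \<epsilon> x - f \<in> I"
proof -
  obtain x where x: "x \<in> F 0" "augmentation \<epsilon> x - f \<in> I" using surjective assms by blast
  let ?r = "restrict_keys (\<lambda>m. monomial_degree m = e)"
  have "?r (augmentation \<epsilon> x - f) \<in> I" using x(2) ideal by (auto simp: homogeneous_ideal_def)
  also have "?r (augmentation \<epsilon> x - f) = augmentation \<epsilon> (homogeneous_part (deg 0) e x) - f"
    using assms(2)
    by (subst additive_diff) (simp_all add: restrict_keys_add augmentation_homogeneous_part[OF x(1)] restrict_keys_id)
  finally show ?thesis using x(1) free_module_homogeneous_part homogeneous_homogeneous_part by blast
qed

end

definition graded_map ::
  "nat \<Rightarrow> nat set \<Rightarrow> (nat \<Rightarrow> nat) \<Rightarrow> nat set \<Rightarrow> (nat \<Rightarrow> nat) \<Rightarrow> (nat \<Rightarrow> (nat \<Rightarrow>\<^sub>0 'k::idom mpoly)) \<Rightarrow> bool" where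
  "graded_map n B deg B' deg' f \<longleftrightarrow>
     (\<forall>b\<in>B. f b \<in> free_module (poly_ring n) B' \<and> homogeneous deg' (deg b) (f b))"

lemma graded_mapD:
  assumes "graded_map n B deg B' deg' f" "x \<in> free_module (poly_ring n) B"
  shows "lin_ext f x \<in> free_module (poly_ring n) B'"
    and "homogeneous deg e x \<Longrightarrow> homogeneous deg' e (lin_ext f x)"
proof -
  have "keys x \<subseteq> B" using assms(2) by (simp add: free_module_def)
  then show "lin_ext f x \<in> free_module (poly_ring n) B'"
    "homogeneous deg e x \<Longrightarrow> homogeneous deg' e (lin_ext f x)"
    using assms by (auto simp: graded_map_def intro!: free_module_lin_ext homogeneous_lin_ext)
qed

definition chain_map_over_identity where
  "chain_map_over_identity n I B deg D \<epsilon> B' deg' D' \<epsilon>' \<phi> \<longleftrightarrow>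
     (\<forall>k. graded_map n (B k) (deg k) (B' k) (deg' k) (\<phi> k)) \<and>
     (\<forall>b\<in>B 0. augmentation \<epsilon>' (\<phi> 0 b) - \<epsilon> b \<in> I) \<and>
     (\<forall>k. \<forall>b\<in>B (Suc k). lin_ext (D' k) (\<phi> (Suc k) b) = lin_ext (\<phi> k) (D k b))"

lemma augmentation_over_identity:
  assumes "homogeneous_ideal n I" "x \<in> free_module (poly_ring n) B"
    and "\<And>b. b \<in> B \<Longrightarrow> augmentation \<epsilon>' (f b) - \<epsilon> b \<in> I"
  shows "augmentation \<epsilon>' (lin_ext f x) - augmentation \<epsilon> x \<in> I"
proof -
  have "augmentation \<epsilon>' (lin_ext f x) - augmentation \<epsilon> x
      = (\<Sum>b\<in>keys x. lookup x b * (augmentation \<epsilon>' (f b) - \<epsilon> b))"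
    unfolding augmentation_lin_ext
    unfolding augmentation_def additive_ext_def sum_subtractf[symmetric] by (simp add: right_diff_distrib)
  also have "\<dots> \<in> I"
    using assms by (intro homogeneous_ideal_sum) (auto simp: homogeneous_ideal_def free_module_def)
  finally show ?thesis .
qed

text \<open>The comparison theorem: images of basis elements are lifted through the exact target
  complex. \<open>P\<close> carries along that cycles go to cycles, which \<open>R'.lift\<close>
  requires at the next index, and \<open>Q\<close> ties consecutive choices together for
  \<open>dependent_nat_choice\<close>.\<close>

lemma chain_map_exists:
  assumes "graded_resolution n I B deg D \<epsilon>" "graded_resolution n I B' deg' D' \<epsilon>'"
  shows "\<exists>\<phi>. chain_map_over_identity n I B deg D \<epsilon> B' deg' D' \<epsilon>' \<phi>"
proof -
  interpret R: graded_resolution n I B deg D \<epsilon> by fact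
  interpret R': graded_resolution n I B' deg' D' \<epsilon>' by fact
  define P where "P k f \<longleftrightarrow> graded_map n (B k) (deg k) (B' k) (deg' k) f
      \<and> (\<forall>x\<in>R.F k. R.cycle k x \<longrightarrow> R'.cycle k (lin_ext f x))
      \<and> (k = 0 \<longrightarrow> (\<forall>b\<in>B 0. augmentation \<epsilon>' (f b) - \<epsilon> b \<in> I))" for k f
  define Q where "Q k f g \<longleftrightarrow> (\<forall>b\<in>B (Suc k). lin_ext (D' k) (g b) = lin_ext f (D k b))"
    for k and f g :: "nat \<Rightarrow> (nat \<Rightarrow>\<^sub>0 'a mpoly)"
  have "\<exists>f. P 0 f"
  proof -
    have "\<forall>b\<in>B 0. \<exists>x. x \<in> R'.F 0 \<and> homogeneous (deg' 0) (deg 0 b) x \<and> augmentation \<epsilon>' x - \<epsilon> b \<in> I"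
      using R'.lift_augmentation R.aug_mem R.aug_deg by blast
    then obtain f where f: "\<And>b. b \<in> B 0 \<Longrightarrow>
        f b \<in> R'.F 0 \<and> homogeneous (deg' 0) (deg 0 b) (f b) \<and> augmentation \<epsilon>' (f b) - \<epsilon> b \<in> I"
      using bchoice[of "B 0"] by meson
    have "R'.cycle 0 (lin_ext f x)" if x: "x \<in> R.F 0" "R.cycle 0 x" for x
    proof -
      have "augmentation \<epsilon>' (lin_ext f x) - augmentation \<epsilon> x \<in> I"
        using f by (intro augmentation_over_identity[OF R.ideal x(1)]) auto
      moreover have "augmentation \<epsilon> x \<in> I" using x(2) by (simp add: R.cycle_def)
      ultimately have "augmentation \<epsilon>' (lin_ext f x) - augmentation \<epsilon> x + augmentation \<epsilon> x \<in> I"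
        using R.ideal unfolding homogeneous_ideal_def by blast
      then show ?thesis by (simp add: R'.cycle_def)
    qed
    then show ?thesis using f unfolding P_def graded_map_def by blast
  qed
  moreover have "\<exists>g. P (Suc k) g \<and> Q k f g" if P: "P k f" for k f
  proof -
    have "\<exists>y. y \<in> R'.F (Suc k) \<and> homogeneous (deg' (Suc k)) (deg (Suc k) b) y \<and> lin_ext (D' k) y = lin_ext f (D k b)"
      if b: "b \<in> B (Suc k)" for b
    proof (rule R'.lift)
      have "graded_map n (B k) (deg k) (B' k) (deg' k) f" using P by (simp add: P_def)
      note f = graded_mapD[OF this R.diff_mem[OF b]]
      show "lin_ext f (D k b) \<in> R'.F k" by (rule f(1))
      show "homogeneous (deg' k) (deg (Suc k) b) (lin_ext f (D k b))"
        by (rule f(2)[OF R.diff_homogeneous[OF b]])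
      show "R'.cycle k (lin_ext f (D k b))"
        using P R.cycle_diff[OF b] R.diff_mem[OF b] unfolding P_def by blast
    qed
    then obtain g where g: "\<And>b. b \<in> B (Suc k) \<Longrightarrow>
        g b \<in> R'.F (Suc k) \<and> homogeneous (deg' (Suc k)) (deg (Suc k) b) (g b) \<and> lin_ext (D' k) (g b) = lin_ext f (D k b)"
      using bchoice[of "B (Suc k)"] by meson
    have "R'.cycle (Suc k) (lin_ext g x)" if x: "x \<in> R.F (Suc k)" "R.cycle (Suc k) x" for x
    proof -
      have "lin_ext (D' k) (lin_ext g x) = lin_ext (\<lambda>b. lin_ext f (D k b)) x"
        unfolding lin_ext_comp using x(1) g by (intro lin_ext_cong) (auto simp: free_module_def)
      also have "\<dots> = lin_ext f (lin_ext (D k) x)" by (simp add: lin_ext_comp)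
      also have "\<dots> = 0" using x(2) by (simp add: R.cycle_def)
      finally show ?thesis by (simp add: R'.cycle_def)
    qed
    then have "P (Suc k) g" using g unfolding P_def graded_map_def by blast
    moreover have "Q k f g" using g unfolding Q_def by blast
    ultimately show ?thesis by blast
  qed
  ultimately obtain \<phi> where "\<And>k. P k (\<phi> k) \<and> Q k (\<phi> k) (\<phi> (Suc k))"
    using dependent_nat_choice[of P Q] by blast
  then show ?thesis unfolding P_def Q_def chain_map_over_identity_def by blast
qed

text \<open>Both \<open>\<theta>\<close> and the identity lift the identity of S/I. On cycles the
  term of the homotopy formula that contains the differential of \<open>x\<close> drops out, and the
  shortened formula kept in \<open>P\<close> is what makes the right-hand side of the next equation
  a cycle.\<close>

lemma chain_homotopy_exists:
  assumes "graded_resolution n I B deg D \<epsilon>"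
    and \<theta>: "chain_map_over_identity n I B deg D \<epsilon> B deg D \<epsilon> \<theta>"
  shows "\<exists>h. (\<forall>k. graded_map n (B k) (deg k) (B (Suc k)) (deg (Suc k)) (h k)) \<and>
     (\<forall>b\<in>B 0. lin_ext (D 0) (h 0 b) = \<theta> 0 b - single b 1) \<and>
     (\<forall>k. \<forall>b\<in>B (Suc k). lin_ext (D (Suc k)) (h (Suc k) b) = \<theta> (Suc k) b - single b 1 - lin_ext (h k) (D k b))"
proof -
  interpret R: graded_resolution n I B deg D \<epsilon> by fact
  define P where "P k f \<longleftrightarrow> graded_map n (B k) (deg k) (B (Suc k)) (deg (Suc k)) f
      \<and> (\<forall>x\<in>R.F k. R.cycle k x \<longrightarrow> lin_ext (D k) (lin_ext f x) = lin_ext (\<theta> k) x - x)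
      \<and> (k = 0 \<longrightarrow> (\<forall>b\<in>B 0. lin_ext (D 0) (f b) = \<theta> 0 b - single b 1))" for k f
  define Q where "Q k f g \<longleftrightarrow>
      (\<forall>b\<in>B (Suc k). lin_ext (D (Suc k)) (g b) = \<theta> (Suc k) b - single b 1 - lin_ext f (D k b))"
    for k and f g :: "nat \<Rightarrow> (nat \<Rightarrow>\<^sub>0 'a mpoly)"
  have \<theta>_map: "\<theta> k b \<in> R.F k" "homogeneous (deg k) (deg k b) (\<theta> k b)" if "b \<in> B k" for k b
    using \<theta> that unfolding chain_map_over_identity_def graded_map_def by blast+
  have one: "single b 1 \<in> R.F k" if "b \<in> B k" for k b
    using that by (intro free_module_single) auto
  have "\<exists>f. P 0 f"
  proof -
    have "\<exists>y. y \<in> R.F (Suc 0) \<and> homogeneous (deg (Suc 0)) (deg 0 b) y \<and> lin_ext (D 0) y = \<theta> 0 b - single b 1"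
      if b: "b \<in> B 0" for b
    proof (rule R.lift)
      show "\<theta> 0 b - single b 1 \<in> R.F 0" using b by (intro free_module_diff \<theta>_map one)
      show "homogeneous (deg 0) (deg 0 b) (\<theta> 0 b - single b 1)"
        using b by (intro homogeneous_diff \<theta>_map homogeneous_single_one)
      have "augmentation \<epsilon> (\<theta> 0 b) - \<epsilon> b \<in> I"
        using \<theta> b unfolding chain_map_over_identity_def by blast
      then show "R.cycle 0 (\<theta> 0 b - single b 1)" by (simp add: R.cycle_def augmentation_diff)
    qed
    then obtain f where f: "\<And>b. b \<in> B 0 \<Longrightarrow>
        f b \<in> R.F (Suc 0) \<and> homogeneous (deg (Suc 0)) (deg 0 b) (f b) \<and> lin_ext (D 0) (f b) = \<theta> 0 b - single b 1"
      using bchoice[of "B 0"] by meson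
    have "lin_ext (D 0) (lin_ext f x) = lin_ext (\<theta> 0) x - x" if x: "x \<in> R.F 0" for x
    proof -
      have "lin_ext (D 0) (lin_ext f x) = lin_ext (\<lambda>b. \<theta> 0 b - single b 1) x"
        unfolding lin_ext_comp using x f by (intro lin_ext_cong) (auto simp: free_module_def)
      then show ?thesis by (simp add: lin_ext_fun_diff)
    qed
    then show ?thesis using f unfolding P_def graded_map_def by blast
  qed
  moreover have "\<exists>g. P (Suc k) g \<and> Q k f g" if P: "P k f" for k f
  proof -
    have f_map: "graded_map n (B k) (deg k) (B (Suc k)) (deg (Suc k)) f"
      and f_cycle: "\<And>x. x \<in> R.F k \<Longrightarrow> R.cycle k x \<Longrightarrow> lin_ext (D k) (lin_ext f x) = lin_ext (\<theta> k) x - x"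
      using P unfolding P_def by blast+
    have "\<exists>y. y \<in> R.F (Suc (Suc k)) \<and> homogeneous (deg (Suc (Suc k))) (deg (Suc k) b) y
        \<and> lin_ext (D (Suc k)) y = \<theta> (Suc k) b - single b 1 - lin_ext f (D k b)"
      if b: "b \<in> B (Suc k)" for b
    proof (rule R.lift)
      note f = graded_mapD[OF f_map R.diff_mem[OF b]]
      show "\<theta> (Suc k) b - single b 1 - lin_ext f (D k b) \<in> R.F (Suc k)"
        using b by (intro free_module_diff \<theta>_map one f)
      show "homogeneous (deg (Suc k)) (deg (Suc k) b) (\<theta> (Suc k) b - single b 1 - lin_ext f (D k b))"
        using b by (intro homogeneous_diff \<theta>_map homogeneous_single_one f R.diff_homogeneous)
      have "lin_ext (D k) (\<theta> (Suc k) b) = lin_ext (\<theta> k) (D k b)"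
        using \<theta> b unfolding chain_map_over_identity_def by blast
      then show "R.cycle (Suc k) (\<theta> (Suc k) b - single b 1 - lin_ext f (D k b))"
        using f_cycle[OF R.diff_mem[OF b] R.cycle_diff[OF b]] by (simp add: R.cycle_def lin_ext_diff)
    qed
    then obtain g where g: "\<And>b. b \<in> B (Suc k) \<Longrightarrow>
        g b \<in> R.F (Suc (Suc k)) \<and> homogeneous (deg (Suc (Suc k))) (deg (Suc k) b) (g b)
        \<and> lin_ext (D (Suc k)) (g b) = \<theta> (Suc k) b - single b 1 - lin_ext f (D k b)"
      using bchoice[of "B (Suc k)"] by meson
    have "lin_ext (D (Suc k)) (lin_ext g x) = lin_ext (\<theta> (Suc k)) x - x"
      if x: "x \<in> R.F (Suc k)" "R.cycle (Suc k) x" for x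
    proof -
      have "lin_ext (D (Suc k)) (lin_ext g x)
          = lin_ext (\<lambda>b. \<theta> (Suc k) b - single b 1 - lin_ext f (D k b)) x"
        unfolding lin_ext_comp using x(1) g by (intro lin_ext_cong) (auto simp: free_module_def)
      also have "\<dots> = lin_ext (\<theta> (Suc k)) x - x - lin_ext f (lin_ext (D k) x)"
        by (simp add: lin_ext_comp lin_ext_fun_diff)
      finally show ?thesis using x(2) by (simp add: R.cycle_def)
    qed
    then have "P (Suc k) g" using g unfolding P_def graded_map_def by blast
    moreover have "Q k f g" using g unfolding Q_def by blast
    ultimately show ?thesis by blast
  qed
  ultimately obtain h where "\<And>k. P k (h k) \<and> Q k (h k) (h (Suc k))"
    using dependent_nat_choice[of P Q] by blast
  then show ?thesis unfolding P_def Q_def by blast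
qed

section \<open>Reduction modulo the variables\<close>

definition reduce :: "('b \<Rightarrow>\<^sub>0 'k::idom mpoly) \<Rightarrow> ('b \<Rightarrow>\<^sub>0 'k)" where
  "reduce x = Poly_Mapping.map constant_term x"

lemma constant_term_0 [simp]: "constant_term 0 = 0"
  and constant_term_add: "constant_term (f + g) = constant_term f + constant_term g"
  and constant_term_diff: "constant_term (f - g) = constant_term f - constant_term g"
  by (simp_all add: constant_term_def lookup_add lookup_minus)

lemma add_eq_0_poly_mapping_nat: "m + m' = 0 \<longleftrightarrow> m = 0 \<and> m' = (0 :: 'a \<Rightarrow>\<^sub>0 nat)"
  by (auto simp: poly_mapping_eq_iff fun_eq_iff lookup_add)

lemma constant_term_single [simp]: "constant_term (single m c) = (if m = 0 then c else 0)"
  by (auto simp: constant_term_def lookup_single when_def)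

lemma constant_term_mult: "constant_term (f * g) = constant_term f * constant_term g"
proof (rule additive_eqI[of "\<lambda>f. constant_term (f * g)"])
  fix s r
  show "constant_term (single s r * g) = constant_term (single s r) * constant_term g"
    by (rule additive_eqI[of "\<lambda>g. constant_term (single s r * g)"])
       (auto simp: distrib_left constant_term_add mult_single add_eq_0_poly_mapping_nat)
qed (simp_all add: distrib_right constant_term_add)

lemma lookup_reduce [simp]: "lookup (reduce x) b = constant_term (lookup x b)"
  by (simp add: reduce_def Poly_Mapping.map.rep_eq when_def)

lemma reduce_add: "reduce (x + y) = reduce x + reduce y"
  and reduce_diff: "reduce (x - y) = reduce x - reduce y"
  and reduce_scale: "reduce (scale c x) = scale (constant_term c) (reduce x)"
  and reduce_single: "reduce (single b c) = single b (constant_term c)"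
  by (rule poly_mapping_eqI, simp add: lookup_add lookup_minus constant_term_add constant_term_diff
      constant_term_mult lookup_single when_def)+

lemma reduce_sum: "reduce (sum f A) = (\<Sum>a\<in>A. reduce (f a))"
  by (rule additive_sum) (rule reduce_add)

lemma reduce_lin_ext: "reduce (lin_ext D x) = lin_ext (\<lambda>b. reduce (D b)) (reduce x)"
  by (rule additive_eqI[of "\<lambda>x. reduce (lin_ext D x)"])
     (simp_all add: lin_ext_add reduce_add reduce_scale reduce_single)

text \<open>A constant term belongs to the monomial of degree 0, so a basis element that survives
  the reduction must itself have degree \<open>e\<close>.\<close>

lemma keys_reduce:
  assumes "homogeneous deg e x" "keys x \<subseteq> B"
  shows "keys (reduce x) \<subseteq> {b \<in> B. deg b = e}"
proof
  fix b assume b: "b \<in> keys (reduce x)"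
  then have "0 \<in> keys (lookup x b)" by (simp add: in_keys_iff constant_term_def)
  then have "deg b + monomial_degree 0 = e" using assms(1) unfolding homogeneous_def by blast
  moreover have "b \<in> keys x" using b by (auto simp: in_keys_iff)
  ultimately show "b \<in> {b \<in> B. deg b = e}" using assms(2) by auto
qed

text \<open>A relation among the images modulo \<open>W'\<close> is pulled back by \<open>g\<close>
  to one modulo \<open>W\<close>, since \<open>g\<close> inverts \<open>f\<close> up to
  \<open>W\<close>. The lemma concerns single independent sets and not ranks because an arbitrary
  resolution may have infinite rank in a given degree.\<close>

lemma indep_mod_transfer:
  assumes "finite X" "X \<subseteq> Z" "indep_mod X W" "submodule W"
    and f: "\<And>x y. f (x + y) = f x + f y" "\<And>c x. f (scale c x) = scale c (f x)"
    and g: "\<And>x y. g (x + y) = g x + g y" "\<And>c x. g (scale c x) = scale c (g x)"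
    and gW: "\<And>w. w \<in> W' \<Longrightarrow> g w \<in> W"
    and gf: "\<And>z. z \<in> Z \<Longrightarrow> g (f z) - z \<in> W"
  shows "indep_mod (f ` X) W'" "card (f ` X) = card X"
proof -
  have key: "\<forall>x\<in>X. c x = 0" if "f (\<Sum>x\<in>X. scale (c x) x) \<in> W'" for c
  proof -
    let ?z = "\<Sum>x\<in>X. scale (c x) x"
    have "g (f ?z) - ?z = (\<Sum>x\<in>X. scale (c x) (g (f x) - x))"
      by (simp add: additive_sum[of f] additive_sum[of g] f g scale_diff sum_subtractf)
    also have "\<dots> \<in> W" using gf assms(2,4) by (intro submodule_sum submodule_scale) auto
    finally have "g (f ?z) - (g (f ?z) - ?z) \<in> W"
      by (rule submodule_diff[OF assms(4) gW[OF that]])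
    then show ?thesis using assms(3) by (simp add: indep_mod_def)
  qed
  have f_sum: "f (\<Sum>x\<in>X. scale (c x) x) = (\<Sum>x\<in>X. scale (c x) (f x))" for c
    by (simp add: additive_sum[of f] f)
  have inj: "inj_on f X"
  proof (rule inj_onI, rule ccontr)
    fix x y assume xy: "x \<in> X" "y \<in> X" "f x = f y" "x \<noteq> y"
    \<comment> \<open>The combination is \<open>x - y\<close>. Its image under \<open>f\<close>
      vanishes, so it lies in \<open>W\<close>, contrary to independence.\<close>
    define c :: "_ \<Rightarrow> 'b" where "c z = (if z = x then 1 else 0) - (if z = y then 1 else 0)" for z
    have "(\<Sum>z\<in>X. scale (c z) (f z)) = f x - f y"
      unfolding c_def scale_diff_left sum_subtractf using xy \<open>finite X\<close>
      by (simp add: if_distrib[of "\<lambda>c. scale c _"] sum.delta cong: if_cong)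
    then have 0: "f (\<Sum>z\<in>X. scale (c z) z) = 0" by (simp add: f_sum xy)
    let ?z = "\<Sum>z\<in>X. scale (c z) z"
    have "g (f ?z) - ?z = (\<Sum>x\<in>X. scale (c x) (g (f x) - x))"
      by (simp add: additive_sum[of f] additive_sum[of g] f g scale_diff sum_subtractf)
    also have "\<dots> \<in> W" using gf assms(2,4) by (intro submodule_sum submodule_scale) auto
    finally have "scale (-1) (g (f ?z) - ?z) \<in> W" using assms(4) by (intro submodule_scale)
    moreover have "g 0 = 0" using g(1)[of 0 0] by simp
    ultimately have "?z \<in> W" using 0 by (simp add: scale_minus scale_minus_left)
    then have "c x = 0" using assms(3) xy by (simp add: indep_mod_def)
    then show False using xy by (simp add: c_def)
  qed
  then show "card (f ` X) = card X" by (rule card_image)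
  show "indep_mod (f ` X) W'"
    unfolding indep_mod_def
  proof (intro allI impI ballI)
    fix c x assume c: "(\<Sum>y\<in>f ` X. scale (c y) y) \<in> W'" and "x \<in> f ` X"
    have "(\<Sum>y\<in>f ` X. scale (c y) y) = f (\<Sum>x\<in>X. scale (c (f x)) x)"
      unfolding f_sum using inj by (simp add: sum.reindex)
    then show "c x = 0" using key[of "\<lambda>x. c (f x)"] c \<open>x \<in> f ` X\<close> by auto
  qed
qed

section \<open>Independence of Tor from the resolution\<close>

definition tensor_cycles where
  "tensor_cycles B deg D i e = {x \<in> free_module (UNIV :: 'k::idom set) {b \<in> B i. deg i b = e}.
     \<forall>k. i = Suc k \<longrightarrow> lin_ext (\<lambda>b. reduce (D k b :: nat \<Rightarrow>\<^sub>0 'k mpoly)) x = 0}"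

definition tensor_boundaries where
  "tensor_boundaries B deg D i e = lin_ext (\<lambda>b. reduce (D i b :: nat \<Rightarrow>\<^sub>0 'k::idom mpoly)) `
     free_module (UNIV :: 'k set) {b \<in> B (Suc i). deg (Suc i) b = e}"

lemma tensor_homology_rank_alt:
  "tensor_homology_rank B deg D i e = quotient_rank (tensor_cycles B deg D i e) (tensor_boundaries B deg D i e)"
  by (simp add: tensor_homology_rank_def tensor_cycles_def tensor_boundaries_def Let_def reduce_def)

lemma submodule_tensor_boundaries: "submodule (tensor_boundaries B deg D i e)"
  unfolding tensor_boundaries_def by (rule submodule_image)

lemma graded_map_reduce:
  assumes "graded_map n B deg B' deg' f" "keys x \<subseteq> {b \<in> B. deg b = e}"
  shows "keys (lin_ext (\<lambda>b. reduce (f b)) x) \<subseteq> {b \<in> B'. deg' b = e}"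
proof -
  have "keys (reduce (f b)) \<subseteq> {b \<in> B'. deg' b = e}" if "b \<in> keys x" for b
  proof -
    have b: "b \<in> B" "deg b = e" using that assms(2) by auto
    then have "f b \<in> free_module (poly_ring n) B'" "homogeneous deg' e (f b)"
      using assms(1) unfolding graded_map_def by blast+
    then show ?thesis by (intro keys_reduce) (auto simp: free_module_def)
  qed
  then show ?thesis using keys_lin_ext[of "\<lambda>b. reduce (f b)" x] by blast
qed

lemma chain_map_reduce:
  assumes \<phi>: "chain_map_over_identity n I B deg D \<epsilon> B' deg' D' \<epsilon>' \<phi>"
    and x: "keys x \<subseteq> {b \<in> B (Suc k). deg (Suc k) b = e}"
  shows "lin_ext (\<lambda>b. reduce (D' k b)) (lin_ext (\<lambda>b. reduce (\<phi> (Suc k) b)) x)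
       = lin_ext (\<lambda>b. reduce (\<phi> k b)) (lin_ext (\<lambda>b. reduce (D k b)) x)"
  unfolding lin_ext_comp
proof (rule lin_ext_cong)
  fix b assume "b \<in> keys x"
  then have "lin_ext (D' k) (\<phi> (Suc k) b) = lin_ext (\<phi> k) (D k b)"
    using \<phi> x unfolding chain_map_over_identity_def by blast
  then show "lin_ext (\<lambda>b. reduce (D' k b)) (reduce (\<phi> (Suc k) b))
      = lin_ext (\<lambda>b. reduce (\<phi> k b)) (reduce (D k b))"
    by (simp flip: reduce_lin_ext)
qed

lemma chain_map_tensor:
  assumes \<phi>: "chain_map_over_identity n I B deg D \<epsilon> B' deg' D' \<epsilon>' \<phi>"
  shows "x \<in> tensor_cycles B deg D i e \<Longrightarrow> lin_ext (\<lambda>b. reduce (\<phi> i b)) x \<in> tensor_cycles B' deg' D' i e"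
    and "x \<in> tensor_boundaries B deg D i e \<Longrightarrow> lin_ext (\<lambda>b. reduce (\<phi> i b)) x \<in> tensor_boundaries B' deg' D' i e"
proof -
  have \<phi>_map: "graded_map n (B k) (deg k) (B' k) (deg' k) (\<phi> k)" for k
    using \<phi> unfolding chain_map_over_identity_def by blast
  {
    assume "x \<in> tensor_cycles B deg D i e"
    then have x: "keys x \<subseteq> {b \<in> B i. deg i b = e}" "\<And>k. i = Suc k \<Longrightarrow> lin_ext (\<lambda>b. reduce (D k b)) x = 0"
      by (auto simp: tensor_cycles_def)
    have "lin_ext (\<lambda>b. reduce (D' k b)) (lin_ext (\<lambda>b. reduce (\<phi> i b)) x) = 0" if "i = Suc k" for k
      using chain_map_reduce[OF \<phi>, of x k e] x that by simp
    then show "lin_ext (\<lambda>b. reduce (\<phi> i b)) x \<in> tensor_cycles B' deg' D' i e"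
      using graded_map_reduce[OF \<phi>_map x(1)] by (simp add: tensor_cycles_def)
  next
    assume "x \<in> tensor_boundaries B deg D i e"
    then obtain y where y: "x = lin_ext (\<lambda>b. reduce (D i b)) y" "keys y \<subseteq> {b \<in> B (Suc i). deg (Suc i) b = e}"
      by (auto simp: tensor_boundaries_def)
    then show "lin_ext (\<lambda>b. reduce (\<phi> i b)) x \<in> tensor_boundaries B' deg' D' i e"
      using chain_map_reduce[OF \<phi> y(2)] graded_map_reduce[OF \<phi>_map y(2)]
      unfolding tensor_boundaries_def
      by (intro image_eqI[of _ _ "lin_ext (\<lambda>b. reduce (\<phi> (Suc i) b)) y"]) simp_all
  }
qed

text \<open>The reduced homotopy applied to \<open>x\<close> has the required boundary: in positive
  homological degree its second term contains the reduced differential of \<open>x\<close>, which is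
  zero for a cycle, and in degree 0 there is no second term.\<close>

lemma homotopy_tensor:
  assumes "graded_resolution n I B deg D \<epsilon>"
    and \<theta>: "chain_map_over_identity n I B deg D \<epsilon> B deg D \<epsilon> \<theta>"
    and x: "x \<in> tensor_cycles B deg D i e"
  shows "lin_ext (\<lambda>b. reduce (\<theta> i b)) x - x \<in> tensor_boundaries B deg D i e"
proof -
  obtain h where h_map: "\<And>k. graded_map n (B k) (deg k) (B (Suc k)) (deg (Suc k)) (h k)"
    and h_0: "\<And>b. b \<in> B 0 \<Longrightarrow> lin_ext (D 0) (h 0 b) = \<theta> 0 b - single b 1"
    and h_Suc: "\<And>k b. b \<in> B (Suc k) \<Longrightarrow>
      lin_ext (D (Suc k)) (h (Suc k) b) = \<theta> (Suc k) b - single b 1 - lin_ext (h k) (D k b)"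
    using chain_homotopy_exists[OF assms(1,2)] by blast
  have keys: "keys x \<subseteq> {b \<in> B i. deg i b = e}" using x by (simp add: tensor_cycles_def)
  let ?y = "lin_ext (\<lambda>b. reduce (h i b)) x"
  have "lin_ext (\<lambda>b. reduce (D i b)) ?y = lin_ext (\<lambda>b. reduce (lin_ext (D i) (h i b))) x"
    by (simp add: lin_ext_comp reduce_lin_ext)
  also have "\<dots> = lin_ext (\<lambda>b. reduce (\<theta> i b)) x - x"
  proof (cases i)
    case 0
    have "lin_ext (\<lambda>b. reduce (lin_ext (D i) (h i b))) x = lin_ext (\<lambda>b. reduce (\<theta> i b) - single b 1) x"
      using keys 0 by (intro lin_ext_cong) (auto simp: h_0 reduce_diff reduce_single simp flip: single_one)
    then show ?thesis by (simp add: lin_ext_fun_diff)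
  next
    case (Suc k)
    have "lin_ext (\<lambda>b. reduce (lin_ext (D i) (h i b))) x
        = lin_ext (\<lambda>b. reduce (\<theta> i b) - single b 1 - lin_ext (\<lambda>b. reduce (h k b)) (reduce (D k b))) x"
    proof (rule lin_ext_cong)
      fix b assume "b \<in> keys x"
      then have "b \<in> B (Suc k)" using keys Suc by auto
      from h_Suc[OF this] show "reduce (lin_ext (D i) (h i b))
          = reduce (\<theta> i b) - single b 1 - lin_ext (\<lambda>b. reduce (h k b)) (reduce (D k b))"
        using Suc by (simp add: reduce_diff reduce_single reduce_lin_ext[symmetric] constant_term_def)
    qed
    also have "\<dots> = lin_ext (\<lambda>b. reduce (\<theta> i b)) x - x
        - lin_ext (\<lambda>b. reduce (h k b)) (lin_ext (\<lambda>b. reduce (D k b)) x)"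
      by (simp add: lin_ext_fun_diff lin_ext_comp)
    finally show ?thesis using x Suc by (simp add: tensor_cycles_def)
  qed
  finally show ?thesis
    using graded_map_reduce[OF h_map keys] unfolding tensor_boundaries_def
    by (intro image_eqI[of _ _ ?y]) simp_all
qed

lemma chain_map_comp:
  assumes "homogeneous_ideal n I"
    and \<phi>: "chain_map_over_identity n I B deg D \<epsilon> B' deg' D' \<epsilon>' \<phi>"
    and \<psi>: "chain_map_over_identity n I B' deg' D' \<epsilon>' B'' deg'' D'' \<epsilon>'' \<psi>"
    and D: "\<And>k b. b \<in> B (Suc k) \<Longrightarrow> D k b \<in> free_module (poly_ring n) (B k)"
  shows "chain_map_over_identity n I B deg D \<epsilon> B'' deg'' D'' \<epsilon>'' (\<lambda>k b. lin_ext (\<psi> k) (\<phi> k b))"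
proof -
  have \<phi>_map: "graded_map n (B k) (deg k) (B' k) (deg' k) (\<phi> k)"
    and \<psi>_map: "graded_map n (B' k) (deg' k) (B'' k) (deg'' k) (\<psi> k)" for k
    using \<phi> \<psi> unfolding chain_map_over_identity_def by blast+
  have \<phi>_mem: "\<phi> k b \<in> free_module (poly_ring n) (B' k)" if "b \<in> B k" for k b
    using \<phi>_map that unfolding graded_map_def by blast
  show ?thesis unfolding chain_map_over_identity_def
  proof (intro conjI allI ballI)
    fix k
    show "graded_map n (B k) (deg k) (B'' k) (deg'' k) (\<lambda>b. lin_ext (\<psi> k) (\<phi> k b))"
      using \<phi>_map[of k] graded_mapD[OF \<psi>_map[of k]] unfolding graded_map_def by blast
  next
    fix b assume b: "b \<in> B 0"
    have "augmentation \<epsilon>'' (lin_ext (\<psi> 0) (\<phi> 0 b)) - augmentation \<epsilon>' (\<phi> 0 b) \<in> I"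
      using \<psi> unfolding chain_map_over_identity_def
      by (intro augmentation_over_identity[OF assms(1) \<phi>_mem[OF b]]) blast
    moreover have "augmentation \<epsilon>' (\<phi> 0 b) - \<epsilon> b \<in> I"
      using \<phi> b unfolding chain_map_over_identity_def by blast
    ultimately have "(augmentation \<epsilon>'' (lin_ext (\<psi> 0) (\<phi> 0 b)) - augmentation \<epsilon>' (\<phi> 0 b))
        + (augmentation \<epsilon>' (\<phi> 0 b) - \<epsilon> b) \<in> I"
      using assms(1) unfolding homogeneous_ideal_def by blast
    then show "augmentation \<epsilon>'' (lin_ext (\<psi> 0) (\<phi> 0 b)) - \<epsilon> b \<in> I" by simp
  next
    fix k b assume b: "b \<in> B (Suc k)"
    have "lin_ext (D'' k) (lin_ext (\<psi> (Suc k)) (\<phi> (Suc k) b)) = lin_ext (\<lambda>c. lin_ext (\<psi> k) (D' k c)) (\<phi> (Suc k) b)"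
      unfolding lin_ext_comp using \<phi>_mem[OF b] \<psi>
      by (intro lin_ext_cong) (auto simp: free_module_def chain_map_over_identity_def)
    also have "\<dots> = lin_ext (\<psi> k) (lin_ext (D' k) (\<phi> (Suc k) b))" by (simp add: lin_ext_comp)
    also have "lin_ext (D' k) (\<phi> (Suc k) b) = lin_ext (\<phi> k) (D k b)"
      using \<phi> b unfolding chain_map_over_identity_def by blast
    finally show "lin_ext (D'' k) (lin_ext (\<psi> (Suc k)) (\<phi> (Suc k) b))
        = lin_ext (\<lambda>b. lin_ext (\<psi> k) (\<phi> k b)) (D k b)"
      by (simp add: lin_ext_comp)
  qed
qed

text \<open>The composite of comparison maps in both directions lifts the identity of S/I, hence is
  homotopic to the identity. On cycles of the reduced complex it therefore differs from the identity
  by boundaries.\<close>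

lemma tensor_independent_sets_transfer:
  assumes R: "graded_resolution n I B deg D \<epsilon>" and R': "graded_resolution n I B' deg' D' \<epsilon>'"
    and X: "finite X" "X \<subseteq> tensor_cycles B deg D i e" "indep_mod X (tensor_boundaries B deg D i e)"
  shows "\<exists>X'. finite X' \<and> X' \<subseteq> tensor_cycles B' deg' D' i e
    \<and> indep_mod X' (tensor_boundaries B' deg' D' i e) \<and> card X' = card X"
proof -
  interpret R: graded_resolution n I B deg D \<epsilon> by fact
  obtain \<phi> where \<phi>: "chain_map_over_identity n I B deg D \<epsilon> B' deg' D' \<epsilon>' \<phi>"
    using chain_map_exists[OF R R'] by blast
  obtain \<psi> where \<psi>: "chain_map_over_identity n I B' deg' D' \<epsilon>' B deg D \<epsilon> \<psi>"
    using chain_map_exists[OF R' R] by blast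
  let ?f = "lin_ext (\<lambda>b. reduce (\<phi> i b))" and ?g = "lin_ext (\<lambda>b. reduce (\<psi> i b))"
  have comp: "?g (?f x) = lin_ext (\<lambda>b. reduce (lin_ext (\<psi> i) (\<phi> i b))) x" for x
    by (simp add: lin_ext_comp reduce_lin_ext)
  have gf: "?g (?f z) - z \<in> tensor_boundaries B deg D i e" if "z \<in> tensor_cycles B deg D i e" for z
    unfolding comp using homotopy_tensor[OF R chain_map_comp[OF R.ideal \<phi> \<psi> R.diff_mem] that] .
  note transfer = indep_mod_transfer[OF X submodule_tensor_boundaries, of ?f ?g,
      OF lin_ext_add lin_ext_scale lin_ext_add lin_ext_scale chain_map_tensor(2)[OF \<psi>] gf]
  show ?thesis
    using transfer X chain_map_tensor(1)[OF \<phi>] by (intro exI[of _ "?f ` X"]) blast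
qed

text \<open>The two sets of cardinalities whose suprema define the ranks coincide, so finiteness of
  the resolutions does not enter.\<close>

theorem tensor_homology_rank_unique:
  assumes "graded_resolution n I B deg D \<epsilon>" "graded_resolution n I B' deg' D' \<epsilon>'"
  shows "tensor_homology_rank B deg D i e = tensor_homology_rank B' deg' D' i e"
proof -
  have "{card X |X. finite X \<and> X \<subseteq> tensor_cycles B deg D i e \<and> indep_mod X (tensor_boundaries B deg D i e)}
      = {card X |X. finite X \<and> X \<subseteq> tensor_cycles B' deg' D' i e \<and> indep_mod X (tensor_boundaries B' deg' D' i e)}"
    (is "?L = ?R")
  proof (intro equalityI subsetI)
    fix r assume "r \<in> ?L"
    then obtain X where X: "r = card X" "finite X" "X \<subseteq> tensor_cycles B deg D i e"
      "indep_mod X (tensor_boundaries B deg D i e)" by blast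
    obtain X' where "finite X'" "X' \<subseteq> tensor_cycles B' deg' D' i e"
      "indep_mod X' (tensor_boundaries B' deg' D' i e)" "card X' = card X"
      using tensor_independent_sets_transfer[OF assms X(2-4)] by blast
    then show "r \<in> ?R" unfolding X(1) by (intro CollectI exI[of _ X']) simp
  next
    fix r assume "r \<in> ?R"
    then obtain X where X: "r = card X" "finite X" "X \<subseteq> tensor_cycles B' deg' D' i e"
      "indep_mod X (tensor_boundaries B' deg' D' i e)" by blast
    obtain X' where "finite X'" "X' \<subseteq> tensor_cycles B deg D i e"
      "indep_mod X' (tensor_boundaries B deg D i e)" "card X' = card X"
      using tensor_independent_sets_transfer[OF assms(2,1) X(2-4)] by blast
    then show "r \<in> ?L" unfolding X(1) by (intro CollectI exI[of _ X']) simp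
  qed
  then show ?thesis by (simp add: tensor_homology_rank_alt quotient_rank_alt)
qed

section \<open>The Stanley--Reisner ideal as a monomial ideal\<close>

definition indicator_monomial :: "nat set \<Rightarrow> (nat \<Rightarrow>\<^sub>0 nat)" where
  "indicator_monomial \<sigma> = (\<Sum>i\<in>\<sigma>. single i 1)"

lemma lookup_indicator_monomial:
  assumes "finite \<sigma>" shows "lookup (indicator_monomial \<sigma>) i = (if i \<in> \<sigma> then 1 else 0)"
proof -
  have "lookup (indicator_monomial \<sigma>) i = (\<Sum>j\<in>\<sigma>. if j = i then 1 else 0)"
    unfolding indicator_monomial_def lookup_sum by (intro sum.cong) (auto simp: lookup_single)
  then show ?thesis using assms by simp
qed

lemma keys_indicator_monomial [simp]: "finite \<sigma> \<Longrightarrow> keys (indicator_monomial \<sigma>) = \<sigma>"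
  by (auto simp: in_keys_iff lookup_indicator_monomial split: if_splits)

lemma prod_var: "finite \<sigma> \<Longrightarrow> (\<Prod>i\<in>\<sigma>. var i) = single (indicator_monomial \<sigma>) 1"
  by (induction \<sigma> rule: finite_induct) (auto simp: indicator_monomial_def var_def mult_single)

lemma single_mem_poly_ring: "keys m \<subseteq> {1..n} \<Longrightarrow> single m c \<in> poly_ring n"
  by (auto simp: poly_ring_def)

lemma simplicial_complexD:
  assumes "simplicial_complex V K"
  shows "{} \<in> K" "\<sigma> \<in> K \<Longrightarrow> \<tau> \<subseteq> \<sigma> \<Longrightarrow> \<tau> \<in> K" "\<sigma> \<in> K \<Longrightarrow> finite \<sigma>" "\<sigma> \<in> K \<Longrightarrow> \<sigma> \<subseteq> V"
  using assms unfolding simplicial_complex_def by blast+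

text \<open>A monomial whose support is not a face is divisible by the generator that belongs to its
  own support; conversely, a multiple of a generator has a support containing a nonface.\<close>

lemma stanley_reisner_ideal_eq:
  assumes K: "simplicial_complex {1..n} K"
  shows "(stanley_reisner_ideal n K :: 'k::idom mpoly set) = {f \<in> poly_ring n. \<forall>m\<in>keys f. keys m \<notin> K}" (is "_ = ?I")
proof (intro equalityI subsetI)
  fix f :: "'k mpoly" assume "f \<in> stanley_reisner_ideal n K"
  then obtain q where f: "f = (\<Sum>\<sigma>\<in>Pow {1..n} - K. q \<sigma> * (\<Prod>i\<in>\<sigma>. var i))" and q: "\<And>\<sigma>. q \<sigma> \<in> poly_ring n"
    unfolding stanley_reisner_ideal_def by blast
  have fin: "finite \<sigma>" if "\<sigma> \<in> Pow {1..n} - K" for \<sigma> using that by (auto intro: finite_subset)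
  have "(\<Prod>i\<in>\<sigma>. var i) \<in> (poly_ring n :: 'k mpoly set)" if "\<sigma> \<in> Pow {1..n} - K" for \<sigma>
    unfolding prod_var[OF fin[OF that]] using that fin[OF that] by (intro single_mem_poly_ring) simp
  then have "f \<in> poly_ring n" unfolding f
    using q by (intro poly_ring_sum poly_ring_mult)
  moreover have "keys m \<notin> K" if m: "m \<in> keys f" for m
  proof -
    obtain \<sigma> where \<sigma>: "\<sigma> \<in> Pow {1..n} - K" "m \<in> keys (q \<sigma> * (\<Prod>i\<in>\<sigma>. var i))"
      using m keys_sum_subset[of "\<lambda>\<sigma>. q \<sigma> * (\<Prod>i\<in>\<sigma>. var i)" "Pow {1..n} - K"] unfolding f by blast
    then obtain a where "m = a + indicator_monomial \<sigma>"
      using keys_mult[of "q \<sigma>" "\<Prod>i\<in>\<sigma>. var i"] fin[OF \<sigma>(1)] by (auto simp: prod_var)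
    then have "\<sigma> \<subseteq> keys m" using fin[OF \<sigma>(1)] by (simp add: keys_add_nat)
    then show ?thesis using \<sigma>(1) simplicial_complexD(2)[OF K] by blast
  qed
  ultimately show "f \<in> ?I" by blast
next
  fix f :: "'k mpoly" assume "f \<in> ?I"
  then have f: "f \<in> poly_ring n" "\<And>m. m \<in> keys f \<Longrightarrow> keys m \<notin> K" by auto
  \<comment> \<open>The terms of \<open>f\<close> with support \<open>\<sigma>\<close>, divided by
    the squarefree monomial of \<open>\<sigma>\<close>.\<close>
  define q where "q \<sigma> = (\<Sum>m\<in>{m \<in> keys f. keys m = \<sigma>}. single (m - indicator_monomial \<sigma>) (lookup f m))" for \<sigma>
  have sub: "keys ` keys f \<subseteq> Pow {1..n} - K" using f by (auto simp: poly_ring_def)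
  have "q \<sigma> \<in> poly_ring n" for \<sigma>
    unfolding q_def
  proof (intro poly_ring_sum single_mem_poly_ring)
    fix m assume "m \<in> {m \<in> keys f. keys m = \<sigma>}"
    moreover have "keys (m - indicator_monomial \<sigma>) \<subseteq> keys m"
      by (auto simp: in_keys_iff lookup_minus)
    ultimately show "keys (m - indicator_monomial \<sigma>) \<subseteq> {1..n}" using f(1) by (auto simp: poly_ring_def)
  qed
  moreover have "f = (\<Sum>\<sigma>\<in>Pow {1..n} - K. q \<sigma> * (\<Prod>i\<in>\<sigma>. var i))"
  proof -
    have "q \<sigma> * (\<Prod>i\<in>\<sigma>. var i) = (\<Sum>m\<in>{m \<in> keys f. keys m = \<sigma>}. single m (lookup f m))"
      if "\<sigma> \<in> Pow {1..n} - K" for \<sigma>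
    proof -
      have fin: "finite \<sigma>" using that by (auto intro: finite_subset)
      have "m - indicator_monomial \<sigma> + indicator_monomial \<sigma> = m" if "keys m = \<sigma>" for m
        using that fin
        by (intro poly_mapping_eqI) (auto simp: lookup_add lookup_minus lookup_indicator_monomial in_keys_iff)
      then show ?thesis using fin
        by (auto simp: q_def prod_var sum_distrib_right mult_single intro!: sum.cong)
    qed
    then have "(\<Sum>\<sigma>\<in>Pow {1..n} - K. q \<sigma> * (\<Prod>i\<in>\<sigma>. var i))
        = (\<Sum>\<sigma>\<in>Pow {1..n} - K. \<Sum>m\<in>{m \<in> keys f. keys m = \<sigma>}. single m (lookup f m))"
      by (intro sum.cong) auto
    also have "\<dots> = (\<Sum>m\<in>keys f. single m (lookup f m))"
      using sub by (intro sum.group) auto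
    also have "\<dots> = f" by (rule poly_mapping_sum_single[symmetric]) auto
    finally show ?thesis by simp
  qed
  ultimately show "f \<in> stanley_reisner_ideal n K" unfolding stanley_reisner_ideal_def by blast
qed

lemma homogeneous_stanley_reisner_ideal:
  assumes K: "simplicial_complex {1..n} K"
  shows "homogeneous_ideal n (stanley_reisner_ideal n K)"
  unfolding homogeneous_ideal_def stanley_reisner_ideal_eq[OF K]
proof (intro conjI ballI allI)
  fix f g :: "'a mpoly"
  assume f: "f \<in> poly_ring n" and g: "g \<in> {f \<in> poly_ring n. \<forall>m\<in>keys f. keys m \<notin> K}"
  have "keys m \<notin> K" if m: "m \<in> keys (f * g)" for m
  proof -
    obtain a b where "m = a + b" "b \<in> keys g" using m keys_mult[of f g] by blast
    then show ?thesis using g simplicial_complexD(2)[OF K, of "keys m" "keys b"] by (auto simp: keys_add_nat)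
  qed
  then show "f * g \<in> {f \<in> poly_ring n. \<forall>m\<in>keys f. keys m \<notin> K}" using f g by (auto intro: poly_ring_mult)
qed (auto intro: poly_ring_add poly_ring_restrict_keys simp: keys_restrict_keys dest!: subsetD[OF keys_add])

section \<open>Signs\<close>

text \<open>Signs act on an arbitrary abelian group, so the same lemmas serve chains with
  coefficients in the polynomial ring and in \<open>'k\<close>.\<close>

definition signed :: "nat \<Rightarrow> 'a::ab_group_add \<Rightarrow> 'a" where
  "signed k x = (if even k then x else - x)"

text \<open>The exponent of the sign with which \<open>t\<close> is removed from the ordered set
  \<open>\<tau>\<close>, both in \<open>boundary\<close> and in the exterior algebra.\<close>

definition position :: "nat set \<Rightarrow> nat \<Rightarrow> nat" where
  "position \<tau> t = card {u \<in> \<tau>. u < t}"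

lemma signed_0 [simp]: "signed 0 x = x"
  and signed_zero [simp]: "signed k 0 = 0"
  and signed_Suc: "signed (Suc k) x = - signed k x"
  and signed_add: "signed k (x + y) = signed k x + signed k y"
  and signed_diff: "signed k (x - y) = signed k x - signed k y"
  and signed_signed: "signed k (signed l x) = signed (k + l) x"
  by (auto simp: signed_def)

lemma signed_sum: "signed k (sum f A) = (\<Sum>a\<in>A. signed k (f a))"
  by (rule additive_sum) (rule signed_add)

lemma additive_signed:
  fixes f :: "'a::ab_group_add \<Rightarrow> 'b::ab_group_add"
  assumes "\<And>x y. f (x + y) = f x + f y"
  shows "f (signed k x) = signed k (f x)"
  using additive_diff[OF assms, of 0 x] assms[of 0 0] by (simp add: signed_def)

lemma lookup_signed: "lookup (signed k x) b = (-1) ^ k * lookup x b" for x :: "'b \<Rightarrow>\<^sub>0 'r::comm_ring_1"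
  by (simp add: signed_def)

lemma position_Diff_less: "t \<le> u \<Longrightarrow> position (\<tau> - {u}) t = position \<tau> t"
  unfolding position_def by (rule arg_cong[of _ _ card]) auto

lemma position_Diff_greater:
  assumes "finite \<tau>" "t \<in> \<tau>" "t < u"
  shows "position \<tau> u = Suc (position (\<tau> - {t}) u)"
proof -
  have "{v \<in> \<tau>. v < u} = insert t {v \<in> \<tau> - {t}. v < u}" using assms by auto
  then show ?thesis using assms by (simp add: position_def)
qed

text \<open>The cancellation behind vanishing squares of differentials: for \<open>t < u\<close>,
  removing \<open>t\<close> lowers the position of \<open>u\<close> by one, while removing
  \<open>u\<close> leaves that of \<open>t\<close> unchanged, so the two orders of removal have
  opposite signs.\<close>

lemma alternating_sum_zero:
  fixes G :: "nat \<Rightarrow> nat \<Rightarrow> 'a::ab_group_add"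
  assumes "finite \<tau>" and sym: "\<And>t u. G t u = G u t"
  shows "(\<Sum>t\<in>\<tau>. signed (position \<tau> t) (\<Sum>u\<in>\<tau> - {t}. signed (position (\<tau> - {t}) u) (G t u))) = 0"
proof -
  define H where "H t u = signed (position \<tau> t + position (\<tau> - {t}) u) (G t u)" for t u
  have H: "H t u + H u t = 0" if "t \<in> \<tau>" "u \<in> \<tau>" "t < u" for t u
    using that position_Diff_greater[OF assms(1) that(1,3)] position_Diff_less[of t u \<tau>]
    by (simp add: H_def sym[of u t] signed_def)
  have split: "(\<Sum>u\<in>\<tau> - {t}. H t u) = (\<Sum>u\<in>{u \<in> \<tau>. t < u}. H t u) + (\<Sum>u\<in>{u \<in> \<tau>. u < t}. H t u)" for t
  proof -
    have "\<tau> - {t} = {u \<in> \<tau>. t < u} \<union> {u \<in> \<tau>. u < t}" by auto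
    moreover have "{u \<in> \<tau>. t < u} \<inter> {u \<in> \<tau>. u < t} = {}" by auto
    ultimately show ?thesis using assms(1) by (simp add: sum.union_disjoint)
  qed
  have "(\<Sum>t\<in>\<tau>. signed (position \<tau> t) (\<Sum>u\<in>\<tau> - {t}. signed (position (\<tau> - {t}) u) (G t u)))
      = (\<Sum>t\<in>\<tau>. \<Sum>u\<in>\<tau> - {t}. H t u)"
    by (simp add: H_def signed_sum signed_signed)
  also have "\<dots> = (\<Sum>t\<in>\<tau>. \<Sum>u\<in>{u \<in> \<tau>. t < u}. H t u) + (\<Sum>t\<in>\<tau>. \<Sum>u\<in>{u \<in> \<tau>. u < t}. H t u)"
    by (simp add: split sum.distrib)
  also have "(\<Sum>t\<in>\<tau>. \<Sum>u\<in>{u \<in> \<tau>. u < t}. H t u) = (\<Sum>u\<in>\<tau>. \<Sum>t\<in>{t \<in> \<tau>. u < t}. H t u)"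
    using assms(1) by (intro sum.swap_restrict)
  also have "(\<Sum>t\<in>\<tau>. \<Sum>u\<in>{u \<in> \<tau>. t < u}. H t u) + \<dots> = 0"
    unfolding sum.distrib[symmetric] using H by (intro sum.neutral ballI) auto
  finally show ?thesis .
qed

section \<open>A free resolution of the Stanley--Reisner ring\<close>

text \<open>
  The \<open>S\<close>-basis of \<open>S \<otimes> \<Lambda> \<otimes> S/I\<close> consists of the pairs of a set \<open>\<tau>\<close> (an exterior monomial) and a
  monomial \<open>m\<close> outside \<open>I\<close>, encoded as natural numbers.
\<close>

definition cells :: "(nat set \<times> (nat \<Rightarrow>\<^sub>0 nat)) set" where
  "cells = {\<tau>. finite \<tau>} \<times> UNIV"

definition encode :: "nat set \<Rightarrow> (nat \<Rightarrow>\<^sub>0 nat) \<Rightarrow> nat" where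
  "encode \<tau> m = to_nat_on cells (\<tau>, m)"

definition decode :: "nat \<Rightarrow> nat set \<times> (nat \<Rightarrow>\<^sub>0 nat)" where
  "decode = from_nat_into cells"

text \<open>A monomial is determined by the finite set of its pairs of index and nonzero
  exponent.\<close>

lemma countable_monomials: "countable (UNIV :: (nat \<Rightarrow>\<^sub>0 nat) set)"
proof -
  define graph where "graph m = (\<lambda>i. (i, lookup m i)) ` keys m" for m :: "nat \<Rightarrow>\<^sub>0 nat"
  have "inj graph"
  proof (rule injI, rule poly_mapping_eqI)
    fix m m' i assume eq: "graph m = graph m'"
    have mem: "(i, c) \<in> graph m \<longleftrightarrow> c \<noteq> 0 \<and> lookup m i = c" for m c
      by (auto simp: graph_def in_keys_iff)
    show "lookup m i = lookup m' i" using mem[of _ m] mem[of _ m'] eq by metis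
  qed
  moreover have "countable (range graph)"
    by (rule countable_subset[OF _ countable_Collect_finite]) (auto simp: graph_def)
  ultimately show ?thesis by (rule countable_image_inj_on[rotated])
qed

lemma decode_encode [simp]: "finite \<tau> \<Longrightarrow> decode (encode \<tau> m) = (\<tau>, m)"
proof -
  have "countable cells" unfolding cells_def
    by (intro countable_SIGMA countable_Collect_finite countable_monomials)
  then show "finite \<tau> \<Longrightarrow> decode (encode \<tau> m) = (\<tau>, m)"
    unfolding decode_def encode_def by (intro from_nat_into_to_nat_on) (auto simp: cells_def)
qed

lemma encode_eq_iff: "finite \<tau> \<Longrightarrow> finite \<tau>' \<Longrightarrow> encode \<tau> m = encode \<tau>' m' \<longleftrightarrow> \<tau> = \<tau>' \<and> m = m'"
  by (metis decode_encode prod.inject)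

definition cell_degree :: "nat \<Rightarrow> nat" where
  "cell_degree b = 2 * card (fst (decode b)) + monomial_degree (snd (decode b))"

definition cell_aug :: "nat \<Rightarrow> 'k::idom mpoly" where
  "cell_aug b = single (snd (decode b)) 1"

text \<open>The value 0 is the class in S/I of a monomial whose support is not a face. With this
  convention the formula for the differential needs no case distinction.\<close>

definition cell :: "nat set set \<Rightarrow> nat set \<Rightarrow> (nat \<Rightarrow>\<^sub>0 nat) \<Rightarrow> 'k::idom mpoly \<Rightarrow> (nat \<Rightarrow>\<^sub>0 'k mpoly)" where
  "cell K \<tau> m c = (if keys m \<in> K then single (encode \<tau> m) c else 0)"

text \<open>The Koszul differential: multiplication by the left copy of the variable changes the
  coefficient, and by the right copy the monomial \<open>m\<close>.\<close>

definition cell_diff :: "nat set set \<Rightarrow> nat \<Rightarrow> (nat \<Rightarrow>\<^sub>0 'k::idom mpoly)" where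
  "cell_diff K b = (case decode b of (\<tau>, m) \<Rightarrow>
     \<Sum>t\<in>\<tau>. signed (position \<tau> t) (cell K (\<tau> - {t}) m (var t) - cell K (\<tau> - {t}) (m + single t 1) 1))"

text \<open>
  The contracting homotopy of the Koszul complex of \<open>x\<^sub>t \<otimes> 1\<close>: the smallest index \<open>t\<close> that occurs
  is moved from the monomial \<open>s\<close> to the exterior part.
\<close>

definition cell_htpy :: "nat set set \<Rightarrow> nat \<Rightarrow> (nat \<Rightarrow>\<^sub>0 nat) \<Rightarrow> 'k \<Rightarrow> (nat \<Rightarrow>\<^sub>0 'k::idom mpoly)" where
  "cell_htpy K b s c = (case decode b of (\<tau>, m) \<Rightarrow>
     let t = Min (keys s \<union> \<tau>) in
     if keys s \<union> \<tau> = {} \<or> t \<in> \<tau> then 0 else cell K (insert t \<tau>) m (single (s - single t 1) c))"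

text \<open>Two nested extensions, because the formula depends on the monomial \<open>s\<close> of
  the coefficient: the map is additive but not linear over the polynomial ring.\<close>

definition htpy :: "nat set set \<Rightarrow> (nat \<Rightarrow>\<^sub>0 'k::idom mpoly) \<Rightarrow> (nat \<Rightarrow>\<^sub>0 'k mpoly)" where
  "htpy K = additive_ext (\<lambda>b. additive_ext (cell_htpy K b))"

lemma cell_zero [simp]: "cell K \<tau> m 0 = 0"
  by (simp add: cell_def)

lemma cell_add: "cell K \<tau> m (c + d) = cell K \<tau> m c + cell K \<tau> m d"
  by (simp add: cell_def single_add)

lemma scale_cell: "scale c (cell K \<tau> m d) = cell K \<tau> m (c * d)"
  by (simp add: cell_def)

lemma cell_htpy_add: "cell_htpy K b s (c + d) = cell_htpy K b s c + cell_htpy K b s d"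
  by (cases "decode b") (auto simp: cell_htpy_def cell_add single_add Let_def)

lemma htpy_add: "htpy K (x + y) = htpy K x + htpy K y"
  unfolding htpy_def by (intro additive_ext_add cell_htpy_add)

lemmas htpy_sum = additive_sum[of "htpy K" for K, OF htpy_add]
lemmas htpy_diff = additive_diff[of "htpy K" for K, OF htpy_add]
lemmas htpy_signed = additive_signed[of "htpy K" for K, OF htpy_add]
lemmas lin_ext_signed = additive_signed[of "lin_ext D" for D, OF lin_ext_add]

lemma cell_htpy_zero [simp]: "cell_htpy K b s 0 = 0"
  by (simp add: cell_htpy_def Let_def split: prod.split)

lemma htpy_zero [simp]: "htpy K 0 = 0"
  by (simp add: htpy_def additive_ext_def)

lemma htpy_single: "htpy K (single b (single s c)) = cell_htpy K b s c"
  unfolding htpy_def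
  by (subst additive_ext_single) (simp_all add: additive_ext_single additive_ext_def)

lemma htpy_cell:
  assumes "finite \<tau>"
  shows "htpy K (cell K \<tau> m (single s c)) = (let t = Min (keys s \<union> \<tau>) in
     if keys s \<union> \<tau> = {} \<or> t \<in> \<tau> then 0 else cell K (insert t \<tau>) m (single (s - single t 1) c))"
proof (cases "keys m \<in> K")
  case True
  then have "cell K \<tau> m (single s c) = single (encode \<tau> m) (single s c)" by (simp add: cell_def)
  then show ?thesis by (simp add: htpy_single cell_htpy_def assms)
qed (simp add: cell_def Let_def)

text \<open>Bounds the degree of the left coefficients only; this is the quantity on which the
  exactness proof is an induction.\<close>

definition degree_below :: "nat \<Rightarrow> (nat \<Rightarrow>\<^sub>0 'k::idom mpoly) \<Rightarrow> bool" where
  "degree_below N x \<longleftrightarrow> (\<forall>b. \<forall>s\<in>keys (lookup x b). monomial_degree s < N)"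

lemma degree_below_0 [simp]: "degree_below N 0"
  by (simp add: degree_below_def)

lemma degree_below_add: "degree_below N x \<Longrightarrow> degree_below N y \<Longrightarrow> degree_below N (x + y)"
  unfolding degree_below_def by (auto simp: lookup_add dest!: subsetD[OF keys_add])

lemma degree_below_signed: "degree_below N x \<Longrightarrow> degree_below N (signed k x)"
  by (auto simp: degree_below_def signed_def)

lemma degree_below_sum: "(\<And>a. a \<in> A \<Longrightarrow> degree_below N (f a)) \<Longrightarrow> degree_below N (sum f A)"
  by (induction A rule: infinite_finite_induct) (auto intro: degree_below_add)

lemma degree_below_mono: "degree_below N x \<Longrightarrow> N \<le> N' \<Longrightarrow> degree_below N' x"
  unfolding degree_below_def by fastforce

lemma degree_below_cell: "monomial_degree s < N \<Longrightarrow> degree_below N (cell K \<tau> m (single s c))"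
  by (auto simp: degree_below_def cell_def lookup_single when_def)

lemma degree_below_exists: "\<exists>N. degree_below N x"
proof -
  let ?S = "\<Union>b\<in>keys x. monomial_degree ` keys (lookup x b)"
  have "degree_below (Suc (Max ?S)) x"
    unfolding degree_below_def
  proof (intro allI ballI)
    fix b s assume s: "s \<in> keys (lookup x b)"
    then have "b \<in> keys x" by (auto simp: in_keys_iff)
    with s have "monomial_degree s \<in> ?S" by blast
    then show "monomial_degree s < Suc (Max ?S)" by (simp add: le_imp_less_Suc)
  qed
  then show ?thesis ..
qed

locale complex_on_vertices =
  fixes n :: nat and K :: "nat set set"
  assumes K: "simplicial_complex {1..n} K"
begin

definition cell_basis :: "nat \<Rightarrow> nat set" where
  "cell_basis k = {encode \<tau> m | \<tau> m. \<tau> \<subseteq> {1..n} \<and> card \<tau> = k \<and> keys m \<in> K}"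

lemma cell_basisE:
  assumes "b \<in> cell_basis k"
  obtains \<tau> m where "b = encode \<tau> m" "\<tau> \<subseteq> {1..n}" "card \<tau> = k" "keys m \<in> K" "finite \<tau>" "decode b = (\<tau>, m)"
proof -
  obtain \<tau> m where *: "b = encode \<tau> m" "\<tau> \<subseteq> {1..n}" "card \<tau> = k" "keys m \<in> K"
    using assms unfolding cell_basis_def by blast
  then have "finite \<tau>" by (auto intro: finite_subset)
  with * that show thesis by simp
qed

abbreviation F where "F k \<equiv> free_module (poly_ring n) (cell_basis k)"

lemma cell_mem: "\<tau> \<subseteq> {1..n} \<Longrightarrow> card \<tau> = k \<Longrightarrow> c \<in> poly_ring n \<Longrightarrow> cell K \<tau> m c \<in> F k"
  unfolding cell_def cell_basis_def by (auto intro!: free_module_single)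

lemma cell_not_in: "keys m \<notin> K \<Longrightarrow> cell K \<tau> m c = 0"
  by (simp add: cell_def)

lemma cell_add_not_in: "keys m \<notin> K \<Longrightarrow> cell K \<tau> (m + m') c = 0"
  using simplicial_complexD(2)[OF K, of "keys (m + m')" "keys m"]
  by (auto simp: cell_def keys_add_nat)

text \<open>It remains true when the cell is zero by convention, since enlarging the support of
  \<open>m\<close> leaves it outside \<open>K\<close>.\<close>

lemma cell_diff_cell:
  assumes "finite \<tau>"
  shows "lin_ext (cell_diff K) (cell K \<tau> m c) = (\<Sum>t\<in>\<tau>. signed (position \<tau> t)
     (cell K (\<tau> - {t}) m (c * var t) - cell K (\<tau> - {t}) (m + single t 1) c))"
proof (cases "keys m \<in> K")
  case True
  have "scale c (signed k x) = signed k (scale c x)" for k and x :: "nat \<Rightarrow>\<^sub>0 'a mpoly"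
    by (rule additive_signed) (rule scale_add)
  with True show ?thesis using assms
    by (subst cell_def) (simp add: cell_diff_def scale_sum scale_diff scale_cell)
next
  case False
  then show ?thesis by (simp add: cell_not_in cell_add_not_in)
qed

lemma cell_diff_cell_diff:
  assumes "finite \<tau>"
  shows "lin_ext (cell_diff K) (lin_ext (cell_diff K) (cell K \<tau> m c)) = 0"
proof -
  \<comment> \<open>The product of the two differences of variables for \<open>t\<close> and
    \<open>u\<close>, expanded and applied to the cell with both removed; it is symmetric since the
    variables commute.\<close>
  define G where "G t u = cell K (\<tau> - {t} - {u}) m (c * var t * var u)
      - cell K (\<tau> - {t} - {u}) (m + single u 1) (c * var t)
      - cell K (\<tau> - {t} - {u}) (m + single t 1) (c * var u)
      + cell K (\<tau> - {t} - {u}) (m + single t 1 + single u 1) c" for t u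
  have "G t u = G u t" for t u
  proof -
    have "\<tau> - {t} - {u} = \<tau> - {u} - {t}" by auto
    then show ?thesis by (simp add: G_def mult_ac add_ac)
  qed
  then have "(\<Sum>t\<in>\<tau>. signed (position \<tau> t) (\<Sum>u\<in>\<tau> - {t}. signed (position (\<tau> - {t}) u) (G t u))) = 0"
    by (intro alternating_sum_zero assms)
  moreover have "lin_ext (cell_diff K) (cell K (\<tau> - {t}) m (c * var t) - cell K (\<tau> - {t}) (m + single t 1) c)
      = (\<Sum>u\<in>\<tau> - {t}. signed (position (\<tau> - {t}) u) (G t u))" for t
    using assms by (simp add: lin_ext_diff cell_diff_cell sum_subtractf[symmetric] G_def
        signed_diff[symmetric] algebra_simps)
  ultimately show ?thesis
    using assms by (simp only: cell_diff_cell lin_ext_sum lin_ext_signed)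
qed

lemma cell_diff_twice:
  assumes "x \<in> F k"
  shows "lin_ext (cell_diff K) (lin_ext (cell_diff K) x) = 0"
proof -
  have "lin_ext (cell_diff K) (lin_ext (cell_diff K) x) = lin_ext (\<lambda>_. 0) x"
    unfolding lin_ext_comp
  proof (rule lin_ext_cong)
    fix b assume "b \<in> keys x"
    then have "b \<in> cell_basis k" using assms by (auto simp: free_module_def)
    then obtain \<tau> m where b: "b = encode \<tau> m" "keys m \<in> K" "finite \<tau>" by (rule cell_basisE)
    have "cell_diff K b = lin_ext (cell_diff K) (cell K \<tau> m (1 :: 'a mpoly))"
      using b by (simp add: cell_def)
    then show "lin_ext (cell_diff K) (cell_diff K b :: nat \<Rightarrow>\<^sub>0 'a mpoly) = 0"
      using cell_diff_cell_diff[OF b(3), of m 1] by simp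
  qed
  then show ?thesis by (simp add: lin_ext_def)
qed

lemma var_mem: "t \<in> {1..n} \<Longrightarrow> var t \<in> poly_ring n"
  unfolding var_def by (rule single_mem_poly_ring) auto

lemma free_module_signed: "x \<in> F k \<Longrightarrow> signed l x \<in> F k"
  using free_module_diff[of 0 n _ x] by (auto simp: signed_def)

lemma cell_diff_mem:
  assumes "b \<in> cell_basis (Suc k)" shows "cell_diff K b \<in> F k"
  using assms
proof (rule cell_basisE)
  fix \<tau> m assume "\<tau> \<subseteq> {1..n}" "card \<tau> = Suc k" "finite \<tau>" "decode b = (\<tau>, m)"
  then show ?thesis
    by (auto simp: cell_diff_def intro!: free_module_sum free_module_signed free_module_diff cell_mem var_mem)
qed

lemma monomial_degree_single: "monomial_degree (single t c) = 2 * c"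
  by (simp add: monomial_degree_def)

lemma homogeneous_cell:
  assumes "finite \<tau>" "\<And>s. s \<in> keys c \<Longrightarrow> 2 * card \<tau> + monomial_degree m + monomial_degree s = e"
  shows "homogeneous cell_degree e (cell K \<tau> m c)"
  unfolding homogeneous_def
proof (intro allI ballI)
  fix b s assume "s \<in> keys (lookup (cell K \<tau> m c) b)"
  then have "b = encode \<tau> m" "s \<in> keys c"
    by (auto simp: cell_def lookup_single when_def split: if_splits)
  then show "cell_degree b + monomial_degree s = e" using assms by (simp add: cell_degree_def)
qed

lemma homogeneous_zero [simp]: "homogeneous deg e 0"
  by (simp add: homogeneous_def)

lemma homogeneous_sum:
  "(\<And>a. a \<in> A \<Longrightarrow> homogeneous deg e (f a)) \<Longrightarrow> homogeneous deg e (sum f A)"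
  by (induction A rule: infinite_finite_induct) (simp_all add: homogeneous_add)

lemma cell_diff_homogeneous:
  assumes "b \<in> cell_basis k" shows "homogeneous cell_degree (cell_degree b) (cell_diff K b)"
  using assms
proof (rule cell_basisE)
  fix \<tau> m assume \<tau>: "finite \<tau>" "decode b = (\<tau>, m)"
  have card: "card \<tau> = Suc (card (\<tau> - {t}))" if "t \<in> \<tau>" for t
    using card.remove[OF \<tau>(1) that] .
  have signed: "homogeneous cell_degree e (signed k x)" if "homogeneous cell_degree e x" for e k
    and x :: "nat \<Rightarrow>\<^sub>0 'a mpoly"
    using that by (auto simp: homogeneous_def signed_def)
  have "homogeneous cell_degree (cell_degree b) (cell K (\<tau> - {t}) m (var t) :: nat \<Rightarrow>\<^sub>0 'a mpoly)"
    "homogeneous cell_degree (cell_degree b) (cell K (\<tau> - {t}) (m + single t 1) 1 :: nat \<Rightarrow>\<^sub>0 'a mpoly)"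
    if "t \<in> \<tau>" for t
    using \<tau> card[OF that]
    by (auto simp: cell_degree_def var_def monomial_degree_add monomial_degree_single intro!: homogeneous_cell)
  then show ?thesis
    using \<tau>(2) by (simp add: cell_diff_def homogeneous_sum signed homogeneous_diff)
qed

lemma htpy_mem:
  assumes "x \<in> F k" shows "htpy K x \<in> F (Suc k)"
  unfolding htpy_def additive_ext_def
proof (intro free_module_sum)
  fix b s assume b: "b \<in> keys x" and s: "s \<in> keys (lookup x b)"
  have "keys s \<subseteq> {1..n}" using s assms by (auto simp: free_module_def poly_ring_def)
  have "b \<in> cell_basis k" using b assms by (auto simp: free_module_def)
  then show "cell_htpy K b s (lookup (lookup x b) s) \<in> F (Suc k)"
  proof (rule cell_basisE)
    fix \<tau> m assume \<tau>: "\<tau> \<subseteq> {1..n}" "card \<tau> = k" "finite \<tau>" "decode b = (\<tau>, m)"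
    define t where "t = Min (keys s \<union> \<tau>)"
    show ?thesis
    proof (cases "keys s \<union> \<tau> = {} \<or> t \<in> \<tau>")
      case True
      then show ?thesis using \<tau> by (simp add: cell_htpy_def t_def[symmetric])
    next
      case False
      then have "t \<in> keys s \<union> \<tau>" unfolding t_def using \<tau> by (intro Min_in) auto
      then have t: "t \<notin> \<tau>" "t \<in> {1..n}" using False \<open>keys s \<subseteq> {1..n}\<close> \<tau> by auto
      have "keys (s - single t 1) \<subseteq> keys s" by (auto simp: in_keys_iff lookup_minus)
      then show ?thesis using \<tau> t False \<open>keys s \<subseteq> {1..n}\<close>
        by (auto simp: cell_htpy_def t_def[symmetric] Let_def intro!: cell_mem single_mem_poly_ring)
    qed
  qed
qed

section \<open>Exactness by successive approximation\<close>

definition htpy_error :: "(nat \<Rightarrow>\<^sub>0 'k::idom mpoly) \<Rightarrow> (nat \<Rightarrow>\<^sub>0 'k mpoly)" where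
  "htpy_error x = x - lin_ext (cell_diff K) (htpy K x) - htpy K (lin_ext (cell_diff K) x)"

lemma htpy_error_add: "htpy_error (x + y) = htpy_error x + htpy_error y"
  by (simp add: htpy_error_def htpy_add lin_ext_add)

text \<open>Against the left half of the differential \<open>htpy\<close> is an exact contraction,
  which reproduces the cell. The right half does not raise the degree of \<open>s\<close>, while
  \<open>htpy\<close> divides \<open>s\<close> by a variable, so everything that is left over has
  lower degree.\<close>

lemma htpy_error_cell:
  assumes \<tau>: "finite \<tau>" and ne: "keys s \<union> \<tau> \<noteq> {}"
  shows "degree_below (monomial_degree s) (htpy_error (cell K \<tau> m (single s c)))"
proof -
  let ?d = "lin_ext (cell_diff K)" and ?e = "\<lambda>t. single t (1::nat)"
  let ?u = "cell K \<tau> m (single s c)"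
  define t where "t = Min (keys s \<union> \<tau>)"
  have t: "t \<in> keys s \<union> \<tau>" unfolding t_def using \<tau> ne by (intro Min_in) auto
  have t_le: "t \<le> v" if "v \<in> keys s \<union> \<tau>" for v unfolding t_def using \<tau> that by (intro Min_le) auto
  have deg_less: "monomial_degree (s - ?e v) < monomial_degree s" if "v \<in> keys s" for v
  proof -
    have "s - ?e v + ?e v = s"
      using that by (intro poly_mapping_eqI) (auto simp: lookup_add lookup_minus lookup_single when_def in_keys_iff)
    then have "monomial_degree s = monomial_degree (s - ?e v) + 2"
      by (metis monomial_degree_add monomial_degree_single mult.right_neutral)
    then show ?thesis by simp
  qed
  have mult_var: "single s' c * var v = single (s' + ?e v) c" for s' v
    by (simp add: var_def mult_single)
  have htpy_below: "degree_below (monomial_degree s) (htpy K (cell K \<sigma> m' (single s c)))"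
    if "finite \<sigma>" for \<sigma> m'
  proof (cases "keys s \<union> \<sigma> = {} \<or> Min (keys s \<union> \<sigma>) \<in> \<sigma>")
    case True
    then show ?thesis using that by (auto simp: htpy_cell Let_def)
  next
    case False
    then have "Min (keys s \<union> \<sigma>) \<in> keys s \<union> \<sigma>" using that by (intro Min_in) auto
    then have "Min (keys s \<union> \<sigma>) \<in> keys s" using False by blast
    then have "degree_below (monomial_degree s)
        (cell K (insert (Min (keys s \<union> \<sigma>)) \<sigma>) m' (single (s - ?e (Min (keys s \<union> \<sigma>))) c))"
      by (intro degree_below_cell deg_less)
    then show ?thesis using False that by (simp add: htpy_cell Let_def)
  qed
  define E1 where "E1 = (\<Sum>v\<in>\<tau>. signed (position \<tau> v) (htpy K (cell K (\<tau> - {v}) (m + ?e v) (single s c))))"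
  have E1: "degree_below (monomial_degree s) E1"
    unfolding E1_def using \<tau> by (intro degree_below_sum degree_below_signed htpy_below) auto
  define T where "T v = htpy K (cell K (\<tau> - {v}) m (single (s + ?e v) c))" for v
  have hd: "htpy K (?d ?u) = (\<Sum>v\<in>\<tau>. signed (position \<tau> v) (T v)) - E1"
    using \<tau> by (simp add: cell_diff_cell htpy_sum htpy_signed htpy_diff mult_var T_def E1_def
        signed_diff sum_subtractf)
  have T: "T v = (if t \<in> \<tau> - {v} then 0 else cell K (insert t (\<tau> - {v})) m (single (s + ?e v - ?e t) c))"
    if "v \<in> \<tau>" for v
  proof -
    have "keys (s + ?e v) \<union> (\<tau> - {v}) = keys s \<union> \<tau>" using that by (auto simp: keys_add_nat)
    then show ?thesis using \<tau> ne by (auto simp: T_def htpy_cell t_def[symmetric] Let_def)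
  qed
  have pos_t: "position \<sigma> t = 0" if "\<sigma> \<subseteq> keys s \<union> \<tau>" for \<sigma>
  proof -
    have "{u \<in> \<sigma>. u < t} = {}" using that t_le by fastforce
    then show ?thesis by (simp only: position_def card.empty)
  qed
  show ?thesis
  proof (cases "t \<in> \<tau>")
    case True
    \<comment> \<open>Here \<open>htpy\<close> kills the cell itself. Among the boundary terms only
      \<open>v = t\<close> lets \<open>t\<close> be moved back into the exterior part, and it has
      sign \<open>+\<close> as \<open>t\<close> is least.\<close>
    have "(\<Sum>v\<in>\<tau>. signed (position \<tau> v) (T v)) = (\<Sum>v\<in>\<tau>. if v = t then ?u else 0)"
      using True pos_t[of \<tau>] by (intro sum.cong) (auto simp: T insert_absorb)
    also have "\<dots> = ?u" using True \<tau> by simp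
    finally have "htpy_error ?u = E1"
      using True \<tau> ne by (simp add: htpy_error_def hd htpy_cell t_def[symmetric] Let_def)
    then show ?thesis using E1 by simp
  next
    case False
    then have ts: "t \<in> keys s" using t by blast
    have s_eq: "s - ?e t + ?e v = s + ?e v - ?e t" for v
      using ts by (intro poly_mapping_eqI) (auto simp: lookup_add lookup_minus lookup_single when_def in_keys_iff)
    define E2 where "E2 = (\<Sum>v\<in>insert t \<tau>. signed (position (insert t \<tau>) v)
        (cell K (insert t \<tau> - {v}) (m + ?e v) (single (s - ?e t) c)))"
    have E2: "degree_below (monomial_degree s) E2"
      unfolding E2_def using ts by (intro degree_below_sum degree_below_signed degree_below_cell deg_less)
    have "?d (htpy K ?u) = ?d (cell K (insert t \<tau>) m (single (s - ?e t) c))"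
      using False \<tau> ne by (auto simp: htpy_cell t_def[symmetric] Let_def)
    also have "\<dots> = (\<Sum>v\<in>insert t \<tau>. signed (position (insert t \<tau>) v)
        (cell K (insert t \<tau> - {v}) m (single (s + ?e v - ?e t) c))) - E2"
      using \<tau> by (simp only: cell_diff_cell finite_insert mult_var E2_def signed_diff sum_subtractf s_eq)
    \<comment> \<open>The term \<open>v = t\<close> restores the cell. The others cancel against the
      sum in \<open>hd\<close>, because inserting the smaller index \<open>t\<close> shifts every
      position in \<open>\<tau>\<close> by one.\<close>
    also have "(\<Sum>v\<in>insert t \<tau>. signed (position (insert t \<tau>) v)
        (cell K (insert t \<tau> - {v}) m (single (s + ?e v - ?e t) c)))
        = ?u + (\<Sum>v\<in>\<tau>. signed (position (insert t \<tau>) v) (cell K (insert t \<tau> - {v}) m (single (s + ?e v - ?e t) c)))"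
      using False \<tau> pos_t[of "insert t \<tau>"] t by simp
    also have "(\<Sum>v\<in>\<tau>. signed (position (insert t \<tau>) v) (cell K (insert t \<tau> - {v}) m (single (s + ?e v - ?e t) c)))
        = - (\<Sum>v\<in>\<tau>. signed (position \<tau> v) (T v))"
      unfolding sum_negf[symmetric]
    proof (intro sum.cong refl)
      fix v assume v: "v \<in> \<tau>"
      then have "t < v" using t_le[of v] False by (cases "t = v") auto
      then have "position (insert t \<tau>) v = Suc (position \<tau> v)"
        using position_Diff_greater[of "insert t \<tau>" t v] False \<tau> by simp
      moreover have "insert t \<tau> - {v} = insert t (\<tau> - {v})" using \<open>t < v\<close> by auto
      ultimately show "signed (position (insert t \<tau>) v) (cell K (insert t \<tau> - {v}) m (single (s + ?e v - ?e t) c))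
          = - signed (position \<tau> v) (T v)"
        using v False by (simp add: T signed_Suc)
    qed
    finally have "htpy_error ?u = E1 + E2" by (simp add: htpy_error_def hd)
    then show ?thesis using E1 E2 by (simp add: degree_below_add)
  qed
qed

text \<open>The excluded case \<open>k = 0\<close> and \<open>N = 0\<close> is that of constant
  coefficients on cells with empty exterior part: there both \<open>htpy\<close> and the
  differential vanish, so the error is the element itself and no degree is gained.\<close>

lemma htpy_error_degree_below:
  assumes "x \<in> F k" "degree_below (Suc N) x" "k > 0 \<or> N > 0"
  shows "degree_below N (htpy_error x)"
proof -
  have "x = (\<Sum>b\<in>keys x. single b (lookup x b))" by (rule poly_mapping_sum_single) auto
  also have "\<dots> = (\<Sum>b\<in>keys x. \<Sum>s\<in>keys (lookup x b). single b (single s (lookup (lookup x b) s)))"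
  proof (intro sum.cong refl)
    fix b
    have "lookup x b = (\<Sum>s\<in>keys (lookup x b). single s (lookup (lookup x b) s))"
      by (rule poly_mapping_sum_single) auto
    then have "single b (lookup x b) = single b (\<Sum>s\<in>keys (lookup x b). single s (lookup (lookup x b) s))"
      by (rule arg_cong)
    also have "\<dots> = (\<Sum>s\<in>keys (lookup x b). single b (single s (lookup (lookup x b) s)))"
      by (rule additive_sum) (rule single_add)
    finally show "single b (lookup x b) = \<dots>" .
  qed
  finally have "htpy_error x = (\<Sum>b\<in>keys x. \<Sum>s\<in>keys (lookup x b).
      htpy_error (single b (single s (lookup (lookup x b) s))))" (is "_ = ?R")
    by (metis (no_types, lifting) additive_sum htpy_error_add sum.cong)
  also have "degree_below N ?R"
  proof (intro degree_below_sum)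
    fix b s assume b: "b \<in> keys x" and s: "s \<in> keys (lookup x b)"
    have "monomial_degree s \<le> N" using assms(2) s unfolding degree_below_def by fastforce
    have "b \<in> cell_basis k" using b assms by (auto simp: free_module_def)
    then show "degree_below N (htpy_error (single b (single s (lookup (lookup x b) s))))"
    proof (rule cell_basisE)
      fix \<tau> m assume \<tau>: "b = encode \<tau> m" "card \<tau> = k" "keys m \<in> K" "finite \<tau>"
      let ?c = "lookup (lookup x b) s"
      have eq: "single b (single s ?c) = cell K \<tau> m (single s ?c)" using \<tau> by (simp add: cell_def)
      show ?thesis
      proof (cases "keys s \<union> \<tau> = {}")
        case False
        then show ?thesis unfolding eq using \<tau> \<open>monomial_degree s \<le> N\<close>
          by (intro degree_below_mono[OF htpy_error_cell]) auto
      next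
        case True
        then have "N > 0" using \<tau> assms(3) by auto
        moreover have "htpy_error (cell K \<tau> m (single s ?c)) = cell K \<tau> m (single s ?c)"
          using True by (simp add: htpy_error_def htpy_cell cell_diff_cell Let_def)
        ultimately show ?thesis using True unfolding eq
          by (auto intro!: degree_below_cell simp: monomial_degree_def)
      qed
    qed
  qed
  finally show ?thesis .
qed

lemma htpy_error_mem: "x \<in> F (Suc k) \<Longrightarrow> htpy_error x \<in> F (Suc k)"
  and htpy_error_mem_0: "x \<in> F 0 \<Longrightarrow> lin_ext (cell_diff K) x = 0 \<and> htpy_error x \<in> F 0"
proof -
  have d: "lin_ext (cell_diff K) y \<in> F k" if "y \<in> F (Suc k)" for k y
    using that cell_diff_mem by (rule free_module_lin_ext)
  show "x \<in> F (Suc k) \<Longrightarrow> htpy_error x \<in> F (Suc k)" for x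
    unfolding htpy_error_def by (intro free_module_diff d htpy_mem)
  assume x: "x \<in> F 0"
  have "lin_ext (cell_diff K) x = lin_ext (\<lambda>_. 0) x"
  proof (rule lin_ext_cong)
    fix b assume "b \<in> keys x"
    then have "b \<in> cell_basis 0" using x by (auto simp: free_module_def)
    then show "cell_diff K b = 0" by (rule cell_basisE) (simp add: cell_diff_def)
  qed
  then have "lin_ext (cell_diff K) x = 0" by (simp add: lin_ext_def)
  then show "lin_ext (cell_diff K) x = 0 \<and> htpy_error x \<in> F 0"
    unfolding htpy_error_def using x by (auto intro!: free_module_diff d htpy_mem)
qed

text \<open>The error is again a cycle, differs from \<open>x\<close> by the boundary of
  \<open>htpy K x\<close>, and has a smaller degree bound; at bound 0 nothing is left.\<close>

lemma cell_complex_exact_Suc: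
  assumes "degree_below N x" "x \<in> F (Suc k)" "lin_ext (cell_diff K) x = 0"
  shows "x \<in> lin_ext (cell_diff K) ` F (Suc (Suc k))"
  using assms
proof (induction N arbitrary: x)
  case 0
  then have "lookup x b = 0" for b by (auto simp: degree_below_def simp flip: keys_eq_empty)
  then have "x = 0" by (intro poly_mapping_eqI) simp
  then show ?case by (intro image_eqI[of _ _ 0]) auto
next
  case (Suc N)
  have err: "htpy_error x = x - lin_ext (cell_diff K) (htpy K x)"
    using Suc.prems by (simp add: htpy_error_def)
  have "htpy_error x \<in> lin_ext (cell_diff K) ` F (Suc (Suc k))"
  proof (rule Suc.IH)
    show "degree_below N (htpy_error x)"
      using Suc.prems by (intro htpy_error_degree_below) auto
    show "htpy_error x \<in> F (Suc k)" using Suc.prems by (intro htpy_error_mem)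
    show "lin_ext (cell_diff K) (htpy_error x) = 0"
      using Suc.prems cell_diff_twice[OF htpy_mem[OF Suc.prems(2)]] by (simp add: err lin_ext_diff)
  qed
  then obtain y where "y \<in> F (Suc (Suc k))" "htpy_error x = lin_ext (cell_diff K) y" by blast
  then show ?case using Suc.prems err
    by (intro image_eqI[of _ _ "y + htpy K x"] free_module_add htpy_mem) (auto simp: lin_ext_add algebra_simps)
qed

abbreviation I where "I \<equiv> stanley_reisner_ideal n K"

lemma ideal_iff: "f \<in> I \<longleftrightarrow> f \<in> poly_ring n \<and> (\<forall>m\<in>keys f. keys m \<notin> K)"
  by (simp add: stanley_reisner_ideal_eq[OF K])

lemma augmentation_zero [simp]: "augmentation \<epsilon> 0 = 0"
  by (simp add: augmentation_def additive_ext_def)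

lemma augmentation_cell: "augmentation cell_aug (cell K {} m c) = (if keys m \<in> K then c * single m 1 else 0)"
  by (simp add: cell_def cell_aug_def)

text \<open>Both terms of the differential go to the product of \<open>m\<close> and the variable of
  \<open>t\<close>. They fail to cancel only if this product lies in the ideal, where the second
  term is zero by convention.\<close>

lemma augmentation_cell_diff:
  assumes "x \<in> F (Suc 0)"
  shows "augmentation cell_aug (lin_ext (cell_diff K) x) \<in> I"
proof -
  have "augmentation cell_aug (lin_ext (cell_diff K) x)
      = (\<Sum>b\<in>keys x. lookup x b * augmentation cell_aug (cell_diff K b))"
    unfolding augmentation_lin_ext by (simp add: augmentation_def additive_ext_def)
  also have "\<dots> \<in> I"
  proof (rule homogeneous_ideal_sum[OF homogeneous_stanley_reisner_ideal[OF K]])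
    fix b assume b: "b \<in> keys x"
    then have "b \<in> cell_basis (Suc 0)" using assms by (auto simp: free_module_def)
    then have "augmentation cell_aug (cell_diff K b :: nat \<Rightarrow>\<^sub>0 'a mpoly) \<in> I"
    proof (rule cell_basisE)
      fix \<tau> m assume \<tau>: "\<tau> \<subseteq> {1..n}" "card \<tau> = Suc 0" "keys m \<in> K" "decode b = (\<tau>, m)"
      then obtain t where t: "\<tau> = {t}" by (auto simp: card_Suc_eq)
      have "{u \<in> {t}. u < t} = {}" by auto
      then have "position {t} t = 0" by (simp only: position_def card.empty)
      then have "augmentation cell_aug (cell_diff K b :: nat \<Rightarrow>\<^sub>0 'a mpoly)
          = (if keys (m + single t 1) \<in> K then 0 else single (m + single t 1) 1)"
        using \<tau> by (simp add: cell_diff_def t augmentation_diff augmentation_cell var_def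
            mult_single add.commute)
      moreover have "keys (m + single t 1) \<subseteq> {1..n}"
        using \<tau> t simplicial_complexD(4)[OF K \<tau>(3)] by (auto simp: keys_add_nat)
      ultimately show ?thesis
        by (auto simp: ideal_iff intro!: single_mem_poly_ring)
    qed
    moreover have "lookup x b \<in> poly_ring n" using assms by (auto simp: free_module_def)
    ultimately show "lookup x b * augmentation cell_aug (cell_diff K b) \<in> I"
      using homogeneous_stanley_reisner_ideal[OF K] unfolding homogeneous_ideal_def by blast
  qed
  finally show ?thesis .
qed

text \<open>The recursion now stops at constant coefficients and not at zero. There the augmentation
  sends distinct basis elements to distinct monomials outside the ideal, so its value lies in the
  ideal only for \<open>x = 0\<close>.\<close>

lemma cell_complex_exact_0:
  assumes "degree_below (Suc N) x" "x \<in> F 0" "augmentation cell_aug x \<in> I"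
  shows "x \<in> lin_ext (cell_diff K) ` F (Suc 0)"
  using assms
proof (induction N arbitrary: x)
  case 0
  have const: "lookup x b = single 0 (lookup (lookup x b) 0)" for b
  proof -
    have "s = 0" if "s \<in> keys (lookup x b)" for s
    proof -
      have "monomial_degree s = 0" using 0 that by (auto simp: degree_below_def)
      then show ?thesis by (auto simp: monomial_degree_def in_keys_iff intro!: poly_mapping_eqI)
    qed
    then have "keys (lookup x b) \<subseteq> {0}" by blast
    then have "lookup x b = (\<Sum>s\<in>{0}. single s (lookup (lookup x b) s))"
      by (intro poly_mapping_sum_single) auto
    then show ?thesis by simp
  qed
  have "lookup x b = 0" for b
  proof (rule ccontr)
    assume nz: "lookup x b \<noteq> 0"
    then have "b \<in> keys x" by (simp add: in_keys_iff)
    then have "b \<in> cell_basis 0" using 0 by (auto simp: free_module_def)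
    then obtain m where m: "b = encode {} m" "keys m \<in> K"
      by (rule cell_basisE) auto
    have "lookup (augmentation cell_aug x) m = lookup (lookup x b) 0"
    proof -
      have "lookup (lookup x a * cell_aug a) m = (if a = b then lookup (lookup x b) 0 else 0)" if "a \<in> keys x" for a
      proof -
        have "a \<in> cell_basis 0" using that 0 by (auto simp: free_module_def)
        then obtain m' where m': "a = encode {} m'" by (rule cell_basisE) auto
        have "lookup (lookup x a * cell_aug a) m = lookup (single m' (lookup (lookup x a) 0)) m"
          by (subst const) (simp add: cell_aug_def m' mult_single)
        then show ?thesis by (auto simp: lookup_single m m' encode_eq_iff when_def)
      qed
      then show ?thesis using \<open>b \<in> keys x\<close>
        by (simp add: augmentation_def additive_ext_def lookup_sum)
    qed
    moreover have "lookup (lookup x b) 0 \<noteq> 0" using nz const[of b] by auto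
    ultimately have "m \<in> keys (augmentation cell_aug x)" by (simp add: in_keys_iff)
    then show False using 0(3) m by (auto simp: ideal_iff)
  qed
  then have "x = 0" by (intro poly_mapping_eqI) simp
  then show ?case by (intro image_eqI[of _ _ 0]) auto
next
  case (Suc N)
  have d0: "lin_ext (cell_diff K) x = 0" "htpy_error x \<in> F 0"
    using htpy_error_mem_0[OF Suc.prems(2)] by auto
  then have err: "htpy_error x = x - lin_ext (cell_diff K) (htpy K x)"
    by (simp add: htpy_error_def)
  have h: "htpy K x \<in> F (Suc 0)" using Suc.prems by (intro htpy_mem)
  have "htpy_error x \<in> lin_ext (cell_diff K) ` F (Suc 0)"
  proof (rule Suc.IH)
    show "degree_below (Suc N) (htpy_error x)"
      using Suc.prems by (intro htpy_error_degree_below) auto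
    show "htpy_error x \<in> F 0" by (rule d0)
    show "augmentation cell_aug (htpy_error x) \<in> I"
      unfolding err augmentation_diff using Suc.prems augmentation_cell_diff[OF h]
      by (intro homogeneous_ideal_diff[OF homogeneous_stanley_reisner_ideal[OF K]])
  qed
  then obtain y where "y \<in> F (Suc 0)" "htpy_error x = lin_ext (cell_diff K) y" by blast
  then show ?case using h err
    by (intro image_eqI[of _ _ "y + htpy K x"] free_module_add) (auto simp: lin_ext_add algebra_simps)
qed

theorem cell_resolution:
  "graded_free_resolution n (I :: 'k::idom mpoly set) cell_basis (\<lambda>_. cell_degree) (\<lambda>_. cell_diff K) cell_aug"
  unfolding graded_free_resolution_def Let_def
proof (intro conjI ballI allI)
  fix b assume "b \<in> cell_basis 0"
  then obtain m where m: "b = encode {} m" "keys m \<in> K" by (rule cell_basisE) auto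
  show "(cell_aug b :: 'k mpoly) \<in> poly_ring n"
    unfolding cell_aug_def using m simplicial_complexD(4)[OF K m(2)] by (intro single_mem_poly_ring) simp
  show "monomial_degree s = cell_degree b" if "s \<in> keys (cell_aug b :: 'k mpoly)" for s
    using that m by (simp add: cell_aug_def cell_degree_def)
next
  fix i b assume b: "b \<in> cell_basis (Suc i)"
  show "cell_diff K b \<in> free_module (poly_ring n :: 'k mpoly set) (cell_basis i)"
    using b by (rule cell_diff_mem)
  show "cell_degree c + monomial_degree m = cell_degree b" if "m \<in> keys (lookup (cell_diff K b :: nat \<Rightarrow>\<^sub>0 'k mpoly) c)" for c m
    using cell_diff_homogeneous[OF b, where 'a = 'k] that unfolding homogeneous_def by blast
next
  fix f :: "'k mpoly" assume f: "f \<in> poly_ring n"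
  have aug: "(\<Sum>b\<in>keys x. lookup x b * cell_aug b) = augmentation cell_aug x" for x :: "nat \<Rightarrow>\<^sub>0 'k mpoly"
    by (simp add: augmentation_def additive_ext_def)
  have "keys (0 :: nat \<Rightarrow>\<^sub>0 nat) \<in> K" using simplicial_complexD(1)[OF K] by simp
  then have "augmentation cell_aug (cell K {} 0 f) = f" by (simp add: augmentation_cell flip: single_one)
  moreover have "cell K {} 0 f \<in> F 0" using f by (intro cell_mem) auto
  ultimately show "\<exists>x\<in>F 0. (\<Sum>b\<in>keys x. lookup x b * cell_aug b) - f \<in> I"
    unfolding aug by (intro bexI[of _ "cell K {} 0 f"]) (auto simp: ideal_iff)
next
  have aug: "(\<Sum>b\<in>keys x. lookup x b * cell_aug b) = augmentation cell_aug x" for x :: "nat \<Rightarrow>\<^sub>0 'k mpoly"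
    by (simp add: augmentation_def additive_ext_def)
  show "lin_ext (cell_diff K) ` free_module (poly_ring n :: 'k mpoly set) (cell_basis 1)
      = {x \<in> F 0. (\<Sum>b\<in>keys x. lookup x b * cell_aug b) \<in> I}"
    unfolding aug
  proof (intro equalityI subsetI)
    fix x assume "x \<in> lin_ext (cell_diff K) ` free_module (poly_ring n :: 'k mpoly set) (cell_basis 1)"
    then obtain y where y: "y \<in> F (Suc 0)" "x = lin_ext (cell_diff K) y" by auto
    then have "x \<in> F 0" using cell_diff_mem by (auto intro: free_module_lin_ext)
    then show "x \<in> {x \<in> F 0. augmentation cell_aug x \<in> I}"
      using augmentation_cell_diff[OF y(1)] y(2) by simp
  next
    fix x :: "nat \<Rightarrow>\<^sub>0 'k mpoly" assume x: "x \<in> {x \<in> F 0. augmentation cell_aug x \<in> I}"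
    obtain N where "degree_below N x" using degree_below_exists by blast
    then have "degree_below (Suc N) x" by (rule degree_below_mono) simp
    then show "x \<in> lin_ext (cell_diff K) ` free_module (poly_ring n :: 'k mpoly set) (cell_basis 1)"
      using cell_complex_exact_0 x by auto
  qed
next
  fix i
  show "lin_ext (cell_diff K) ` free_module (poly_ring n :: 'k mpoly set) (cell_basis (Suc (Suc i)))
      = {x \<in> F (Suc i). lin_ext (cell_diff K) x = 0}"
  proof (intro equalityI subsetI)
    fix x assume "x \<in> lin_ext (cell_diff K) ` free_module (poly_ring n :: 'k mpoly set) (cell_basis (Suc (Suc i)))"
    then obtain y where y: "y \<in> F (Suc (Suc i))" "x = lin_ext (cell_diff K) y" by auto
    then have "x \<in> F (Suc i)" using cell_diff_mem by (auto intro: free_module_lin_ext)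
    then show "x \<in> {x \<in> F (Suc i). lin_ext (cell_diff K) x = 0}"
      using cell_diff_twice[OF y(1)] y(2) by simp
  next
    fix x :: "nat \<Rightarrow>\<^sub>0 'k mpoly" assume x: "x \<in> {x \<in> F (Suc i). lin_ext (cell_diff K) x = 0}"
    obtain N where "degree_below N x" using degree_below_exists by blast
    then show "x \<in> lin_ext (cell_diff K) ` free_module (poly_ring n :: 'k mpoly set) (cell_basis (Suc (Suc i)))"
      using cell_complex_exact_Suc x by auto
  qed
qed

text \<open>The Betti number is a definite description: \<open>cell_resolution\<close> supplies
  existence, and \<open>tensor_homology_rank_unique\<close> the uniqueness.\<close>

theorem bigraded_betti_eq:
  "bigraded_betti TYPE('k::idom) n K i e
     = tensor_homology_rank cell_basis (\<lambda>_. cell_degree) (\<lambda>_. cell_diff K :: nat \<Rightarrow> nat \<Rightarrow>\<^sub>0 'k mpoly) i e"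
  unfolding bigraded_betti_def
proof (rule the_equality)
  show "\<exists>B deg D \<epsilon>. graded_free_resolution n (I :: 'k mpoly set) B deg D \<epsilon> \<and>
      tensor_homology_rank cell_basis (\<lambda>_. cell_degree) (\<lambda>_. cell_diff K :: nat \<Rightarrow> nat \<Rightarrow>\<^sub>0 'k mpoly) i e
        = tensor_homology_rank B deg D i e"
    using cell_resolution[where 'k = 'k] by blast
next
  fix r assume "\<exists>B deg D \<epsilon>. graded_free_resolution n (I :: 'k mpoly set) B deg D \<epsilon> \<and>
      r = tensor_homology_rank B deg D i e"
  then obtain B deg D \<epsilon> where "graded_free_resolution n (I :: 'k mpoly set) B deg D \<epsilon>"
    and r: "r = tensor_homology_rank B deg D i e" by blast
  then have "graded_resolution n (I :: 'k mpoly set) B deg D \<epsilon>"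
    and "graded_resolution n (I :: 'k mpoly set) cell_basis (\<lambda>_. cell_degree) (\<lambda>_. cell_diff K) cell_aug"
    using homogeneous_stanley_reisner_ideal[OF K] cell_resolution unfolding graded_resolution_def by blast+
  then show "r = tensor_homology_rank cell_basis (\<lambda>_. cell_degree) (\<lambda>_. cell_diff K :: nat \<Rightarrow> nat \<Rightarrow>\<^sub>0 'k mpoly) i e"
    unfolding r by (rule tensor_homology_rank_unique)
qed

end

section \<open>Hochster's formula\<close>

text \<open>The exterior generator of index \<open>t\<close> carries the degree of the variable of
  index \<open>t\<close>. After reduction the differential only moves \<open>t\<close> from
  \<open>\<tau>\<close> to \<open>m\<close>, so this sum is preserved.\<close>

definition multidegree :: "nat \<Rightarrow> (nat \<Rightarrow>\<^sub>0 nat)" where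
  "multidegree b = indicator_monomial (fst (decode b)) + snd (decode b)"

definition reduced_cell :: "nat set set \<Rightarrow> nat set \<Rightarrow> (nat \<Rightarrow>\<^sub>0 nat) \<Rightarrow> (nat \<Rightarrow>\<^sub>0 'k::idom)" where
  "reduced_cell K \<tau> m = (if keys m \<in> K then single (encode \<tau> m) 1 else 0)"

definition reduced_diff :: "nat set set \<Rightarrow> nat \<Rightarrow> (nat \<Rightarrow>\<^sub>0 'k::idom)" where
  "reduced_diff K b = reduce (cell_diff K b)"

lemma restrict_keys_lin_ext:
  assumes "\<And>b c. b \<in> keys x \<Longrightarrow> c \<in> keys (D b) \<Longrightarrow> \<gamma> c = \<gamma> b"
  shows "lin_ext D (restrict_keys (\<lambda>b. \<gamma> b = g) x) = restrict_keys (\<lambda>b. \<gamma> b = g) (lin_ext D x)"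
proof (rule additive_eqI[of "\<lambda>x. lin_ext D (restrict_keys (\<lambda>b. \<gamma> b = g) x)"])
  fix b r assume b: "b \<in> keys x"
  have "restrict_keys (\<lambda>b. \<gamma> b = g) (scale r (D b)) = (if \<gamma> b = g then scale r (D b) else 0)"
    using assms[OF b] keys_scale[of r "D b"] by (auto intro!: restrict_keys_id restrict_keys_0)
  then show "lin_ext D (restrict_keys (\<lambda>b. \<gamma> b = g) (single b r)) = restrict_keys (\<lambda>b. \<gamma> b = g) (lin_ext D (single b r))"
    by (simp add: restrict_keys_def additive_ext_single)
qed (simp_all add: restrict_keys_add lin_ext_add)

lemma lin_ext_uminus: "lin_ext D (- x) = - lin_ext D x"
  using lin_ext_diff[of D 0 x] by simp

lemma reduce_zero [simp]: "reduce 0 = 0"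
  by (rule poly_mapping_eqI) simp

lemma keys_uminus [simp]: "keys (- x :: 'b \<Rightarrow>\<^sub>0 'r::ab_group_add) = keys x"
  by (auto simp: in_keys_iff)

lemma reduce_signed: "reduce (signed k x) = signed k (reduce x)"
  by (rule additive_signed) (rule reduce_add)

lemma signed_minus: "signed k (- x) = - signed k x"
  by (simp add: signed_def)

text \<open>A variable has constant term 0, so the left half of the Koszul differential disappears
  and only multiplication in S/I remains.\<close>

lemma reduced_diff_decode:
  "reduced_diff K b = (case decode b of (\<tau>, m) \<Rightarrow>
     - (\<Sum>t\<in>\<tau>. signed (position \<tau> t) (reduced_cell K (\<tau> - {t}) (m + single t 1))))"
proof -
  have "single t (1::nat) \<noteq> 0" for t :: nat
    by (metis lookup_single_eq lookup_zero zero_neq_one)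
  then have "constant_term (var t :: 'a mpoly) = 0" for t
    by (simp add: var_def)
  then have zero: "reduce (cell K \<tau> m (var t)) = (0 :: nat \<Rightarrow>\<^sub>0 'a)" for \<tau> m t
    by (simp add: cell_def reduce_single)
  have one: "reduce (cell K \<tau> m 1) = (reduced_cell K \<tau> m :: nat \<Rightarrow>\<^sub>0 'a)" for \<tau> m
    by (simp add: cell_def reduced_cell_def reduce_single constant_term_def)
  show ?thesis
    by (simp add: reduced_diff_def cell_diff_def reduce_sum reduce_signed reduce_diff zero one signed_minus
        sum_negf split: prod.split)
qed

lemma reduced_diff_encode:
  "finite \<tau> \<Longrightarrow> reduced_diff K (encode \<tau> m)
     = - (\<Sum>t\<in>\<tau>. signed (position \<tau> t) (reduced_cell K (\<tau> - {t}) (m + single t 1)))"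
  by (simp add: reduced_diff_decode)

lemma indicator_monomial_remove:
  "finite \<tau> \<Longrightarrow> t \<in> \<tau> \<Longrightarrow> indicator_monomial (\<tau> - {t}) + single t 1 = indicator_monomial \<tau>"
  by (rule poly_mapping_eqI) (auto simp: lookup_add lookup_indicator_monomial lookup_single when_def)

lemma monomial_degree_indicator: "finite \<tau> \<Longrightarrow> monomial_degree (indicator_monomial \<tau>) = 2 * card \<tau>"
  by (simp add: monomial_degree_def lookup_indicator_monomial)

lemma finite_monomials:
  assumes "finite A"
  shows "finite {m :: nat \<Rightarrow>\<^sub>0 nat. keys m \<subseteq> A \<and> monomial_degree m \<le> N}"
proof (rule finite_imageD)
  let ?M = "{m :: nat \<Rightarrow>\<^sub>0 nat. keys m \<subseteq> A \<and> monomial_degree m \<le> N}"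
  show "inj_on lookup ?M" by (intro inj_onI) (simp only: poly_mapping_eq_iff)
  have "lookup m i \<le> N" if "m \<in> ?M" for m i
  proof (cases "i \<in> keys m")
    case True
    then have "2 * lookup m i \<le> monomial_degree m"
      unfolding monomial_degree_def by (intro member_le_sum) auto
    then show ?thesis using that by simp
  qed (simp add: in_keys_iff)
  then have "lookup ` ?M \<subseteq> {f. \<forall>i. (i \<in> A \<longrightarrow> f i \<in> {..N}) \<and> (i \<notin> A \<longrightarrow> f i = 0)}"
    by (auto simp: in_keys_iff)
  moreover have "finite {f. \<forall>i. (i \<in> A \<longrightarrow> f i \<in> {..N}) \<and> (i \<notin> A \<longrightarrow> f i = (0 :: nat))}"
    using assms by (intro finite_set_of_finite_funs) auto
  ultimately show "finite (lookup ` ?M)" by (rule finite_subset)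
qed

context complex_on_vertices
begin

section \<open>Splitting Tor by multidegree\<close>

definition block_basis :: "(nat \<Rightarrow>\<^sub>0 nat) \<Rightarrow> nat \<Rightarrow> nat set" where
  "block_basis g k = {b \<in> cell_basis k. multidegree b = g}"

definition block_cycles :: "(nat \<Rightarrow>\<^sub>0 nat) \<Rightarrow> nat \<Rightarrow> (nat \<Rightarrow>\<^sub>0 'k::idom) set" where
  "block_cycles g i = {x \<in> free_module UNIV (block_basis g i). lin_ext (reduced_diff K) x = 0}"

definition block_boundaries :: "(nat \<Rightarrow>\<^sub>0 nat) \<Rightarrow> nat \<Rightarrow> (nat \<Rightarrow>\<^sub>0 'k::idom) set" where
  "block_boundaries g i = lin_ext (reduced_diff K) ` free_module UNIV (block_basis g (Suc i))"

lemma block_basisE: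
  assumes "b \<in> block_basis g k"
  obtains \<tau> m where "b = encode \<tau> m" "\<tau> \<subseteq> {1..n}" "card \<tau> = k" "keys m \<in> K" "finite \<tau>"
    "decode b = (\<tau>, m)" "indicator_monomial \<tau> + m = g"
proof -
  have "b \<in> cell_basis k" "multidegree b = g" using assms by (simp_all add: block_basis_def)
  from this(1) show thesis
  proof (rule cell_basisE)
    fix \<tau> m
    assume *: "b = encode \<tau> m" "\<tau> \<subseteq> {1..n}" "card \<tau> = k" "keys m \<in> K" "finite \<tau>" "decode b = (\<tau>, m)"
    then have "indicator_monomial \<tau> + m = g"
      using \<open>multidegree b = g\<close> by (simp add: multidegree_def)
    with * show thesis by (rule that)
  qed
qed

lemma block_basisI:
  "\<tau> \<subseteq> {1..n} \<Longrightarrow> card \<tau> = k \<Longrightarrow> keys m \<in> K \<Longrightarrow> indicator_monomial \<tau> + m = g \<Longrightarrow> encode \<tau> m \<in> block_basis g k"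
  unfolding block_basis_def cell_basis_def multidegree_def by (auto simp: finite_subset[of \<tau> "{1..n}"])

lemma keys_reduced_diff:
  assumes "b \<in> block_basis g (Suc k)"
  shows "keys (reduced_diff K b :: nat \<Rightarrow>\<^sub>0 'k::idom) \<subseteq> block_basis g k"
  using assms
proof (rule block_basisE)
  fix \<tau> m assume b: "b = encode \<tau> m" "\<tau> \<subseteq> {1..n}" "card \<tau> = Suc k" "finite \<tau>" "indicator_monomial \<tau> + m = g"
  have "keys (signed l (reduced_cell K (\<tau> - {t}) (m + single t 1)) :: nat \<Rightarrow>\<^sub>0 'k) \<subseteq> block_basis g k"
    if t: "t \<in> \<tau>" for t l
  proof -
    have "indicator_monomial (\<tau> - {t}) + (m + single t 1) = g"
      using indicator_monomial_remove[OF b(4) t] b(5) by (metis add.assoc add.commute)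
    then have "keys (m + single t 1) \<in> K \<Longrightarrow> encode (\<tau> - {t}) (m + single t 1) \<in> block_basis g k"
      using b t by (intro block_basisI) auto
    then show ?thesis by (auto simp: reduced_cell_def signed_def split: if_splits)
  qed
  moreover have "keys (\<Sum>t\<in>\<tau>. signed (position \<tau> t) (reduced_cell K (\<tau> - {t}) (m + single t 1)) :: nat \<Rightarrow>\<^sub>0 'k)
      \<subseteq> (\<Union>t\<in>\<tau>. keys (signed (position \<tau> t) (reduced_cell K (\<tau> - {t}) (m + single t 1)) :: nat \<Rightarrow>\<^sub>0 'k))"
    by (rule keys_sum_subset)
  ultimately show ?thesis unfolding b(1) reduced_diff_encode[OF b(4)] keys_uminus by blast
qed

lemma reduced_diff_0: "b \<in> cell_basis 0 \<Longrightarrow> reduced_diff K b = 0"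
  by (erule cell_basisE) (simp add: reduced_diff_decode)

lemma multidegree_reduced_diff:
  assumes "b \<in> cell_basis k" "c \<in> keys (reduced_diff K b :: nat \<Rightarrow>\<^sub>0 'k::idom)"
  shows "multidegree c = multidegree b"
proof (cases k)
  case 0
  then show ?thesis using assms reduced_diff_0[of b, where 'a = 'k] by simp
next
  case (Suc l)
  then have "b \<in> block_basis (multidegree b) (Suc l)" using assms by (simp add: block_basis_def)
  then have "c \<in> block_basis (multidegree b) l" using keys_reduced_diff assms by blast
  then show ?thesis by (simp add: block_basis_def)
qed

lemma cell_degree_multidegree: "b \<in> cell_basis k \<Longrightarrow> cell_degree b = monomial_degree (multidegree b)"
  by (erule cell_basisE) (simp add: cell_degree_def multidegree_def monomial_degree_add monomial_degree_indicator)

lemma finite_cell_basis_degree: "finite {b \<in> cell_basis k. cell_degree b = e}"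
proof (rule finite_subset)
  let ?M = "{m :: nat \<Rightarrow>\<^sub>0 nat. keys m \<subseteq> {1..n} \<and> monomial_degree m \<le> e}"
  show "{b \<in> cell_basis k. cell_degree b = e} \<subseteq> (\<lambda>(\<tau>, m). encode \<tau> m) ` (Pow {1..n} \<times> ?M)"
  proof
    fix b assume b: "b \<in> {b \<in> cell_basis k. cell_degree b = e}"
    then have "b \<in> cell_basis k" by simp
    then obtain \<tau> m where m: "b = encode \<tau> m" "\<tau> \<subseteq> {1..n}" "keys m \<in> K" "decode b = (\<tau>, m)"
      by (rule cell_basisE)
    then have "m \<in> ?M" using b simplicial_complexD(4)[OF K] by (auto simp: cell_degree_def)
    with m show "b \<in> (\<lambda>(\<tau>, m). encode \<tau> m) ` (Pow {1..n} \<times> ?M)" by force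
  qed
  show "finite ((\<lambda>(\<tau>, m). encode \<tau> m) ` (Pow {1..n} \<times> ?M))"
    by (intro finite_imageI finite_cartesian_product finite_monomials) auto
qed

text \<open>The condition on cycles is void in homological degree 0, where the reduced differential
  vanishes anyway; one description covers all \<open>i\<close>.\<close>

lemma tensor_cycles_cell:
  "tensor_cycles cell_basis (\<lambda>_. cell_degree) (\<lambda>_. cell_diff K :: nat \<Rightarrow> nat \<Rightarrow>\<^sub>0 'k::idom mpoly) i e
     = {x \<in> free_module UNIV {b \<in> cell_basis i. cell_degree b = e}. lin_ext (reduced_diff K) x = 0}"
proof -
  have "lin_ext (reduced_diff K) x = 0" if "i = 0" "keys x \<subseteq> cell_basis i" for x :: "nat \<Rightarrow>\<^sub>0 'k"
    unfolding lin_ext_def using that by (intro sum.neutral) (auto simp: reduced_diff_0)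
  moreover have "(\<lambda>b. reduce (cell_diff K b)) = (reduced_diff K :: nat \<Rightarrow> nat \<Rightarrow>\<^sub>0 'k)"
    by (auto simp: reduced_diff_def)
  ultimately show ?thesis unfolding tensor_cycles_def by (cases i) auto
qed

lemma tensor_boundaries_cell:
  "tensor_boundaries cell_basis (\<lambda>_. cell_degree) (\<lambda>_. cell_diff K :: nat \<Rightarrow> nat \<Rightarrow>\<^sub>0 'k::idom mpoly) i e
     = lin_ext (reduced_diff K) ` free_module UNIV {b \<in> cell_basis (Suc i). cell_degree b = e}"
  by (simp add: tensor_boundaries_def reduced_diff_def[abs_def])

text \<open>The reduced differential preserves the multidegree, which refines the internal degree.
  The set \<open>G\<close> may exceed the multidegrees that occur, which leaves its choice to the
  application.\<close>

lemma betti_eq_sum_blocks: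
  assumes "finite G" "\<And>b. b \<in> cell_basis i \<Longrightarrow> cell_degree b = e \<Longrightarrow> multidegree b \<in> G"
    and "\<And>g. g \<in> G \<Longrightarrow> monomial_degree g = e"
  shows "bigraded_betti TYPE('k::idom) n K i e
     = (\<Sum>g\<in>G. quotient_rank (block_cycles g i) (block_boundaries g i :: (nat \<Rightarrow>\<^sub>0 'k) set))"
proof -
  let ?C = "\<lambda>k. {b \<in> cell_basis k. cell_degree b = e}"
  let ?d = "lin_ext (reduced_diff K) :: (nat \<Rightarrow>\<^sub>0 'k) \<Rightarrow> _"
  let ?r = "\<lambda>g. restrict_keys (\<lambda>b. multidegree b = g) :: (nat \<Rightarrow>\<^sub>0 'k) \<Rightarrow> _"
  define Z where "Z = {x \<in> free_module UNIV (?C i). ?d x = 0}"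
  define W where "W = ?d ` free_module UNIV (?C (Suc i))"
  have C: "{b \<in> ?C k. multidegree b = g} = block_basis g k" if "g \<in> G" for k g
    using assms(3)[OF that] cell_degree_multidegree by (auto simp: block_basis_def)
  have r_d: "?d (?r g x) = ?r g (?d x)" if "keys x \<subseteq> cell_basis k" for x g k
    using that multidegree_reduced_diff by (intro restrict_keys_lin_ext) blast
  have r_C: "keys (?r g x) \<subseteq> ?C k" if "keys x \<subseteq> ?C k" for x g k
    using that by (auto simp: keys_restrict_keys)
  have "bigraded_betti TYPE('k) n K i e = quotient_rank Z W"
    by (simp add: bigraded_betti_eq tensor_homology_rank_alt tensor_cycles_cell tensor_boundaries_cell Z_def W_def)
  also have "\<dots> = (\<Sum>g\<in>G. quotient_rank {z \<in> Z. \<forall>b\<in>keys z. multidegree b = g} {w \<in> W. \<forall>b\<in>keys w. multidegree b = g})"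
  proof (rule quotient_rank_graded[OF finite_cell_basis_degree assms(1)])
    show "multidegree ` ?C i \<subseteq> G" using assms(2) by auto
    show "Z \<subseteq> free_module UNIV (?C i)" by (auto simp: Z_def)
    show "submodule W" unfolding W_def by (rule submodule_image)
  next
    fix g z assume "z \<in> Z"
    then have z: "keys z \<subseteq> ?C i" "?d z = 0" by (auto simp: Z_def)
    moreover have "keys z \<subseteq> cell_basis i" using z by auto
    ultimately show "?r g z \<in> Z" using r_C[of z i g] r_d[of z i g] by (simp add: Z_def)
  next
    fix g w assume "w \<in> W"
    then obtain y where y: "keys y \<subseteq> ?C (Suc i)" "w = ?d y" by (auto simp: W_def)
    moreover have "keys y \<subseteq> cell_basis (Suc i)" using y by auto
    ultimately show "?r g w \<in> W" using r_C[of y "Suc i" g] r_d[of y "Suc i" g] unfolding W_def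
      by (intro image_eqI[of _ _ "?r g y"]) auto
  qed
  also have "\<dots> = (\<Sum>g\<in>G. quotient_rank (block_cycles g i) (block_boundaries g i :: (nat \<Rightarrow>\<^sub>0 'k) set))"
  proof (intro sum.cong refl arg_cong2[of _ _ _ _ quotient_rank])
    fix g assume g: "g \<in> G"
    show "{z \<in> Z. \<forall>b\<in>keys z. multidegree b = g} = block_cycles g i"
      using C[OF g, of i] by (auto simp: Z_def block_cycles_def)
    show "{w \<in> W. \<forall>b\<in>keys w. multidegree b = g} = block_boundaries g i"
    proof (intro equalityI subsetI)
      fix w assume "w \<in> {w \<in> W. \<forall>b\<in>keys w. multidegree b = g}"
      then obtain y where y: "keys y \<subseteq> ?C (Suc i)" "w = ?d y" and w: "\<forall>b\<in>keys w. multidegree b = g"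
        by (auto simp: W_def)
      have "keys y \<subseteq> cell_basis (Suc i)" using y by auto
      then have "?d (?r g y) = w" using r_d[of y "Suc i" g] y(2) w by (simp add: restrict_keys_id)
      moreover have "keys (?r g y) \<subseteq> block_basis g (Suc i)"
        using C[OF g, of "Suc i"] y(1) by (auto simp: keys_restrict_keys)
      ultimately show "w \<in> block_boundaries g i"
        unfolding block_boundaries_def by (intro image_eqI[of _ _ "?r g y"]) auto
    next
      fix w :: "nat \<Rightarrow>\<^sub>0 'k" assume "w \<in> block_boundaries g i"
      then obtain y where y: "keys y \<subseteq> block_basis g (Suc i)" "w = ?d y" by (auto simp: block_boundaries_def)
      have "keys w \<subseteq> block_basis g i"
        using keys_lin_ext[of "reduced_diff K" y] keys_reduced_diff y by blast
      moreover have "keys y \<subseteq> ?C (Suc i)" using y(1) C[OF g, of "Suc i", symmetric] by auto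
      then have "w \<in> W" unfolding W_def y(2) by (intro image_eqI[of _ _ y]) auto
      ultimately show "w \<in> {w \<in> W. \<forall>b\<in>keys w. multidegree b = g}" by (auto simp: block_basis_def)
    qed
  qed
  finally show ?thesis .
qed

text \<open>With exponent at least 2, \<open>m\<close> contains \<open>t\<close> in every cell of
  the block, and still does after one factor \<open>t\<close> has been moved between
  \<open>m\<close> and \<open>\<tau>\<close>. The support of \<open>m\<close>, hence membership in
  \<open>K\<close>, never sees the move, so cells with and without \<open>t\<close> in
  \<open>\<tau>\<close> cancel in pairs.\<close>

lemma block_acyclic:
  assumes g: "lookup g t \<ge> 2"
  shows "quotient_rank (block_cycles g i) (block_boundaries g i :: (nat \<Rightarrow>\<^sub>0 'k::idom) set) = 0"
proof (rule quotient_rank_self, rule subsetI)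
  let ?e = "\<lambda>t. single t (1::nat)"
  let ?d = "lin_ext (reduced_diff K) :: (nat \<Rightarrow>\<^sub>0 'k) \<Rightarrow> _"
  \<comment> \<open>Moves one factor \<open>t\<close> from \<open>m\<close> to the exterior part.
    The sign of the reduced differential makes this a contraction to minus the identity.\<close>
  define h :: "nat \<Rightarrow> (nat \<Rightarrow>\<^sub>0 'k)" where "h b = (case decode b of (\<tau>, m) \<Rightarrow>
    if t \<in> \<tau> then 0 else signed (position \<tau> t) (reduced_cell K (insert t \<tau>) (m - ?e t)))" for b
  have key: "?d (h b) + lin_ext h (reduced_diff K b) = - single b 1" and h_mem: "keys (h b) \<subseteq> block_basis g (Suc k)"
    if b_mem: "b \<in> block_basis g k" for b k
  proof -
    obtain \<tau> m where b: "b = encode \<tau> m" "\<tau> \<subseteq> {1..n}" "card \<tau> = k" "keys m \<in> K" "finite \<tau>"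
      "decode b = (\<tau>, m)" "indicator_monomial \<tau> + m = g" using b_mem by (rule block_basisE)
    have "lookup g t = (if t \<in> \<tau> then 1 else 0) + lookup m t"
      by (simp flip: b(7) add: lookup_add lookup_indicator_monomial b(5))
    then have mt: "lookup m t \<ge> (if t \<in> \<tau> then 1 else 2)" using g by auto
    then have tm: "t \<in> keys m" by (auto simp: in_keys_iff split: if_splits)
    then have "t \<in> {1..n}" using b(4) simplicial_complexD(4)[OF K] by blast
    have "t \<notin> \<tau> \<Longrightarrow> keys (m - ?e t) = keys m"
      using mt by (auto simp: in_keys_iff lookup_minus lookup_single when_def split: if_splits)
    moreover have "t \<notin> \<tau> \<Longrightarrow> indicator_monomial (insert t \<tau>) + (m - ?e t) = g"
      using mt b(5) unfolding b(7)[symmetric]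
      by (intro poly_mapping_eqI)
         (auto simp: lookup_add lookup_minus lookup_indicator_monomial lookup_single when_def)
    ultimately have "t \<notin> \<tau> \<Longrightarrow> encode (insert t \<tau>) (m - ?e t) \<in> block_basis g (Suc k)"
      using b \<open>t \<in> {1..n}\<close> by (intro block_basisI) auto
    then show "keys (h b) \<subseteq> block_basis g (Suc k)"
      by (auto simp: h_def b(6) reduced_cell_def signed_def)
    have h_cell: "lin_ext h (reduced_cell K (\<tau> - {v}) (m + ?e v))
        = (if t \<in> \<tau> - {v} then 0 else
           signed (position (\<tau> - {v}) t) (reduced_cell K (insert t (\<tau> - {v})) (m + ?e v - ?e t)))" if "v \<in> \<tau>" for v
    proof -
      have "keys (m + ?e v - ?e t) = keys (m + ?e v)" if "t \<notin> \<tau> - {v}"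
        using mt tm that by (auto simp: in_keys_iff lookup_minus lookup_add lookup_single when_def split: if_splits)
      then show ?thesis using b(5) by (auto simp: reduced_cell_def h_def)
    qed
    have hd: "lin_ext h (reduced_diff K b) = - (\<Sum>v\<in>\<tau>. signed (position \<tau> v) (lin_ext h (reduced_cell K (\<tau> - {v}) (m + ?e v))))"
      unfolding b(1) reduced_diff_encode[OF b(5)]
      by (simp add: additive_diff[of "lin_ext h" 0, simplified] lin_ext_add lin_ext_sum lin_ext_signed)
    show "?d (h b) + lin_ext h (reduced_diff K b) = - single b 1"
    proof (cases "t \<in> \<tau>")
      case True
      have "(\<Sum>v\<in>\<tau>. signed (position \<tau> v) (lin_ext h (reduced_cell K (\<tau> - {v}) (m + ?e v))))
          = (\<Sum>v\<in>\<tau>. if v = t then single b 1 else 0)"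
      proof (intro sum.cong refl)
        fix v assume v: "v \<in> \<tau>"
        show "signed (position \<tau> v) (lin_ext h (reduced_cell K (\<tau> - {v}) (m + ?e v))) = (if v = t then single b 1 else 0)"
        proof (cases "v = t")
          case True
          have "reduced_cell K \<tau> m = (single b 1 :: nat \<Rightarrow>\<^sub>0 'k)" using b by (simp add: reduced_cell_def)
          moreover have "m + ?e t - ?e t = m" by simp
          moreover have "even (position \<tau> t + position (\<tau> - {t}) t)"
            using position_Diff_less[of t t \<tau>] by simp
          moreover have "insert t (\<tau> - {t}) = \<tau>" using v True by auto
          ultimately show ?thesis using v True
            unfolding h_cell[OF v] by (simp only: signed_signed if_True Diff_iff singletonI simp_thms if_False)
              (simp only: signed_def if_True)
        next
          case False
          then show ?thesis using v \<open>t \<in> \<tau>\<close> unfolding h_cell[OF v] by simp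
        qed
      qed
      also have "\<dots> = single b 1" using True b(5) by simp
      finally show ?thesis using True by (simp add: hd) (simp add: h_def b(6))
    next
      case False
      have "?d (h b) = signed (position \<tau> t) (- (\<Sum>v\<in>insert t \<tau>. signed (position (insert t \<tau>) v)
          (reduced_cell K (insert t \<tau> - {v}) (m - ?e t + ?e v))))"
      proof -
        have "h b = signed (position \<tau> t) (single (encode (insert t \<tau>) (m - ?e t)) 1)"
          using False b(4,6) \<open>t \<notin> \<tau> \<Longrightarrow> keys (m - ?e t) = keys m\<close> by (simp add: h_def reduced_cell_def)
        then show ?thesis using b(5) by (simp add: lin_ext_signed reduced_diff_encode)
      qed
      also have "(\<Sum>v\<in>insert t \<tau>. signed (position (insert t \<tau>) v) (reduced_cell K (insert t \<tau> - {v}) (m - ?e t + ?e v)))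
          = signed (position \<tau> t) (single b 1 :: nat \<Rightarrow>\<^sub>0 'k)
           + (\<Sum>v\<in>\<tau>. signed (position (insert t \<tau>) v) (reduced_cell K (insert t (\<tau> - {v})) (m + ?e v - ?e t)))"
      proof -
        have "m - ?e t + ?e v = m + ?e v - ?e t" for v
          using tm by (intro poly_mapping_eqI) (auto simp: lookup_add lookup_minus lookup_single when_def in_keys_iff)
        moreover have "insert t \<tau> - {v} = insert t (\<tau> - {v})" if "v \<in> \<tau>" for v using False that by auto
        moreover have "position (insert t \<tau>) t = position \<tau> t"
          unfolding position_def by (rule arg_cong[of _ _ card]) auto
        moreover have "reduced_cell K \<tau> m = (single b 1 :: nat \<Rightarrow>\<^sub>0 'k)"
          using b(1,4) by (simp add: reduced_cell_def)
        moreover have "m - ?e t + ?e t = m"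
          using tm by (intro poly_mapping_eqI) (auto simp: lookup_add lookup_minus lookup_single when_def in_keys_iff)
        ultimately show ?thesis using False b(5) by (simp cong: sum.cong)
      qed
      also have "signed (position \<tau> t) (- (signed (position \<tau> t) (single b 1 :: nat \<Rightarrow>\<^sub>0 'k)
           + (\<Sum>v\<in>\<tau>. signed (position (insert t \<tau>) v) (reduced_cell K (insert t (\<tau> - {v})) (m + ?e v - ?e t)))))
          = - single b 1 - (\<Sum>v\<in>\<tau>. signed (position \<tau> t + position (insert t \<tau>) v)
              (reduced_cell K (insert t (\<tau> - {v})) (m + ?e v - ?e t)))"
        by (simp only: signed_minus signed_add signed_signed signed_sum) (simp add: signed_def)
      also have "(\<Sum>v\<in>\<tau>. signed (position \<tau> t + position (insert t \<tau>) v)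
              (reduced_cell K (insert t (\<tau> - {v})) (m + ?e v - ?e t)))
          = - (\<Sum>v\<in>\<tau>. signed (position \<tau> v) (lin_ext h (reduced_cell K (\<tau> - {v}) (m + ?e v))))"
        unfolding sum_negf[symmetric]
      proof (intro sum.cong refl)
        fix v assume v: "v \<in> \<tau>"
        \<comment> \<open>Removing \<open>v\<close> and inserting \<open>t\<close> in the two
          possible orders gives opposite signs.\<close>
        have "odd (position \<tau> t + position (insert t \<tau>) v + (position \<tau> v + position (\<tau> - {v}) t))"
        proof (cases "v < t")
          case True
          then have "position (insert t \<tau>) v = position \<tau> v"
            using position_Diff_less[of v t "insert t \<tau>"] False by simp
          then show ?thesis using True position_Diff_greater[OF b(5) v True] by auto
        next
          case ge: False
          then have "t < v" using v False by (metis linorder_neqE_nat)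
          then show ?thesis
            using position_Diff_less[of t v \<tau>] position_Diff_greater[of "insert t \<tau>" t v] False b(5) by auto
        qed
        then show "signed (position \<tau> t + position (insert t \<tau>) v) (reduced_cell K (insert t (\<tau> - {v})) (m + ?e v - ?e t))
            = - signed (position \<tau> v) (lin_ext h (reduced_cell K (\<tau> - {v}) (m + ?e v)))"
          using False unfolding h_cell[OF v] by (simp add: signed_signed) (auto simp: signed_def)
      qed
      finally show ?thesis by (simp add: hd)
    qed
  qed
  fix z :: "nat \<Rightarrow>\<^sub>0 'k" assume "z \<in> block_cycles g i"
  then have z: "keys z \<subseteq> block_basis g i" "?d z = 0" by (auto simp: block_cycles_def)
  have "?d (lin_ext h z) + lin_ext h (?d z) = lin_ext (\<lambda>b. - single b 1) z"
    unfolding lin_ext_comp lin_ext_fun_add[symmetric] using z key by (intro lin_ext_cong) auto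
  also have "\<dots> = - z"
    using lin_ext_fun_diff[of "\<lambda>_. 0" "\<lambda>b. single b 1" z] by (simp add: lin_ext_def[of "\<lambda>_. 0"])
  finally have "z = ?d (- lin_ext h z)"
    using z by (simp add: lin_ext_uminus eq_neg_iff_add_eq_0 add.commute)
  moreover have "keys (- lin_ext h z) \<subseteq> block_basis g (Suc i)"
    using keys_lin_ext[of h z] h_mem z unfolding keys_uminus by blast
  ultimately show "z \<in> block_boundaries g i" unfolding block_boundaries_def
    by (intro image_eqI[of _ _ "- lin_ext h z"]) simp_all
qed

section \<open>Squarefree multidegrees and simplicial cochains\<close>

lemma lookup_boundary:
  assumes "finite \<sigma>"
  shows "lookup (boundary \<sigma>) \<rho> = (\<Sum>t\<in>\<sigma>. if \<sigma> - {t} = \<rho> then (-1) ^ position \<sigma> t else 0)"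
  unfolding boundary_def lookup_sum position_def by (intro sum.cong refl) (simp add: lookup_single when_def)

text \<open>A strictly increasing relabelling preserves positions, hence all incidence signs; a mere
  bijection would alter them.\<close>

lemma lookup_boundary_image:
  assumes f: "strict_mono_on J f" and "\<sigma> \<subseteq> J" "\<rho> \<subseteq> J" "finite J"
  shows "lookup (boundary (f ` \<sigma>)) (f ` \<rho>) = lookup (boundary \<sigma>) \<rho>"
proof -
  have inj: "inj_on f J" using f by (rule strict_mono_on_imp_inj_on)
  have fin: "finite \<sigma>" using assms finite_subset by blast
  have pos: "position (f ` \<sigma>) (f t) = position \<sigma> t" if "t \<in> \<sigma>" for t
  proof -
    have "{u \<in> f ` \<sigma>. u < f t} = f ` {u \<in> \<sigma>. u < t}"
      using that strict_mono_on_less[OF f] assms(2) by blast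
    moreover have "inj_on f {u \<in> \<sigma>. u < t}" using inj by (rule inj_on_subset) (use assms in auto)
    ultimately show ?thesis by (simp add: position_def card_image)
  qed
  have "lookup (boundary (f ` \<sigma>)) (f ` \<rho>)
      = (\<Sum>t\<in>\<sigma>. if f ` \<sigma> - {f t} = f ` \<rho> then (-1) ^ position (f ` \<sigma>) (f t) else 0)"
    using fin inj_on_subset[OF inj assms(2)] by (simp add: lookup_boundary sum.reindex)
  also have "\<dots> = (\<Sum>t\<in>\<sigma>. if \<sigma> - {t} = \<rho> then (-1) ^ position \<sigma> t else 0)"
  proof (intro sum.cong refl)
    fix t assume t: "t \<in> \<sigma>"
    have "f ` \<sigma> - {f t} = f ` (\<sigma> - {t})"
      using inj_on_image_set_diff[OF inj, of \<sigma> "{t}"] t assms(2) by auto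
    moreover have "f ` (\<sigma> - {t}) = f ` \<rho> \<longleftrightarrow> \<sigma> - {t} = \<rho>"
      using assms by (intro inj_on_image_eq_iff[OF inj]) auto
    ultimately show "(if f ` \<sigma> - {f t} = f ` \<rho> then (-1) ^ position (f ` \<sigma>) (f t) else 0)
        = (if \<sigma> - {t} = \<rho> then (-1) ^ position \<sigma> t else (0 :: 'b))"
      using pos[OF t] by simp
  qed
  finally show ?thesis using fin by (simp add: lookup_boundary)
qed

lemma keys_boundary: "finite \<sigma> \<Longrightarrow> keys (boundary \<sigma>) \<subseteq> (\<lambda>t. \<sigma> - {t}) ` \<sigma>"
  unfolding boundary_def by (auto dest!: subsetD[OF keys_sum_subset] split: if_splits)

definition squarefree_cell :: "nat set \<Rightarrow> nat set \<Rightarrow> nat" where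
  "squarefree_cell J \<sigma> = encode (J - \<sigma>) (indicator_monomial \<sigma>)"

text \<open>The rescaling of the basis that converts the exterior sign, a position in the complement
  \<open>J - \<sigma>\<close>, into the simplicial sign, a position in the face.\<close>

definition coboundary_sign :: "nat set \<Rightarrow> nat set \<Rightarrow> 'k::idom" where
  "coboundary_sign J \<sigma> = (-1) ^ (\<Sum>t\<in>\<sigma>. position J t)"

lemma coboundary_sign_square [simp]: "coboundary_sign J \<sigma> * coboundary_sign J \<sigma> = 1"
  by (simp add: coboundary_sign_def flip: power_add power_mult_distrib)

lemma indicator_monomial_union:
  "finite J \<Longrightarrow> \<sigma> \<subseteq> J \<Longrightarrow> indicator_monomial (J - \<sigma>) + indicator_monomial \<sigma> = indicator_monomial J"
  by (rule poly_mapping_eqI)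
     (auto simp: lookup_add lookup_indicator_monomial finite_subset[of \<sigma> J])

lemma squarefree_cell_eq_iff:
  assumes "finite J" "\<sigma> \<subseteq> J" "\<rho> \<subseteq> J"
  shows "squarefree_cell J \<sigma> = squarefree_cell J \<rho> \<longleftrightarrow> \<sigma> = \<rho>"
proof -
  have "J - \<sigma> = J - \<rho> \<longleftrightarrow> \<sigma> = \<rho>" using assms by blast
  then show ?thesis unfolding squarefree_cell_def using assms(1) by (simp add: encode_eq_iff) blast
qed

text \<open>All exponents of the multidegree are 0 or 1, so each vertex of \<open>J\<close> lies
  either in the exterior part or in the support of the monomial, and the support
  \<open>\<sigma>\<close> determines the cell.\<close>

lemma block_basis_squarefree:
  assumes J: "J \<subseteq> {1..n}" "card J = k + r"
  shows "block_basis (indicator_monomial J) k = squarefree_cell J ` {\<sigma> \<in> K. \<sigma> \<subseteq> J \<and> card \<sigma> = r}"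
proof (intro equalityI subsetI)
  have fin: "finite J" using J finite_subset by blast
  {
    fix b assume "b \<in> block_basis (indicator_monomial J) k"
    then show "b \<in> squarefree_cell J ` {\<sigma> \<in> K. \<sigma> \<subseteq> J \<and> card \<sigma> = r}"
    proof (rule block_basisE)
      fix \<tau> m assume b: "b = encode \<tau> m" "card \<tau> = k" "keys m \<in> K" "finite \<tau>"
        "indicator_monomial \<tau> + m = indicator_monomial J"
      have l: "(if i \<in> \<tau> then 1 else 0) + lookup m i = (if i \<in> J then 1 else 0)" for i
        using arg_cong[OF b(5), of "\<lambda>x. lookup x i"]
        by (simp only: lookup_add lookup_indicator_monomial[OF fin] lookup_indicator_monomial[OF b(4)])
      have \<tau>: "\<tau> \<subseteq> J"
      proof
        fix i assume "i \<in> \<tau>" then show "i \<in> J" using l[of i] by (simp split: if_splits)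
      qed
      have "m = indicator_monomial (J - \<tau>)"
      proof (rule poly_mapping_eqI)
        fix i show "lookup m i = lookup (indicator_monomial (J - \<tau>)) i"
          using l[of i] \<tau> fin by (auto simp: lookup_indicator_monomial split: if_splits)
      qed
      moreover have "J - (J - \<tau>) = \<tau>" using \<tau> by blast
      moreover have "card (J - \<tau>) = r" using \<tau> fin b J by (simp add: card_Diff_subset)
      ultimately show ?thesis using b(1,3) fin
        by (intro image_eqI[of _ _ "J - \<tau>"]) (auto simp: squarefree_cell_def)
    qed
  next
    fix b assume "b \<in> squarefree_cell J ` {\<sigma> \<in> K. \<sigma> \<subseteq> J \<and> card \<sigma> = r}"
    then obtain \<sigma> where \<sigma>: "b = squarefree_cell J \<sigma>" "\<sigma> \<in> K" "\<sigma> \<subseteq> J" "card \<sigma> = r" by blast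
    then have "finite \<sigma>" using fin finite_subset by blast
    then show "b \<in> block_basis (indicator_monomial J) k"
      unfolding \<sigma>(1) squarefree_cell_def using \<sigma> J fin
      by (intro block_basisI indicator_monomial_union) (auto simp: card_Diff_subset)
  }
qed

text \<open>Up to the basis signs and a global minus, the reduced differential is the transpose of
  the boundary matrix. The signs match because \<open>position J t\<close> is the sum of the
  positions of \<open>t\<close> in \<open>J - \<rho>\<close> and in \<open>\<rho>\<close>.\<close>

lemma lookup_reduced_diff_squarefree:
  assumes "finite J" "\<rho> \<in> K" "\<sigma> \<in> K" "\<rho> \<subseteq> J" "\<sigma> \<subseteq> J"
  shows "lookup (reduced_diff K (squarefree_cell J \<rho>)) (squarefree_cell J \<sigma>)
     = - (coboundary_sign J \<rho> * coboundary_sign J \<sigma> * lookup (boundary \<sigma>) \<rho> :: 'k::idom)"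
proof -
  have fin: "finite \<rho>" "finite \<sigma>" using assms finite_subset by blast+
  have "lookup (reduced_diff K (squarefree_cell J \<rho>)) (squarefree_cell J \<sigma>)
      = - (\<Sum>t\<in>J - \<rho>. (-1) ^ position (J - \<rho>) t *
          lookup (reduced_cell K (J - \<rho> - {t}) (indicator_monomial \<rho> + single t 1)) (squarefree_cell J \<sigma>))"
    unfolding squarefree_cell_def using assms(1)
    by (simp add: reduced_diff_encode lookup_sum lookup_signed)
  also have "(\<Sum>t\<in>J - \<rho>. (-1) ^ position (J - \<rho>) t *
          lookup (reduced_cell K (J - \<rho> - {t}) (indicator_monomial \<rho> + single t 1)) (squarefree_cell J \<sigma>))
      = (\<Sum>t\<in>J - \<rho>. if insert t \<rho> = \<sigma> then (-1) ^ position (J - \<rho>) t else (0 :: 'k))"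
  proof (intro sum.cong refl)
    fix t assume t: "t \<in> J - \<rho>"
    have "indicator_monomial \<rho> + single t 1 = indicator_monomial (insert t \<rho>)"
      using indicator_monomial_remove[of "insert t \<rho>" t] fin t by (simp add: insert_absorb)
    moreover have "J - \<rho> - {t} = J - insert t \<rho>" by auto
    ultimately have "reduced_cell K (J - \<rho> - {t}) (indicator_monomial \<rho> + single t 1)
        = (if insert t \<rho> \<in> K then single (squarefree_cell J (insert t \<rho>)) 1 else (0 :: nat \<Rightarrow>\<^sub>0 'k))"
      using fin by (simp add: reduced_cell_def squarefree_cell_def)
    moreover have "squarefree_cell J (insert t \<rho>) = squarefree_cell J \<sigma> \<longleftrightarrow> insert t \<rho> = \<sigma>"
      using assms t by (intro squarefree_cell_eq_iff) auto
    ultimately show "(-1) ^ position (J - \<rho>) t *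
          lookup (reduced_cell K (J - \<rho> - {t}) (indicator_monomial \<rho> + single t 1)) (squarefree_cell J \<sigma>)
        = (if insert t \<rho> = \<sigma> then (-1) ^ position (J - \<rho>) t else (0 :: 'k))"
      using assms(3) by (auto simp: lookup_single when_def)
  qed
  also have "\<dots> = coboundary_sign J \<rho> * coboundary_sign J \<sigma> * lookup (boundary \<sigma>) \<rho>"
  proof (cases "\<exists>t\<in>J - \<rho>. insert t \<rho> = \<sigma>")
    case True
    then obtain t where t: "t \<in> J - \<rho>" "\<sigma> = insert t \<rho>" by blast
    have "(\<Sum>u\<in>J - \<rho>. if insert u \<rho> = \<sigma> then (-1) ^ position (J - \<rho>) u else (0 :: 'k))
        = (\<Sum>u\<in>J - \<rho>. if u = t then (-1) ^ position (J - \<rho>) u else 0)"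
      using t by (intro sum.cong) auto
    also have "\<dots> = (-1) ^ position (J - \<rho>) t" using t assms(1) by simp
    finally have lhs: "(\<Sum>u\<in>J - \<rho>. if insert u \<rho> = \<sigma> then (-1) ^ position (J - \<rho>) u else (0 :: 'k))
        = (-1) ^ position (J - \<rho>) t" .
    have "lookup (boundary \<sigma>) \<rho> = (\<Sum>u\<in>\<sigma>. if u = t then (-1) ^ position \<sigma> u else (0 :: 'k))"
      unfolding lookup_boundary[OF fin(2)] using t by (intro sum.cong) auto
    also have "\<dots> = (-1) ^ position \<sigma> t" using t fin by simp
    finally have bd: "lookup (boundary \<sigma>) \<rho> = ((-1) ^ position \<sigma> t :: 'k)" .
    have "coboundary_sign J \<sigma> = ((-1) ^ position J t * coboundary_sign J \<rho> :: 'k)"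
      using t fin by (simp add: coboundary_sign_def power_add)
    moreover have "position J t = position (J - \<rho>) t + position \<rho> t"
    proof -
      have "{u \<in> J. u < t} = {u \<in> J - \<rho>. u < t} \<union> {u \<in> \<rho>. u < t}" using assms by auto
      moreover have "{u \<in> J - \<rho>. u < t} \<inter> {u \<in> \<rho>. u < t} = {}" by auto
      ultimately show ?thesis unfolding position_def using assms(1) fin by (simp add: card_Un_disjoint)
    qed
    moreover have "position \<sigma> t = position \<rho> t"
      using position_Diff_less[of t t \<sigma>] t by simp
    ultimately have "coboundary_sign J \<rho> * coboundary_sign J \<sigma> * ((-1) ^ position \<sigma> t :: 'k)
        = (coboundary_sign J \<rho> * coboundary_sign J \<rho>) * ((-1) ^ position \<rho> t * (-1) ^ position \<rho> t)
          * (-1) ^ position (J - \<rho>) t"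
      by (simp only: power_add mult_ac)
    also have "\<dots> = (-1) ^ position (J - \<rho>) t"
      by (simp flip: power_add power_mult_distrib)
    finally show ?thesis unfolding lhs bd by simp
  next
    case False
    have "lookup (boundary \<sigma>) \<rho> = (0 :: 'k)"
      unfolding lookup_boundary[OF fin(2)] using False assms by (intro sum.neutral) auto
    moreover have "(\<Sum>t\<in>J - \<rho>. if insert t \<rho> = \<sigma> then (-1) ^ position (J - \<rho>) t else (0 :: 'k)) = 0"
      using False by (intro sum.neutral) auto
    ultimately show ?thesis by simp
  qed
  finally show ?thesis .
qed

lemma poly_mapping_eq_0_on_image:
  assumes "keys u \<subseteq> e ` B" "\<forall>a\<in>B. lookup u (e a) = 0"
  shows "u = 0"
proof (rule ccontr)
  assume "u \<noteq> 0"
  then obtain c where "c \<in> keys u" by fastforce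
  moreover from this obtain a where "a \<in> B" "c = e a" using assms(1) by blast
  ultimately show False using assms(2) by (simp add: in_keys_iff)
qed

text \<open>By the transposed matrices, cycles on either side are the annihilator of the generating
  boundaries on the other, as \<open>quotient_rank_dual\<close> requires. An exterior part with
  \<open>i\<close> elements leaves \<open>q + 1\<close> vertices of \<open>J\<close> for the face,
  which therefore has dimension \<open>q\<close>.\<close>

lemma quotient_rank_squarefree_block:
  assumes J: "J \<subseteq> {1..n}" "card J = Suc (i + q)" and f: "strict_mono_on J f"
  shows "quotient_rank (block_cycles (indicator_monomial J) i) (block_boundaries (indicator_monomial J) i :: (nat \<Rightarrow>\<^sub>0 'k::idom) set)
     = reduced_homology_rank TYPE('k) ((`) f ` {\<sigma> \<in> K. \<sigma> \<subseteq> J}) q"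
proof -
  let ?g = "indicator_monomial J"
  define A where "A r = {\<sigma> \<in> K. \<sigma> \<subseteq> J \<and> card \<sigma> = r}" for r
  let ?c = "squarefree_cell J"
  let ?w = "coboundary_sign J :: nat set \<Rightarrow> 'k"
  let ?L = "(`) f ` {\<sigma> \<in> K. \<sigma> \<subseteq> J}"
  let ?d = "reduced_diff K :: nat \<Rightarrow> nat \<Rightarrow>\<^sub>0 'k"
  let ?b = "boundary :: nat set \<Rightarrow> nat set \<Rightarrow>\<^sub>0 'k"
  have fin: "finite J" using J finite_subset by blast
  have inj: "inj_on f J" using f by (rule strict_mono_on_imp_inj_on)
  have A: "\<sigma> \<in> K" "\<sigma> \<subseteq> J" "card \<sigma> = r" "finite \<sigma>" if "\<sigma> \<in> A r" for \<sigma> r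
    using that fin finite_subset by (auto simp: A_def)
  have finA: "finite (A r)" for r
    by (rule finite_subset[of _ "Pow J"]) (use fin in \<open>auto simp: A_def\<close>)
  have simplices: "simplices ?L r = (`) f ` A (Suc r)" for r
  proof -
    have "card (f ` \<sigma>) = card \<sigma>" "finite (f ` \<sigma>)" if "\<sigma> \<subseteq> J" for \<sigma>
      using card_image[OF inj_on_subset[OF inj that]] finite_subset[OF that fin] by auto
    then show ?thesis unfolding simplices_def A_def by auto
  qed
  have block: "block_basis ?g k = ?c ` A r" if "k + r = Suc (i + q)" for k r
    unfolding A_def using J that by (intro block_basis_squarefree) auto
  have inj_f: "inj_on ((`) f) (A (Suc q))"
    using A inj_on_image_eq_iff[OF inj] by (intro inj_onI) metis
  have inj_c: "inj_on ?c (A (Suc q))"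
    using A squarefree_cell_eq_iff[OF fin] by (intro inj_onI) metis
  have keys_b: "keys (?b (f ` \<sigma>)) \<subseteq> (`) f ` A r" if \<sigma>: "\<sigma> \<in> A (Suc r)" for \<sigma> r
  proof
    fix s assume s: "s \<in> keys (?b (f ` \<sigma>))"
    obtain t where t: "t \<in> \<sigma>" "s = f ` \<sigma> - {f t}"
      using subsetD[OF keys_boundary s] finite_imageI[OF A(4)[OF \<sigma>], of f] by auto
    then have "s = f ` (\<sigma> - {t})"
      using inj_on_image_set_diff[OF inj, of \<sigma> "{t}"] A(2)[OF \<sigma>] by auto
    moreover have "\<sigma> - {t} \<in> A r"
      using A[OF \<sigma>] t simplicial_complexD(2)[OF K, of \<sigma> "\<sigma> - {t}"] by (auto simp: A_def)
    ultimately show "s \<in> (`) f ` A r" by blast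
  qed
  \<comment> \<open>For \<open>i = 0\<close> no lower exterior degree exists: the differential
    vanishes, just as no face inside \<open>J\<close> has \<open>q + 2\<close> vertices.\<close>
  have keys_d: "keys (lin_ext ?d y) \<subseteq> ?c ` A (Suc (Suc q))" if "keys y \<subseteq> ?c ` A (Suc q)" for y
  proof (cases i)
    case 0
    have "?d b = 0" if "b \<in> keys y" for b
    proof -
      have "b \<in> block_basis ?g 0" using that \<open>keys y \<subseteq> _\<close> block[of 0 "Suc q"] 0 by auto
      then show ?thesis by (intro reduced_diff_0) (simp add: block_basis_def)
    qed
    then have "lin_ext ?d y = 0" unfolding lin_ext_def by (intro sum.neutral) auto
    then show ?thesis by simp
  next
    case (Suc i')
    have "keys (?d b) \<subseteq> block_basis ?g i'" if "b \<in> keys y" for b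
      using that \<open>keys y \<subseteq> _\<close> block[of i "Suc q"] Suc by (intro keys_reduced_diff) auto
    moreover have "block_basis ?g i' = ?c ` A (Suc (Suc q))" using block[of i' "Suc (Suc q)"] Suc by simp
    ultimately show ?thesis using keys_lin_ext[of ?d y] by blast
  qed
  \<comment> \<open>Pairing with a generating boundary of the block reads off one coefficient of the
    simplicial boundary, up to sign; \<open>pairing_b\<close> below is the same with the roles
    exchanged.\<close>
  have pairing_d: "pairing (A (Suc q)) ?w ((`) f) ?c x (?d (?c \<rho>)) = - (?w \<rho> * lookup (lin_ext ?b x) (f ` \<rho>))"
    if \<rho>: "\<rho> \<in> A q" and x: "keys x \<subseteq> (`) f ` A (Suc q)" for x \<rho>
  proof -
    have "lookup (lin_ext ?b x) (f ` \<rho>) = (\<Sum>\<sigma>\<in>A (Suc q). lookup x (f ` \<sigma>) * lookup (?b (f ` \<sigma>)) (f ` \<rho>))"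
      using x finA inj_f by (subst lin_ext_superset[of "(`) f ` A (Suc q)"]) (auto simp: sum.reindex lookup_sum)
    also have "\<dots> = (\<Sum>\<sigma>\<in>A (Suc q). lookup x (f ` \<sigma>) * lookup (?b \<sigma>) \<rho>)"
      using A \<rho> by (intro sum.cong refl) (simp add: lookup_boundary_image[OF f _ _ fin])
    finally have "- (?w \<rho> * lookup (lin_ext ?b x) (f ` \<rho>))
        = (\<Sum>\<sigma>\<in>A (Suc q). - (?w \<rho> * (lookup x (f ` \<sigma>) * lookup (?b \<sigma>) \<rho>)))"
      by (simp add: sum_distrib_left sum_negf)
    also have "\<dots> = (\<Sum>\<sigma>\<in>A (Suc q). ?w \<sigma> * lookup x (f ` \<sigma>) * lookup (?d (?c \<rho>)) (?c \<sigma>))"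
    proof (intro sum.cong refl)
      fix \<sigma> assume \<sigma>: "\<sigma> \<in> A (Suc q)"
      have "?w \<sigma> * lookup x (f ` \<sigma>) * lookup (?d (?c \<rho>)) (?c \<sigma>)
          = - ((?w \<sigma> * ?w \<sigma>) * (?w \<rho> * (lookup x (f ` \<sigma>) * lookup (?b \<sigma>) \<rho>)))"
        using A[OF \<sigma>] A[OF \<rho>] by (simp add: lookup_reduced_diff_squarefree[OF fin] mult_ac)
      then show "- (?w \<rho> * (lookup x (f ` \<sigma>) * lookup (?b \<sigma>) \<rho>))
          = ?w \<sigma> * lookup x (f ` \<sigma>) * lookup (?d (?c \<rho>)) (?c \<sigma>)" by simp
    qed
    finally show ?thesis by (simp add: pairing_def)
  qed
  have pairing_b: "?w \<sigma> * pairing (A (Suc q)) ?w ((`) f) ?c (?b (f ` \<sigma>)) y = - lookup (lin_ext ?d y) (?c \<sigma>)"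
    if \<sigma>: "\<sigma> \<in> A (Suc (Suc q))" and y: "keys y \<subseteq> ?c ` A (Suc q)" for y \<sigma>
  proof -
    have "lookup (lin_ext ?d y) (?c \<sigma>) = (\<Sum>\<rho>\<in>A (Suc q). lookup y (?c \<rho>) * lookup (?d (?c \<rho>)) (?c \<sigma>))"
      using y finA inj_c by (subst lin_ext_superset[of "?c ` A (Suc q)"]) (auto simp: sum.reindex lookup_sum)
    also have "\<dots> = (\<Sum>\<rho>\<in>A (Suc q). - (?w \<sigma> * (?w \<rho> * lookup (?b (f ` \<sigma>)) (f ` \<rho>) * lookup y (?c \<rho>))))"
    proof (intro sum.cong refl)
      fix \<rho> assume \<rho>: "\<rho> \<in> A (Suc q)"
      show "lookup y (?c \<rho>) * lookup (?d (?c \<rho>)) (?c \<sigma>)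
          = - (?w \<sigma> * (?w \<rho> * lookup (?b (f ` \<sigma>)) (f ` \<rho>) * lookup y (?c \<rho>)))"
        using A[OF \<sigma>] A[OF \<rho>]
        by (simp add: lookup_reduced_diff_squarefree[OF fin] lookup_boundary_image[OF f _ _ fin] mult_ac)
    qed
    finally show ?thesis by (simp add: pairing_def sum_distrib_left sum_negf)
  qed
  have w_nz: "?w \<sigma> \<noteq> 0" for \<sigma> by (simp add: coboundary_sign_def)
  have "reduced_homology_rank TYPE('k) ?L q = quotient_rank (block_cycles ?g i) (block_boundaries ?g i :: (nat \<Rightarrow>\<^sub>0 'k) set)"
    unfolding reduced_homology_rank_def
  proof (rule quotient_rank_dual[where A = "A (Suc q)" and f = "(`) f" and g = ?c and w = ?w
        and S = "(`) f ` A (Suc (Suc q))" and T = "?c ` A q" and D = ?b and E = ?d])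
    show "finite (A (Suc q))" "finite ((`) f ` A (Suc (Suc q)))" "finite (?c ` A q)" using finA by auto
    show "inj_on ((`) f) (A (Suc q))" "inj_on ?c (A (Suc q))" by fact+
    show "?w a * ?w a = 1" for a by simp
    show "?b s \<in> free_module UNIV ((`) f ` A (Suc q))" if "s \<in> (`) f ` A (Suc (Suc q))" for s
    proof -
      from that obtain \<sigma> where "s = f ` \<sigma>" "\<sigma> \<in> A (Suc (Suc q))" by blast
      then show ?thesis using keys_b[of \<sigma> "Suc q"] by simp
    qed
    show "?d b \<in> free_module UNIV (?c ` A (Suc q))" if "b \<in> ?c ` A q" for b
    proof -
      have "b \<in> block_basis ?g (Suc i)" using that block[of "Suc i" q] by simp
      from keys_reduced_diff[OF this, where 'k = 'k] show ?thesis using block[of i "Suc q"] by simp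
    qed
    show "lin_ext ?b ` free_module UNIV (simplices ?L (q + 1)) = lin_ext ?b ` free_module UNIV ((`) f ` A (Suc (Suc q)))"
      by (simp add: simplices)
    show "block_boundaries ?g i = lin_ext ?d ` free_module UNIV (?c ` A q)"
      by (simp add: block_boundaries_def block[of "Suc i" q])
  next
    fix x
    have "lin_ext ?b x = 0 \<longleftrightarrow> (\<forall>\<rho>\<in>A q. lookup (lin_ext ?b x) (f ` \<rho>) = 0)" if "keys x \<subseteq> (`) f ` A (Suc q)"
    proof
      assume *: "\<forall>\<rho>\<in>A q. lookup (lin_ext ?b x) (f ` \<rho>) = 0"
      have "keys (lin_ext ?b x) \<subseteq> (`) f ` A q"
      proof -
        have "keys (?b s) \<subseteq> (`) f ` A q" if "s \<in> keys x" for s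
        proof -
          from that \<open>keys x \<subseteq> _\<close> obtain \<sigma> where "s = f ` \<sigma>" "\<sigma> \<in> A (Suc q)" by blast
          then show ?thesis using keys_b[of \<sigma> q] by simp
        qed
        then show ?thesis using keys_lin_ext[of ?b x] by blast
      qed
      then show "lin_ext ?b x = 0" using * by (rule poly_mapping_eq_0_on_image)
    qed simp
    then show "x \<in> {x \<in> free_module UNIV (simplices ?L q). lin_ext ?b x = 0} \<longleftrightarrow>
        x \<in> free_module UNIV ((`) f ` A (Suc q)) \<and> (\<forall>b\<in>?c ` A q. pairing (A (Suc q)) ?w ((`) f) ?c x (?d b) = 0)"
      using pairing_d[of _ x] w_nz by (auto simp: simplices)
  next
    fix y
    have "lin_ext ?d y = 0 \<longleftrightarrow> (\<forall>\<sigma>\<in>A (Suc (Suc q)). lookup (lin_ext ?d y) (?c \<sigma>) = 0)" if "keys y \<subseteq> ?c ` A (Suc q)"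
    proof
      assume *: "\<forall>\<sigma>\<in>A (Suc (Suc q)). lookup (lin_ext ?d y) (?c \<sigma>) = 0"
      with keys_d[OF that] show "lin_ext ?d y = 0" by (rule poly_mapping_eq_0_on_image)
    qed simp
    moreover have "pairing (A (Suc q)) ?w ((`) f) ?c (?b (f ` \<sigma>)) y = 0 \<longleftrightarrow> lookup (lin_ext ?d y) (?c \<sigma>) = 0"
      if "\<sigma> \<in> A (Suc (Suc q))" "keys y \<subseteq> ?c ` A (Suc q)" for \<sigma>
      using pairing_b[OF that] w_nz[of \<sigma>] by (metis mult_eq_0_iff neg_equal_0_iff_equal)
    ultimately show "y \<in> block_cycles ?g i \<longleftrightarrow>
        y \<in> free_module UNIV (?c ` A (Suc q)) \<and> (\<forall>s\<in>(`) f ` A (Suc (Suc q)). pairing (A (Suc q)) ?w ((`) f) ?c (?b s) y = 0)"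
      using block[of i "Suc q"] by (auto simp: block_cycles_def)
  qed
  then show ?thesis by simp
qed

text \<open>
  Relabelling the vertices of each \<open>K\<^sub>J\<close> by an increasing map \<open>f J\<close> does not change its homology.
\<close>

theorem hochster_formula:
  assumes "i < j" and f: "\<And>J. J \<subseteq> {1..n} \<Longrightarrow> card J = j \<Longrightarrow> strict_mono_on J (f J)"
  shows "bigraded_betti TYPE('k::idom) n K i (2 * j)
     = (\<Sum>J\<in>{J. J \<subseteq> {1..n} \<and> card J = j}. reduced_homology_rank TYPE('k) ((`) (f J) ` {\<sigma> \<in> K. \<sigma> \<subseteq> J}) (j - i - 1))"
proof -
  let ?Js = "{J. J \<subseteq> {1..n} \<and> card J = j}"
  let ?h = "\<lambda>g. quotient_rank (block_cycles g i) (block_boundaries g i :: (nat \<Rightarrow>\<^sub>0 'k) set)"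
  define G where "G = {g. keys g \<subseteq> {1..n} \<and> monomial_degree g = 2 * j}"
  have fin: "finite J" if "J \<subseteq> {1..n}" for J using that finite_subset by blast
  have "finite G"
    by (rule finite_subset[OF _ finite_monomials[of "{1..n}" "2 * j"]]) (auto simp: G_def)
  moreover have "multidegree b \<in> G" if b: "b \<in> cell_basis i" "cell_degree b = 2 * j" for b
    using b(1)
  proof (rule cell_basisE)
    fix \<tau> m assume "\<tau> \<subseteq> {1..n}" "keys m \<in> K" "finite \<tau>" "decode b = (\<tau>, m)"
    then have "keys (multidegree b) \<subseteq> {1..n}"
      using simplicial_complexD(4)[OF K] by (simp add: multidegree_def keys_add_nat)
    then show ?thesis using b cell_degree_multidegree[OF b(1)] by (simp add: G_def)
  qed
  ultimately have "bigraded_betti TYPE('k) n K i (2 * j) = sum ?h G"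
    by (intro betti_eq_sum_blocks) (auto simp: G_def)
  also have "\<dots> = sum ?h (indicator_monomial ` ?Js)"
  proof (rule sum.mono_neutral_right[OF \<open>finite G\<close>])
    show "indicator_monomial ` ?Js \<subseteq> G"
    proof
      fix g assume "g \<in> indicator_monomial ` ?Js"
      then obtain J where "g = indicator_monomial J" "J \<subseteq> {1..n}" "card J = j" by blast
      then show "g \<in> G" using fin by (simp add: G_def monomial_degree_indicator)
    qed
    show "\<forall>g\<in>G - indicator_monomial ` ?Js. ?h g = 0"
    proof
      fix g assume g: "g \<in> G - indicator_monomial ` ?Js"
      \<comment> \<open>The total degree \<open>2 * j\<close> is fixed, so with all exponents at
        most 1 the support would have exactly \<open>j\<close> elements.\<close>
      have "\<exists>t. lookup g t \<ge> 2"
      proof (rule ccontr)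
        assume "\<nexists>t. lookup g t \<ge> 2"
        then have "lookup g t < 2" for t using not_le by blast
        then have "lookup g t = 1" if "t \<in> keys g" for t
          using that by (metis One_nat_def in_keys_iff less_2_cases)
        then have eq: "g = indicator_monomial (keys g)"
          by (intro poly_mapping_eqI) (auto simp: lookup_indicator_monomial in_keys_iff)
        then have "monomial_degree g = 2 * card (keys g)" by (metis finite_keys monomial_degree_indicator)
        then have "keys g \<in> ?Js" using g by (simp add: G_def)
        then show False using g eq by blast
      qed
      then show "?h g = 0" using block_acyclic by blast
    qed
  qed
  also have "\<dots> = (\<Sum>J\<in>?Js. ?h (indicator_monomial J))"
  proof -
    have "inj_on indicator_monomial ?Js"
      using fin keys_indicator_monomial by (intro inj_onI) (metis mem_Collect_eq)
    then show ?thesis by (simp add: sum.reindex)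
  qed
  also have "\<dots> = (\<Sum>J\<in>?Js. reduced_homology_rank TYPE('k) ((`) (f J) ` {\<sigma> \<in> K. \<sigma> \<subseteq> J}) (j - i - 1))"
    using assms by (intro sum.cong refl quotient_rank_squarefree_block) auto
  finally show ?thesis .
qed

end

section \<open>Patterns of independent events\<close>

context prob_space
begin

text \<open>Patterns are indexed by a fixed set \<open>T\<close> through \<open>e\<close>, so that
  they can later be compared for different vertex sets \<open>J\<close>.\<close>

lemma prob_pattern:
  assumes indep: "indep_events A I" and p: "\<And>i. i \<in> I \<Longrightarrow> prob (A i) = p"
    and e: "finite T" "inj_on e T" "e ` T \<subseteq> I" and S: "S \<subseteq> T"
  shows "{\<omega> \<in> space M. {\<tau> \<in> T. \<omega> \<in> A (e \<tau>)} = S} \<in> events"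
    and "prob {\<omega> \<in> space M. {\<tau> \<in> T. \<omega> \<in> A (e \<tau>)} = S} = p ^ card S * (1 - p) ^ card (T - S)"
proof -
  have events: "A i \<in> events" if "i \<in> I" for i
    using indep that unfolding indep_events_def by blast
  define B where "B i = (if i \<in> e ` S then A i else space M - A i)" for i
  have B_events: "B i \<in> events" if "i \<in> I" for i using events[OF that] by (auto simp: B_def)
  have mem: "e \<tau> \<in> e ` S \<longleftrightarrow> \<tau> \<in> S" if "\<tau> \<in> T" for \<tau>
    using that e(2) S by (auto dest: inj_onD)
  let ?L = "{\<omega> \<in> space M. {\<tau> \<in> T. \<omega> \<in> A (e \<tau>)} = S}"
  have "?L \<in> events \<and> prob ?L = p ^ card S * (1 - p) ^ card (T - S)"
  \<comment> \<open>The product rule for independent sets is stated for nonempty index sets, and the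
    empty intersection would not be \<open>space M\<close>.\<close>
  proof (cases "T = {}")
    case True
    then have eq: "{\<omega> \<in> space M. {\<tau> \<in> T. \<omega> \<in> A (e \<tau>)} = S} = space M" "card S = 0" "card (T - S) = 0"
      using S by auto
    show ?thesis unfolding eq by (simp add: prob_space)
  next
    case False
    have eq: "?L = (\<Inter>i\<in>e ` T. B i)" (is "_ = ?R")
    proof (intro equalityI subsetI)
      fix \<omega> assume "\<omega> \<in> ?L"
      then show "\<omega> \<in> ?R" using mem by (auto simp: B_def)
    next
      fix \<omega> assume \<omega>: "\<omega> \<in> ?R"
      then have "\<omega> \<in> B (e \<tau>)" if "\<tau> \<in> T" for \<tau> using that by blast
      then have B: "(\<tau> \<in> S \<longrightarrow> \<omega> \<in> A (e \<tau>)) \<and> (\<tau> \<notin> S \<longrightarrow> \<omega> \<in> space M \<and> \<omega> \<notin> A (e \<tau>))" if "\<tau> \<in> T" for \<tau>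
        using mem[OF that] that unfolding B_def by (metis Diff_iff)
      obtain \<tau> where "\<tau> \<in> T" using False by blast
      then have "A (e \<tau>) \<subseteq> space M" using e(3) by (intro sets.sets_into_space events) auto
      then have "\<omega> \<in> space M" using B[OF \<open>\<tau> \<in> T\<close>] by blast
      moreover have "{\<tau> \<in> T. \<omega> \<in> A (e \<tau>)} = S" using B S by blast
      ultimately show "\<omega> \<in> ?L" by simp
    qed
    have events_L: "?L \<in> events" unfolding eq using False e B_events by (intro sets.finite_INT) auto
    \<comment> \<open>Independence of the events themselves says nothing directly about complements;
      the sigma-algebras that they generate contain both.\<close>
    have "indep_sets (\<lambda>i. sigma_sets (space M) {A i}) I"
      using indep unfolding indep_events_def_alt by (rule indep_sets_sigma) (simp add: Int_stable_def)
    moreover have "B i \<in> sigma_sets (space M) {A i}" for i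
      unfolding B_def by (auto intro: sigma_sets.Basic sigma_sets.Compl)
    ultimately have "prob (\<Inter>i\<in>e ` T. B i) = (\<Prod>i\<in>e ` T. prob (B i))"
      using False e by (intro indep_setsD) auto
    also have "\<dots> = (\<Prod>\<tau>\<in>T. prob (B (e \<tau>)))" using e by (simp add: prod.reindex)
    also have "\<dots> = (\<Prod>\<tau>\<in>T. if \<tau> \<in> S then p else 1 - p)"
    proof (intro prod.cong refl)
      fix \<tau> assume "\<tau> \<in> T"
      then have "e \<tau> \<in> I" using e by blast
      then show "prob (B (e \<tau>)) = (if \<tau> \<in> S then p else 1 - p)"
        using mem[OF \<open>\<tau> \<in> T\<close>] p prob_compl[OF events] by (simp add: B_def)
    qed
    also have "\<dots> = p ^ card S * (1 - p) ^ card (T - S)"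
    proof -
      have "T \<inter> {\<tau>. \<tau> \<in> S} = S" "T \<inter> - {\<tau>. \<tau> \<in> S} = T - S" using S by auto
      then show ?thesis using e(1) by (simp add: prod.If_cases)
    qed
    finally show ?thesis using events_L unfolding eq by simp
  qed
  then show "?L \<in> events" and "prob ?L = p ^ card S * (1 - p) ^ card (T - S)" by simp_all
qed

text \<open>The value does not involve \<open>e\<close>, which is why all full subcomplexes on
  \<open>j\<close> vertices contribute the same mean.\<close>

lemma expectation_pattern:
  fixes R :: "'b set \<Rightarrow> real"
  assumes "indep_events A I" "\<And>i. i \<in> I \<Longrightarrow> prob (A i) = p" "finite T" "inj_on e T" "e ` T \<subseteq> I"
  shows "integrable M (\<lambda>\<omega>. R {\<tau> \<in> T. \<omega> \<in> A (e \<tau>)})"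
    and "expectation (\<lambda>\<omega>. R {\<tau> \<in> T. \<omega> \<in> A (e \<tau>)}) = (\<Sum>S\<in>Pow T. R S * (p ^ card S * (1 - p) ^ card (T - S)))"
proof -
  let ?E = "\<lambda>S. {\<omega> \<in> space M. {\<tau> \<in> T. \<omega> \<in> A (e \<tau>)} = S}"
  have eq: "R {\<tau> \<in> T. \<omega> \<in> A (e \<tau>)} = (\<Sum>S\<in>Pow T. R S * indicator (?E S) \<omega>)" if "\<omega> \<in> space M" for \<omega>
  proof -
    have "(\<Sum>S\<in>Pow T. R S * indicator (?E S) \<omega>) = (\<Sum>S\<in>Pow T. if S = {\<tau> \<in> T. \<omega> \<in> A (e \<tau>)} then R S else 0)"
      using that by (intro sum.cong) (auto simp: indicator_def)
    also have "\<dots> = R {\<tau> \<in> T. \<omega> \<in> A (e \<tau>)}" using assms(3) by (subst sum.delta) auto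
    finally show ?thesis ..
  qed
  have int: "integrable M (indicator (?E S) :: 'a \<Rightarrow> real)" if "S \<in> Pow T" for S
    using that prob_pattern(1)[OF assms] by (intro integrable_real_indicator) (auto simp: less_top[symmetric])
  have "integrable M (\<lambda>\<omega>. \<Sum>S\<in>Pow T. R S * indicator (?E S) \<omega>)"
    using int by (intro Bochner_Integration.integrable_sum integrable_mult_right) auto
  then show "integrable M (\<lambda>\<omega>. R {\<tau> \<in> T. \<omega> \<in> A (e \<tau>)})"
    by (subst Bochner_Integration.integrable_cong[OF refl eq]) auto
  have "expectation (\<lambda>\<omega>. R {\<tau> \<in> T. \<omega> \<in> A (e \<tau>)}) = expectation (\<lambda>\<omega>. \<Sum>S\<in>Pow T. R S * indicator (?E S) \<omega>)"
    by (intro Bochner_Integration.integral_cong refl eq)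
  also have "\<dots> = (\<Sum>S\<in>Pow T. R S * prob (?E S))"
    using int prob_pattern(1)[OF assms]
    by (subst Bochner_Integration.integral_sum) (auto intro!: integrable_mult_right sum.cong)
  also have "\<dots> = (\<Sum>S\<in>Pow T. R S * (p ^ card S * (1 - p) ^ card (T - S)))"
    using prob_pattern(2)[OF assms] by (intro sum.cong) auto
  finally show "expectation (\<lambda>\<omega>. R {\<tau> \<in> T. \<omega> \<in> A (e \<tau>)}) = \<dots>" .
qed

text \<open>Two patterns with disjoint ranges form one pattern on the disjoint sum
  \<open>T <+> T\<close>, whose weights factor; \<open>expectation_pattern\<close> then gives the
  product rule.\<close>

lemma expectation_pattern_product:
  fixes R R' :: "'b set \<Rightarrow> real"
  assumes A: "indep_events A I" "\<And>i. i \<in> I \<Longrightarrow> prob (A i) = p"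
    and T: "finite T" and e: "inj_on e T" "e ` T \<subseteq> I" and e': "inj_on e' T" "e' ` T \<subseteq> I"
    and disj: "e ` T \<inter> e' ` T = {}"
  shows "expectation (\<lambda>\<omega>. R {\<tau> \<in> T. \<omega> \<in> A (e \<tau>)} * R' {\<tau> \<in> T. \<omega> \<in> A (e' \<tau>)})
    = expectation (\<lambda>\<omega>. R {\<tau> \<in> T. \<omega> \<in> A (e \<tau>)}) * expectation (\<lambda>\<omega>. R' {\<tau> \<in> T. \<omega> \<in> A (e' \<tau>)})"
proof -
  let ?T = "T <+> T" and ?e = "case_sum e e'"
  let ?w = "\<lambda>S. p ^ card S * (1 - p) ^ card (T - S)"
  let ?R = "\<lambda>S. R (Inl -` S) * R' (Inr -` S)"
  have inj: "inj_on ?e ?T"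
  proof (rule inj_onI)
    fix x y assume "x \<in> ?T" "y \<in> ?T" "?e x = ?e y"
    then show "x = y" using e(1) e'(1) disj by (auto simp: Plus_def dest: inj_onD) blast+
  qed
  have ran: "?e ` ?T \<subseteq> I" using e e' by (auto simp: Plus_def)
  have vimage: "Inl -` {\<tau> \<in> ?T. \<omega> \<in> A (?e \<tau>)} = {\<tau> \<in> T. \<omega> \<in> A (e \<tau>)}"
    "Inr -` {\<tau> \<in> ?T. \<omega> \<in> A (?e \<tau>)} = {\<tau> \<in> T. \<omega> \<in> A (e' \<tau>)}" for \<omega>
    by auto
  have "expectation (\<lambda>\<omega>. R {\<tau> \<in> T. \<omega> \<in> A (e \<tau>)} * R' {\<tau> \<in> T. \<omega> \<in> A (e' \<tau>)})
      = (\<Sum>S\<in>Pow ?T. ?R S * (p ^ card S * (1 - p) ^ card (?T - S)))"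
    using expectation_pattern(2)[OF A finite_Plus[OF T T] inj ran, of ?R] unfolding vimage by simp
  also have "\<dots> = (\<Sum>(S, S')\<in>Pow T \<times> Pow T. R S * ?w S * (R' S' * ?w S'))"
  proof (rule sum.reindex_bij_witness[where i = "\<lambda>(S, S'). S <+> S'" and j = "\<lambda>S. (Inl -` S, Inr -` S)"])
    fix S assume S: "S \<in> Pow ?T"
    have split: "S = (Inl -` S) <+> (Inr -` S)"
    proof (intro equalityI subsetI)
      fix x assume "x \<in> S" then show "x \<in> (Inl -` S) <+> (Inr -` S)" by (cases x) auto
    qed auto
    then show "(case (Inl -` S, Inr -` S) of (S, S') \<Rightarrow> S <+> S') = S" by simp
    show mem: "(Inl -` S, Inr -` S) \<in> Pow T \<times> Pow T" using S by auto
    have fin: "finite (Inl -` S)" "finite (Inr -` S)" using mem T finite_subset by auto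
    have "card S = card (Inl -` S) + card (Inr -` S)"
      by (subst split) (rule card_Plus[OF fin])
    moreover have "?T - S = (T - Inl -` S) <+> (T - Inr -` S)" by auto
    then have "card (?T - S) = card (T - Inl -` S) + card (T - Inr -` S)"
      using T by (simp add: card_Plus)
    ultimately show "(case (Inl -` S, Inr -` S) of (S, S') \<Rightarrow> R S * ?w S * (R' S' * ?w S'))
        = ?R S * (p ^ card S * (1 - p) ^ card (?T - S))"
      by (simp add: power_add mult_ac)
  next
    fix b assume "b \<in> Pow T \<times> Pow T"
    then show "(case b of (S, S') \<Rightarrow> S <+> S') \<in> Pow ?T"
      "(Inl -` (case b of (S, S') \<Rightarrow> S <+> S'), Inr -` (case b of (S, S') \<Rightarrow> S <+> S')) = b"
      by (auto split: prod.splits)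
  qed
  also have "\<dots> = (\<Sum>S\<in>Pow T. R S * ?w S) * (\<Sum>S\<in>Pow T. R' S * ?w S)"
    by (simp add: sum_product sum.cartesian_product)
  finally show ?thesis by (simp only: expectation_pattern(2)[OF A T e] expectation_pattern(2)[OF A T e'])
qed

text \<open>The relation \<open>Q\<close> marks the pairs that may be correlated. All other pairs
  drop out of the expanded square, and each index has at most \<open>N\<close> marked
  partners.\<close>

lemma second_moment_sum_le:
  fixes X :: "'i \<Rightarrow> 'a \<Rightarrow> real"
  assumes "finite Js" and int: "\<And>i j. i \<in> Js \<Longrightarrow> j \<in> Js \<Longrightarrow> integrable M (\<lambda>\<omega>. X i \<omega> * X j \<omega>)"
    and zero: "\<And>i j. i \<in> Js \<Longrightarrow> j \<in> Js \<Longrightarrow> \<not> Q i j \<Longrightarrow> expectation (\<lambda>\<omega>. X i \<omega> * X j \<omega>) = 0"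
    and bound: "\<And>i \<omega>. i \<in> Js \<Longrightarrow> \<bar>X i \<omega>\<bar> \<le> D"
    and count: "\<And>i. i \<in> Js \<Longrightarrow> card {j \<in> Js. Q i j} \<le> N"
  shows "integrable M (\<lambda>\<omega>. (\<Sum>i\<in>Js. X i \<omega>)\<^sup>2)"
    and "expectation (\<lambda>\<omega>. (\<Sum>i\<in>Js. X i \<omega>)\<^sup>2) \<le> D\<^sup>2 * (card Js * N)"
proof -
  have sq: "(\<lambda>\<omega>. (\<Sum>i\<in>Js. X i \<omega>)\<^sup>2) = (\<lambda>\<omega>. \<Sum>i\<in>Js. \<Sum>j\<in>Js. X i \<omega> * X j \<omega>)"
    by (auto simp: power2_eq_square sum_product)
  show "integrable M (\<lambda>\<omega>. (\<Sum>i\<in>Js. X i \<omega>)\<^sup>2)"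
    unfolding sq using int by (intro Bochner_Integration.integrable_sum)
  have le: "expectation (\<lambda>\<omega>. X i \<omega> * X j \<omega>) \<le> (if Q i j then D\<^sup>2 else 0)" if ij: "i \<in> Js" "j \<in> Js" for i j
  proof (cases "Q i j")
    case True
    have "expectation (\<lambda>\<omega>. X i \<omega> * X j \<omega>) \<le> expectation (\<lambda>\<omega>. D\<^sup>2)"
    proof (intro integral_mono int ij)
      fix \<omega>
      have "X i \<omega> * X j \<omega> \<le> \<bar>X i \<omega>\<bar> * \<bar>X j \<omega>\<bar>" by (metis abs_ge_self abs_mult)
      also have "\<dots> \<le> D * D" using bound ij by (intro mult_mono) (auto intro: order_trans[OF abs_ge_zero])
      finally show "X i \<omega> * X j \<omega> \<le> D\<^sup>2" by (simp add: power2_eq_square)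
    qed simp
    then show ?thesis using True by (simp add: prob_space)
  qed (simp add: zero ij)
  have "expectation (\<lambda>\<omega>. (\<Sum>i\<in>Js. X i \<omega>)\<^sup>2) = (\<Sum>i\<in>Js. \<Sum>j\<in>Js. expectation (\<lambda>\<omega>. X i \<omega> * X j \<omega>))"
    unfolding sq using int by (subst Bochner_Integration.integral_sum)
      (auto intro!: sum.cong Bochner_Integration.integral_sum Bochner_Integration.integrable_sum)
  also have "\<dots> \<le> (\<Sum>i\<in>Js. \<Sum>j\<in>Js. if Q i j then D\<^sup>2 else 0)"
    using le by (intro sum_mono) auto
  also have "\<dots> = (\<Sum>i\<in>Js. D\<^sup>2 * card {j \<in> Js. Q i j})"
    using \<open>finite Js\<close> by (intro sum.cong refl) (simp add: sum.If_cases Int_def)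
  also have "\<dots> \<le> (\<Sum>i\<in>Js. D\<^sup>2 * N)"
    using count by (intro sum_mono mult_left_mono) auto
  finally show "expectation (\<lambda>\<omega>. (\<Sum>i\<in>Js. X i \<omega>)\<^sup>2) \<le> D\<^sup>2 * (card Js * N)"
    by (simp add: mult_ac)
qed

text \<open>The series of squared deviations has finite expectation, so it converges almost surely
  and its terms tend to 0. Only the moments of each \<open>X n\<close> separately enter, hence no
  joint distribution.\<close>

lemma AE_tendsto_if_summable_second_moment:
  fixes X :: "nat \<Rightarrow> 'a \<Rightarrow> real"
  assumes int: "\<And>n. integrable M (\<lambda>\<omega>. (X n \<omega> - \<mu>)\<^sup>2)"
    and le: "\<And>n. expectation (\<lambda>\<omega>. (X n \<omega> - \<mu>)\<^sup>2) \<le> c n" and c: "summable c"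
  shows "AE \<omega> in M. (\<lambda>n. X n \<omega>) \<longlonglongrightarrow> \<mu>"
proof -
  have meas: "(\<lambda>\<omega>. ennreal ((X n \<omega> - \<mu>)\<^sup>2)) \<in> borel_measurable M" for n
    using int by measurable
  have c_nonneg: "0 \<le> c n" for n
  proof -
    have "0 \<le> expectation (\<lambda>\<omega>. (X n \<omega> - \<mu>)\<^sup>2)" by (intro Bochner_Integration.integral_nonneg) simp
    then show ?thesis using le[of n] by linarith
  qed
  have "(\<integral>\<^sup>+\<omega>. suminf (\<lambda>n. ennreal ((X n \<omega> - \<mu>)\<^sup>2)) \<partial>M)
      = suminf (\<lambda>n. \<integral>\<^sup>+\<omega>. ennreal ((X n \<omega> - \<mu>)\<^sup>2) \<partial>M)"
    using meas by (intro nn_integral_suminf)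
  also have "\<dots> = suminf (\<lambda>n. ennreal (expectation (\<lambda>\<omega>. (X n \<omega> - \<mu>)\<^sup>2)))"
    using int by (simp add: nn_integral_eq_integral)
  also have "\<dots> \<le> suminf (\<lambda>n. ennreal (c n))"
    using le by (intro suminf_le summableI ennreal_leI)
  also have "\<dots> = ennreal (suminf c)" using c c_nonneg by (intro suminf_ennreal2)
  also have "\<dots> < \<infinity>" by simp
  finally have "AE \<omega> in M. suminf (\<lambda>n. ennreal ((X n \<omega> - \<mu>)\<^sup>2)) \<noteq> \<infinity>"
    using meas by (intro nn_integral_PInf_AE) auto
  then show ?thesis
  proof (rule AE_mp, intro AE_I2 impI)
    fix \<omega> assume "suminf (\<lambda>n. ennreal ((X n \<omega> - \<mu>)\<^sup>2)) \<noteq> \<infinity>"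
    then have "summable (\<lambda>n. (X n \<omega> - \<mu>)\<^sup>2)" by (intro summable_suminf_not_top) auto
    then have "(\<lambda>n. (X n \<omega> - \<mu>)\<^sup>2) \<longlonglongrightarrow> 0" by (rule summable_LIMSEQ_zero)
    then have "(\<lambda>n. sqrt ((X n \<omega> - \<mu>)\<^sup>2)) \<longlonglongrightarrow> sqrt 0" by (rule tendsto_real_sqrt)
    then have "(\<lambda>n. X n \<omega> - \<mu>) \<longlonglongrightarrow> 0" by (simp add: tendsto_rabs_zero_iff)
    then show "(\<lambda>n. X n \<omega>) \<longlonglongrightarrow> \<mu>" by (simp add: LIM_zero_iff)
  qed
qed

end

section \<open>A law of large numbers for the full subcomplexes\<close>

text \<open>A union bound over the pairs contained in \<open>J\<close>: once a pair is fixed, the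
  other \<open>j - 2\<close> elements are chosen among \<open>n - 2\<close>.\<close>

lemma card_subsets_meeting_twice:
  assumes J: "J \<subseteq> {1..n}" "card J = j" and "2 \<le> j"
  shows "card {J'. J' \<subseteq> {1..n} \<and> card J' = j \<and> 2 \<le> card (J \<inter> J')} \<le> (j choose 2) * (n - 2 choose (j - 2))"
proof -
  have fin: "finite J" using J finite_subset by blast
  let ?P = "{P. P \<subseteq> J \<and> card P = 2}"
  have "{J'. J' \<subseteq> {1..n} \<and> card J' = j \<and> 2 \<le> card (J \<inter> J')}
      \<subseteq> (\<Union>P\<in>?P. (\<union>) P ` {B. B \<subseteq> {1..n} - P \<and> card B = j - 2})"
  proof
    fix J' assume J': "J' \<in> {J'. J' \<subseteq> {1..n} \<and> card J' = j \<and> 2 \<le> card (J \<inter> J')}"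
    then have "2 \<le> card (J \<inter> J')" by simp
    then obtain P where P: "P \<subseteq> J \<inter> J'" "card P = 2" "finite P"
      by (rule obtain_subset_with_card_n)
    then have "J' = P \<union> (J' - P)" "J' - P \<subseteq> {1..n} - P" "card (J' - P) = j - 2"
      using P J' by (auto simp: card_Diff_subset)
    then show "J' \<in> (\<Union>P\<in>?P. (\<union>) P ` {B. B \<subseteq> {1..n} - P \<and> card B = j - 2})" using P by blast
  qed
  then have "card {J'. J' \<subseteq> {1..n} \<and> card J' = j \<and> 2 \<le> card (J \<inter> J')}
      \<le> card (\<Union>P\<in>?P. (\<union>) P ` {B. B \<subseteq> {1..n} - P \<and> card B = j - 2})"
    using fin by (intro card_mono) auto
  also have "\<dots> \<le> (\<Sum>P\<in>?P. card ((\<union>) P ` {B. B \<subseteq> {1..n} - P \<and> card B = j - 2}))"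
    using fin by (intro card_UN_le) auto
  also have "\<dots> \<le> (\<Sum>P\<in>?P. n - 2 choose (j - 2))"
  proof (intro sum_mono)
    fix P assume P: "P \<in> ?P"
    then have "finite P" "P \<subseteq> {1..n}" using fin J finite_subset by blast+
    then have "card ({1..n} - P) = n - 2" using P by (simp add: card_Diff_subset)
    then have "card {B. B \<subseteq> {1..n} - P \<and> card B = j - 2} = (n - 2 choose (j - 2))"
      using n_subsets[of "{1..n} - P" "j - 2"] by simp
    then show "card ((\<union>) P ` {B. B \<subseteq> {1..n} - P \<and> card B = j - 2}) \<le> (n - 2 choose (j - 2))"
      using card_image_le[of "{B. B \<subseteq> {1..n} - P \<and> card B = j - 2}" "(\<union>) P"] by simp
  qed
  also have "\<dots> = (j choose 2) * (n - 2 choose (j - 2))"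
    using n_subsets[OF fin, of 2] J by simp
  finally show ?thesis .
qed

lemma finite_d_simplices [simp]: "finite (d_simplices n d)"
  by (rule finite_subset[of _ "Pow {1..n}"]) (auto simp: d_simplices_def)

lemma card_d_simplices: "card (d_simplices n d) = n choose (d + 1)"
  using n_subsets[of "{1..n}" "d + 1"] by (simp add: d_simplices_def)

context prob_space
begin

text \<open>A common \<open>d\<close>-simplex needs \<open>d + 1\<close> common vertices, hence at
  least 2. Counting with 2 makes the bound independent of \<open>d\<close>, and its order
  \<open>n ^ (-2)\<close> is already summable.\<close>

lemma subset_average_second_moment:
  fixes R :: "nat set set \<Rightarrow> real"
  assumes A: "indep_events A (d_simplices n d)" "\<And>\<sigma>. \<sigma> \<in> d_simplices n d \<Longrightarrow> prob (A \<sigma>) = p"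
    and d: "1 \<le> d" "d + 1 \<le> j" "j \<le> n"
    and g: "\<And>J. J \<subseteq> {1..n} \<Longrightarrow> card J = j \<Longrightarrow> bij_betw (g J) {1..j} J"
    and bound: "\<And>S. S \<subseteq> d_simplices j d \<Longrightarrow> \<bar>R S - \<mu>\<bar> \<le> D"
    and \<mu>: "\<mu> = (\<Sum>S\<in>Pow (d_simplices j d). R S * (p ^ card S * (1 - p) ^ card (d_simplices j d - S)))"
  defines "X \<equiv> \<lambda>\<omega>. (\<Sum>J\<in>{J. J \<subseteq> {1..n} \<and> card J = j}.
      R {\<tau> \<in> d_simplices j d. \<omega> \<in> A (g J ` \<tau>)}) / (n choose j)"
  shows "integrable M (\<lambda>\<omega>. (X \<omega> - \<mu>)\<^sup>2)"
    and "expectation (\<lambda>\<omega>. (X \<omega> - \<mu>)\<^sup>2) \<le> D\<^sup>2 * (j choose 2)\<^sup>2 / (n choose 2)"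
proof -
  let ?T = "d_simplices j d" and ?Js = "{J. J \<subseteq> {1..n} \<and> card J = j}"
  let ?R = "\<lambda>S. R S - \<mu>"
  let ?X = "\<lambda>J \<omega>. ?R {\<tau> \<in> ?T. \<omega> \<in> A (g J ` \<tau>)}"
  have finJs: "finite ?Js" by simp
  have cardJs: "card ?Js = (n choose j)" using n_subsets[of "{1..n}" j] by simp
  have e: "inj_on ((`) (g J)) ?T" "(`) (g J) ` ?T \<subseteq> {\<sigma> \<in> d_simplices n d. \<sigma> \<subseteq> J}" if "J \<in> ?Js" for J
  proof -
    have bij: "bij_betw (g J) {1..j} J" using that g by auto
    then have inj: "inj_on (g J) {1..j}" and img: "g J ` {1..j} = J" by (auto simp: bij_betw_def)
    show "inj_on ((`) (g J)) ?T"
      by (rule inj_on_subset[OF inj_on_image_Pow[OF inj]]) (auto simp: d_simplices_def)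
    show "(`) (g J) ` ?T \<subseteq> {\<sigma> \<in> d_simplices n d. \<sigma> \<subseteq> J}"
    proof
      fix \<sigma> assume "\<sigma> \<in> (`) (g J) ` ?T"
      then obtain \<tau> where \<tau>: "\<sigma> = g J ` \<tau>" "\<tau> \<subseteq> {1..j}" "card \<tau> = d + 1" by (auto simp: d_simplices_def)
      then have "card \<sigma> = d + 1" "\<sigma> \<subseteq> J" using card_image[OF inj_on_subset[OF inj \<tau>(2)]] img by auto
      then show "\<sigma> \<in> {\<sigma> \<in> d_simplices n d. \<sigma> \<subseteq> J}" using that by (auto simp: d_simplices_def)
    qed
  qed
  have e_ran: "(`) (g J) ` ?T \<subseteq> d_simplices n d" if "J \<in> ?Js" for J
    using e(2)[OF that] by blast
  have pattern: "integrable M (\<lambda>\<omega>. R' {\<tau> \<in> ?T. \<omega> \<in> A (g J ` \<tau>)})"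
    "expectation (\<lambda>\<omega>. R' {\<tau> \<in> ?T. \<omega> \<in> A (g J ` \<tau>)}) = (\<Sum>S\<in>Pow ?T. R' S * (p ^ card S * (1 - p) ^ card (?T - S)))"
    if "J \<in> ?Js" for J and R' :: "nat set set \<Rightarrow> real"
    using expectation_pattern[OF A(1) _ finite_d_simplices e(1)[OF that] e_ran[OF that], where R = R'] A(2)
    by blast+
  have mean: "expectation (?X J) = 0" if "J \<in> ?Js" for J
    using pattern[OF that, of R] by (simp add: prob_space \<mu>)
  have int: "integrable M (\<lambda>\<omega>. ?X J \<omega> * ?X J' \<omega>)" if "J \<in> ?Js" "J' \<in> ?Js" for J J'
  proof -
    have meas: "?X J \<in> borel_measurable M" if "J \<in> ?Js" for J
      using pattern(1)[OF that, of ?R] by (rule borel_measurable_integrable)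
    have "\<bar>?X J \<omega>\<bar> \<le> D" for J \<omega> by (rule bound) auto
    moreover from this have "0 \<le> D" by (rule order_trans[OF abs_ge_zero])
    ultimately have "\<bar>?X J \<omega> * ?X J' \<omega>\<bar> \<le> D * D" for \<omega>
      unfolding abs_mult by (intro mult_mono) auto
    then show ?thesis using meas that
      by (intro integrable_const_bound[of _ "D * D"]) (auto intro!: AE_I2)
  qed
  have zero: "expectation (\<lambda>\<omega>. ?X J \<omega> * ?X J' \<omega>) = 0"
    if J: "J \<in> ?Js" "J' \<in> ?Js" "\<not> 2 \<le> card (J \<inter> J')" for J J'
  proof -
    have "(`) (g J) ` ?T \<inter> (`) (g J') ` ?T = {}"
    proof (rule ccontr)
      assume "(`) (g J) ` ?T \<inter> (`) (g J') ` ?T \<noteq> {}"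
      then obtain \<sigma> where "\<sigma> \<in> d_simplices n d" "\<sigma> \<subseteq> J \<inter> J'"
        using e(2)[OF J(1)] e(2)[OF J(2)] by blast
      moreover have "finite (J \<inter> J')" using J finite_subset[of J "{1..n}"] by auto
      ultimately have "d + 1 \<le> card (J \<inter> J')" using card_mono[of "J \<inter> J'" \<sigma>] by (simp add: d_simplices_def)
      then show False using J d by simp
    qed
    then show ?thesis
      using mean[OF J(1)]
      by (subst expectation_pattern_product[OF A finite_d_simplices e(1)[OF J(1)] e_ran[OF J(1)]
            e(1)[OF J(2)] e_ran[OF J(2)]]) auto
  qed
  have count: "card {J' \<in> ?Js. 2 \<le> card (J \<inter> J')} \<le> (j choose 2) * (n - 2 choose (j - 2))" if "J \<in> ?Js" for J
  proof -
    have "{J' \<in> ?Js. 2 \<le> card (J \<inter> J')} = {J'. J' \<subseteq> {1..n} \<and> card J' = j \<and> 2 \<le> card (J \<inter> J')}" by auto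
    then show ?thesis using card_subsets_meeting_twice[of J n j] that d by simp
  qed
  note moment = second_moment_sum_le[where X = ?X and Q = "\<lambda>J J'. 2 \<le> card (J \<inter> J')" and D = D,
      OF finJs int zero _ count, unfolded cardJs]
  have pos: "0 < (n choose j)" using d by simp
  have X: "(X \<omega> - \<mu>)\<^sup>2 = (\<Sum>J\<in>?Js. ?X J \<omega>)\<^sup>2 / (n choose j)\<^sup>2" for \<omega>
  proof -
    have "X \<omega> - \<mu> = (\<Sum>J\<in>?Js. ?X J \<omega>) / (n choose j)"
      using pos cardJs by (simp add: X_def sum_subtractf field_simps)
    then show ?thesis by (simp add: power_divide)
  qed
  show "integrable M (\<lambda>\<omega>. (X \<omega> - \<mu>)\<^sup>2)"
    unfolding X by (intro integrable_divide moment(1) bound) auto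
  \<comment> \<open>Counting pairs inside \<open>j\<close>-subsets in two ways turns the proportion
    of correlated pairs of subsets into a multiple of \<open>1 / (n choose 2)\<close>.\<close>
  have choose: "(n choose j) * (j choose 2) = (n choose 2) * (n - 2 choose (j - 2))"
    using d by (intro choose_mult) auto
  have "expectation (\<lambda>\<omega>. (X \<omega> - \<mu>)\<^sup>2) = expectation (\<lambda>\<omega>. (\<Sum>J\<in>?Js. ?X J \<omega>)\<^sup>2) / (n choose j)\<^sup>2"
    unfolding X by simp
  also have "\<dots> \<le> D\<^sup>2 * real ((n choose j) * ((j choose 2) * (n - 2 choose (j - 2)))) / (n choose j)\<^sup>2"
    by (intro divide_right_mono moment(2) bound) auto
  also have "\<dots> = D\<^sup>2 * (j choose 2) * (n - 2 choose (j - 2)) / (n choose j)"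
    using pos by (simp add: power2_eq_square)
  also have "\<dots> = D\<^sup>2 * (j choose 2)\<^sup>2 / (n choose 2)"
  proof -
    have "0 < (n choose 2)" using d by simp
    moreover have "real (n choose j) * (j choose 2) = (n choose 2) * (n - 2 choose (j - 2))"
      using choose by (metis of_nat_mult)
    ultimately show ?thesis using pos by (simp add: field_simps power2_eq_square)
  qed
  finally show "expectation (\<lambda>\<omega>. (X \<omega> - \<mu>)\<^sup>2) \<le> D\<^sup>2 * (j choose 2)\<^sup>2 / (n choose 2)" .
qed

lemma subset_average_tendsto:
  fixes R :: "nat set set \<Rightarrow> real" and A :: "nat \<Rightarrow> nat set \<Rightarrow> 'a set"
  assumes A: "\<And>n. j \<le> n \<Longrightarrow> indep_events (A n) (d_simplices n d)"
      "\<And>n \<sigma>. j \<le> n \<Longrightarrow> \<sigma> \<in> d_simplices n d \<Longrightarrow> prob (A n \<sigma>) = p"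
    and d: "1 \<le> d" "d + 1 \<le> j"
    and g: "\<And>n J. J \<subseteq> {1..n} \<Longrightarrow> card J = j \<Longrightarrow> bij_betw (g J) {1..j} J"
  shows "AE \<omega> in M. (\<lambda>n. (\<Sum>J\<in>{J. J \<subseteq> {1..n} \<and> card J = j}.
        R {\<tau> \<in> d_simplices j d. \<omega> \<in> A n (g J ` \<tau>)}) / (n choose j))
      \<longlonglongrightarrow> (\<Sum>S\<in>Pow (d_simplices j d). R S * (p ^ card S * (1 - p) ^ card (d_simplices j d - S)))"
proof -
  let ?X = "\<lambda>n \<omega>. (\<Sum>J\<in>{J. J \<subseteq> {1..n} \<and> card J = j}.
        R {\<tau> \<in> d_simplices j d. \<omega> \<in> A n (g J ` \<tau>)}) / (n choose j)"
  define \<mu> where "\<mu> = (\<Sum>S\<in>Pow (d_simplices j d). R S * (p ^ card S * (1 - p) ^ card (d_simplices j d - S)))"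
  \<comment> \<open>A crude uniform bound: there are only finitely many patterns, whatever
    \<open>n\<close> is.\<close>
  define D where "D = (\<Sum>S\<in>Pow (d_simplices j d). \<bar>R S - \<mu>\<bar>)"
  have bound: "\<bar>R S - \<mu>\<bar> \<le> D" if "S \<subseteq> d_simplices j d" for S
    unfolding D_def using that by (intro member_le_sum) auto
  note moment = subset_average_second_moment[OF A d(1) d(2) _ g bound \<mu>_def]
  \<comment> \<open>Shifted by \<open>j\<close>, because the hypotheses on \<open>A n\<close> start
    there; the limit is unaffected.\<close>
  have "AE \<omega> in M. (\<lambda>n. ?X (n + j) \<omega>) \<longlonglongrightarrow> \<mu>"
  proof (rule AE_tendsto_if_summable_second_moment)
    fix n
    show "integrable M (\<lambda>\<omega>. (?X (n + j) \<omega> - \<mu>)\<^sup>2)" by (rule moment(1)) auto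
    have "expectation (\<lambda>\<omega>. (?X (n + j) \<omega> - \<mu>)\<^sup>2) \<le> D\<^sup>2 * (j choose 2)\<^sup>2 / (n + j choose 2)"
      by (rule moment(2)) auto
    \<comment> \<open>With \<open>N = n + j\<close>, \<open>N choose 2\<close> equals
      \<open>N * (N - 1) / 2\<close>, which is at least \<open>N\<^sup>2 / 4\<close> once
      \<open>N\<close> is at least 2; this is the origin of the factor 4.\<close>
    also have "\<dots> \<le> D\<^sup>2 * (j choose 2)\<^sup>2 * (4 * inverse ((n + j)\<^sup>2))"
    proof -
      have "2 \<le> n + j" using d by simp
      then have "4 * real (n + j choose 2) \<ge> (n + j)\<^sup>2"
      proof -
        have "2 * (n + j choose 2) = (n + j) * (n + j - 1)"
          using times_binomial_minus1_eq[of 2 "n + j"] by simp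
        then have "real 2 * real (n + j choose 2) = real (n + j) * real (n + j - 1)"
          by (simp only: of_nat_mult[symmetric])
        then have "real (n + j choose 2) = real (n + j) * (real (n + j) - 1) / 2"
          using \<open>2 \<le> n + j\<close> by (simp add: of_nat_diff)
        moreover have "real (n + j) * 2 \<le> real (n + j) * real (n + j)"
          using \<open>2 \<le> n + j\<close> by (intro mult_left_mono) auto
        ultimately show ?thesis by (simp add: power2_eq_square algebra_simps)
      qed
      moreover have "0 < real ((n + j)\<^sup>2)" "0 < real (n + j choose 2)" using \<open>2 \<le> n + j\<close> by auto
      ultimately have "1 / real (n + j choose 2) \<le> 4 * inverse ((n + j)\<^sup>2)" by (simp add: field_simps)
      then have "D\<^sup>2 * (j choose 2)\<^sup>2 * (1 / real (n + j choose 2)) \<le> D\<^sup>2 * (j choose 2)\<^sup>2 * (4 * inverse ((n + j)\<^sup>2))"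
        by (intro mult_left_mono) auto
      then show ?thesis by simp
    qed
    finally show "expectation (\<lambda>\<omega>. (?X (n + j) \<omega> - \<mu>)\<^sup>2) \<le> D\<^sup>2 * (j choose 2)\<^sup>2 * (4 * inverse ((n + j)\<^sup>2))" .
  next
    have "summable (\<lambda>n. inverse (real n ^ 2))" by (rule inverse_power_summable) simp
    then have "summable (\<lambda>n. inverse (real (n + j) ^ 2))" by (rule summable_ignore_initial_segment)
    then show "summable (\<lambda>n. D\<^sup>2 * (j choose 2)\<^sup>2 * (4 * inverse ((n + j)\<^sup>2)))"
      by (intro summable_mult) simp
  qed
  then show ?thesis
  proof (rule AE_mp, intro AE_I2 impI)
    fix \<omega> assume "(\<lambda>n. ?X (n + j) \<omega>) \<longlonglongrightarrow> \<mu>"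
    then show "(\<lambda>n. ?X n \<omega>) \<longlonglongrightarrow> (\<Sum>S\<in>Pow (d_simplices j d). R S * (p ^ card S * (1 - p) ^ card (d_simplices j d - S)))"
      unfolding \<mu>_def by (rule LIMSEQ_offset)
  qed
qed

end

section \<open>Linial--Meshulam complexes\<close>

text \<open>The weights are those of \<open>expectation_pattern\<close>, which identifies the limit
  of the averages with the expectation under \<open>lm_pmf\<close>.\<close>

lemma expected_homology_rank_eq:
  assumes "0 < p" "p < 1"
  shows "expected_homology_rank TYPE('k::idom) q n d p
    = (\<Sum>S\<in>Pow (d_simplices n d). real (reduced_homology_rank TYPE('k) (skeleton n (d - 1) \<union> S) q)
        * (p ^ card S * (1 - p) ^ card (d_simplices n d - S)))"
proof -
  let ?T = "d_simplices n d"
  let ?h = "\<lambda>K. real (reduced_homology_rank TYPE('k) K q)"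
  let ?P = "Pi_pmf ?T False (\<lambda>_. bernoulli_pmf p)"
  let ?c = "\<lambda>S \<sigma>. \<sigma> \<in> (S :: nat set set)"
  have pmf: "pmf ?P (?c S) = p ^ card S * (1 - p) ^ card (?T - S)" if "S \<subseteq> ?T" for S
  proof -
    have "pmf ?P (?c S) = (\<Prod>\<sigma>\<in>?T. if \<sigma> \<in> S then p else 1 - p)"
      using that assms by (subst pmf_Pi') (auto intro!: prod.cong)
    moreover have "?T \<inter> {\<tau>. \<tau> \<in> S} = S" "?T \<inter> - {\<tau>. \<tau> \<in> S} = ?T - S" using that by auto
    ultimately show ?thesis by (simp add: prod.If_cases)
  qed
  have "expected_homology_rank TYPE('k) q n d p
      = measure_pmf.expectation ?P (\<lambda>f. ?h (skeleton n (d - 1) \<union> {\<sigma>. f \<sigma>}))"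
    by (simp add: expected_homology_rank_def lm_pmf_def)
  also have "\<dots> = (\<Sum>f\<in>?c ` Pow ?T. ?h (skeleton n (d - 1) \<union> {\<sigma>. f \<sigma>}) * pmf ?P f)"
  proof (rule integral_measure_pmf_real)
    show "finite (?c ` Pow ?T)" by simp
    fix f assume "f \<in> set_pmf ?P"
    then have "\<not> f \<sigma>" if "\<sigma> \<notin> ?T" for \<sigma>
      using that pmf_Pi[of ?T False "\<lambda>_. bernoulli_pmf p" f] by (auto simp: set_pmf_iff split: if_splits)
    then show "f \<in> ?c ` Pow ?T" by (intro image_eqI[of _ _ "{\<sigma>. f \<sigma>}"]) auto
  qed
  also have "\<dots> = (\<Sum>S\<in>Pow ?T. ?h (skeleton n (d - 1) \<union> S) * pmf ?P (?c S))"
    by (subst sum.reindex) (auto simp: inj_on_def fun_eq_iff)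
  also have "\<dots> = (\<Sum>S\<in>Pow ?T. ?h (skeleton n (d - 1) \<union> S) * (p ^ card S * (1 - p) ^ card (?T - S)))"
    using pmf by (intro sum.cong) auto
  finally show ?thesis .
qed

text \<open>The ranks do not depend on \<open>p\<close>, and the weight of each pattern is a product
  of as many linear factors as there are \<open>d\<close>-simplices.\<close>

lemma expected_homology_rank_polynomial:
  "\<exists>P :: real poly. degree P \<le> n choose (d + 1) \<and>
     (\<forall>p\<in>{0<..<1}. expected_homology_rank TYPE('k::idom) q n d p = poly P p)"
proof -
  let ?T = "d_simplices n d"
  define P where "P = (\<Sum>S\<in>Pow ?T. smult (real (reduced_homology_rank TYPE('k) (skeleton n (d - 1) \<union> S) q))
      ([:0, 1:] ^ card S * [:1, -1:] ^ card (?T - S)))"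
  have "degree P \<le> n choose (d + 1)"
    unfolding P_def
  proof (intro degree_sum_le)
    fix S assume S: "S \<in> Pow ?T"
    have "degree ([:0, 1:] ^ card S * [:1, -1:] ^ card (?T - S) :: real poly) \<le> card S + card (?T - S)"
      by (intro order_trans[OF degree_mult_le] add_mono order_trans[OF degree_power_le]) auto
    also have "\<dots> = card ?T"
      using S card_mono[of ?T S] by (simp add: card_Diff_subset finite_subset)
    finally show "degree (smult (real (reduced_homology_rank TYPE('k) (skeleton n (d - 1) \<union> S) q))
        ([:0, 1:] ^ card S * [:1, -1:] ^ card (?T - S))) \<le> n choose (d + 1)"
      using order_trans[OF degree_smult_le] by (simp add: card_d_simplices)
  qed simp
  moreover have "expected_homology_rank TYPE('k) q n d p = poly P p" if "p \<in> {0<..<1}" for p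
    using that by (simp add: expected_homology_rank_eq P_def poly_sum)
  ultimately show ?thesis by blast
qed

text \<open>All faces of dimension below \<open>d\<close> are present, so the relabelled full
  subcomplex is determined by which \<open>d\<close>-simplices of \<open>{1..j}\<close> come from
  faces of \<open>K\<close>.\<close>

lemma lm_complex_relabel:
  assumes K: "K \<in> lm_complexes n d" and d: "1 \<le> d"
    and J: "J \<subseteq> {1..n}" and f: "bij_betw f J {1..j}"
  shows "(`) f ` {\<sigma> \<in> K. \<sigma> \<subseteq> J} = skeleton j (d - 1) \<union> {\<tau> \<in> d_simplices j d. inv_into J f ` \<tau> \<in> K}"
proof -
  let ?g = "inv_into J f"
  have sub: "skeleton n (d - 1) \<subseteq> K" "K \<subseteq> skeleton n d" using K by (auto simp: lm_complexes_def)
  have inj: "inj_on f J" and img: "f ` J = {1..j}" using f by (auto simp: bij_betw_def)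
  have gf: "?g ` f ` \<sigma> = \<sigma>" if "\<sigma> \<subseteq> J" for \<sigma>
    using inj that by (simp add: inv_into_image_cancel)
  have fg: "f ` ?g ` \<tau> = \<tau>" "?g ` \<tau> \<subseteq> J" "card (?g ` \<tau>) = card \<tau>" if "\<tau> \<subseteq> {1..j}" for \<tau>
  proof -
    show "f ` ?g ` \<tau> = \<tau>" using image_inv_into_cancel[OF img that] .
    show "?g ` \<tau> \<subseteq> J" using that img inv_into_into[of _ f J] by blast
    have "inj_on ?g \<tau>" using that img inj_on_inv_into[of \<tau> f J] by blast
    then show "card (?g ` \<tau>) = card \<tau>" by (rule card_image)
  qed
  show ?thesis
  proof (intro equalityI subsetI)
    fix \<tau> assume "\<tau> \<in> (`) f ` {\<sigma> \<in> K. \<sigma> \<subseteq> J}"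
    then obtain \<sigma> where \<sigma>: "\<tau> = f ` \<sigma>" "\<sigma> \<in> K" "\<sigma> \<subseteq> J" by blast
    have "card \<tau> = card \<sigma>" unfolding \<sigma>(1) using card_image[OF inj_on_subset[OF inj \<sigma>(3)]] .
    moreover have "card \<sigma> \<le> d + 1" using \<sigma>(2) sub by (auto simp: skeleton_def)
    moreover have "\<tau> \<subseteq> {1..j}" using \<sigma> img by blast
    moreover have "?g ` \<tau> \<in> K" using gf[OF \<sigma>(3)] \<sigma> by simp
    \<comment> \<open>\<open>skeleton j (d - 1)\<close> admits \<open>d - 1 + 1\<close> vertices,
      which is \<open>d\<close> only because \<open>d\<close> is positive; a face with more vertices
      then has exactly \<open>d + 1\<close>.\<close>
    ultimately show "\<tau> \<in> skeleton j (d - 1) \<union> {\<tau> \<in> d_simplices j d. ?g ` \<tau> \<in> K}"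
      using d by (auto simp: skeleton_def d_simplices_def)
  next
    fix \<tau> assume \<tau>: "\<tau> \<in> skeleton j (d - 1) \<union> {\<tau> \<in> d_simplices j d. ?g ` \<tau> \<in> K}"
    then have sub_j: "\<tau> \<subseteq> {1..j}" by (auto simp: skeleton_def d_simplices_def)
    have "?g ` \<tau> \<in> K"
    proof (cases "\<tau> \<in> skeleton j (d - 1)")
      case True
      then have "?g ` \<tau> \<in> skeleton n (d - 1)" using fg[OF sub_j] J unfolding skeleton_def by auto
      then show ?thesis using sub by blast
    qed (use \<tau> in auto)
    then show "\<tau> \<in> (`) f ` {\<sigma> \<in> K. \<sigma> \<subseteq> J}" using fg[OF sub_j] by (intro image_eqI[of _ _ "?g ` \<tau>"]) auto
  qed
qed

text \<open>Counting with \<open>\<le>\<close> numbers the elements of \<open>J\<close> from 1,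
  which gives the increasing bijection onto \<open>{1..card J}\<close>.\<close>

definition rank_in :: "nat set \<Rightarrow> nat \<Rightarrow> nat" where
  "rank_in J v = card {u \<in> J. u \<le> v}"

lemma rank_in:
  assumes "finite J"
  shows "strict_mono_on J (rank_in J)" "bij_betw (rank_in J) J {1..card J}"
proof -
  show mono: "strict_mono_on J (rank_in J)"
  proof (rule strict_mono_onI)
    fix v w assume vw: "v \<in> J" "w \<in> J" "v < w"
    have "{u \<in> J. u \<le> v} \<subset> {u \<in> J. u \<le> w}" using vw by force
    then show "rank_in J v < rank_in J w" unfolding rank_in_def using assms by (intro psubset_card_mono) auto
  qed
  then have inj: "inj_on (rank_in J) J" by (rule strict_mono_on_imp_inj_on)
  have "rank_in J v \<in> {1..card J}" if "v \<in> J" for v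
  proof -
    have "{v} \<subseteq> {u \<in> J. u \<le> v}" using that by auto
    then have "card {v} \<le> rank_in J v" unfolding rank_in_def using assms by (intro card_mono) auto
    moreover have "rank_in J v \<le> card J" unfolding rank_in_def using assms by (intro card_mono) auto
    ultimately show ?thesis by simp
  qed
  then have "rank_in J ` J \<subseteq> {1..card J}" by blast
  then have "rank_in J ` J = {1..card J}"
    using card_image[OF inj] by (intro card_subset_eq) auto
  then show "bij_betw (rank_in J) J {1..card J}" using inj by (simp add: bij_betw_def)
qed

lemma betti_tendsto:
  fixes M :: "'w measure"
  assumes d: "1 \<le> d" "d + 1 \<le> j" and p: "0 < p" "p < 1" and "prob_space M"
    and Y: "\<And>n. n \<ge> j \<Longrightarrow> random_d_complex M n d p (Y n)" and "i < j"
  shows "AE \<omega> in M. (\<lambda>n. real (bigraded_betti TYPE('k::idom) n (Y n \<omega>) i (2 * j)) / real (n choose j))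
      \<longlonglongrightarrow> expected_homology_rank TYPE('k) (j - i - 1) j d p"
proof -
  interpret prob_space M by fact
  let ?R = "\<lambda>S. real (reduced_homology_rank TYPE('k) (skeleton j (d - 1) \<union> S) (j - i - 1))"
  let ?g = "\<lambda>J. inv_into J (rank_in J)"
  let ?A = "\<lambda>n \<sigma>. {\<omega> \<in> space M. \<sigma> \<in> Y n \<omega>}"
  have "AE \<omega> in M. (\<lambda>n. (\<Sum>J\<in>{J. J \<subseteq> {1..n} \<and> card J = j}.
        ?R {\<tau> \<in> d_simplices j d. \<omega> \<in> ?A n (?g J ` \<tau>)}) / (n choose j))
      \<longlonglongrightarrow> (\<Sum>S\<in>Pow (d_simplices j d). ?R S * (p ^ card S * (1 - p) ^ card (d_simplices j d - S)))"
  proof (rule subset_average_tendsto[OF _ _ d])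
    show "indep_events (?A n) (d_simplices n d)" if "j \<le> n" for n
      using Y[OF that] by (simp add: random_d_complex_def)
    show "prob (?A n \<sigma>) = p" if "j \<le> n" "\<sigma> \<in> d_simplices n d" for n \<sigma>
      using Y[OF that(1)] that(2) by (simp add: random_d_complex_def)
    show "bij_betw (?g J) {1..j} J" if "J \<subseteq> {1..n}" "card J = j" for n J
      using rank_in(2)[of J] that finite_subset by (intro bij_betw_inv_into) auto
  qed
  then show ?thesis
  proof (rule AE_mp, intro AE_I2 impI)
    fix \<omega> assume \<omega>: "\<omega> \<in> space M" and lim: "(\<lambda>n. (\<Sum>J\<in>{J. J \<subseteq> {1..n} \<and> card J = j}.
        ?R {\<tau> \<in> d_simplices j d. \<omega> \<in> ?A n (?g J ` \<tau>)}) / (n choose j))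
      \<longlonglongrightarrow> (\<Sum>S\<in>Pow (d_simplices j d). ?R S * (p ^ card S * (1 - p) ^ card (d_simplices j d - S)))"
    have "real (bigraded_betti TYPE('k) n (Y n \<omega>) i (2 * j))
        = (\<Sum>J\<in>{J. J \<subseteq> {1..n} \<and> card J = j}. ?R {\<tau> \<in> d_simplices j d. \<omega> \<in> ?A n (?g J ` \<tau>)})" if "j \<le> n" for n
    proof -
      have lm: "Y n \<omega> \<in> lm_complexes n d"
        using Y[OF that] \<omega> measurable_space[of "Y n" M "count_space (lm_complexes n d)" \<omega>]
        by (simp add: random_d_complex_def)
      then interpret complex_on_vertices n "Y n \<omega>"
        by unfold_locales (simp add: lm_complexes_def)
      have "bigraded_betti TYPE('k) n (Y n \<omega>) i (2 * j) = (\<Sum>J\<in>{J. J \<subseteq> {1..n} \<and> card J = j}.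
          reduced_homology_rank TYPE('k) ((`) (rank_in J) ` {\<sigma> \<in> Y n \<omega>. \<sigma> \<subseteq> J}) (j - i - 1))"
        using \<open>i < j\<close> rank_in(1) finite_subset by (intro hochster_formula) auto
      then show ?thesis
        unfolding of_nat_sum
      proof (simp only: of_nat_sum, intro sum.cong refl)
        fix J assume "J \<in> {J. J \<subseteq> {1..n} \<and> card J = j}"
        then have J: "J \<subseteq> {1..n}" "bij_betw (rank_in J) J {1..j}"
          using rank_in(2)[of J] finite_subset by auto
        show "real (reduced_homology_rank TYPE('k) ((`) (rank_in J) ` {\<sigma> \<in> Y n \<omega>. \<sigma> \<subseteq> J}) (j - i - 1))
            = ?R {\<tau> \<in> d_simplices j d. \<omega> \<in> ?A n (?g J ` \<tau>)}"
          unfolding lm_complex_relabel[OF lm d(1) J] using \<omega> by simp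
      qed
    qed
    \<comment> \<open>Only from \<open>n = j\<close> on is \<open>Y n \<omega>\<close> known to be a
      Linial--Meshulam complex, so the two sequences are identified from there.\<close>
    then have "eventually (\<lambda>n. (\<Sum>J\<in>{J. J \<subseteq> {1..n} \<and> card J = j}.
        ?R {\<tau> \<in> d_simplices j d. \<omega> \<in> ?A n (?g J ` \<tau>)}) / (n choose j)
        = real (bigraded_betti TYPE('k) n (Y n \<omega>) i (2 * j)) / real (n choose j)) sequentially"
      by (intro eventually_sequentiallyI[of j]) simp
    from Lim_transform_eventually[OF lim this]
    show "(\<lambda>n. real (bigraded_betti TYPE('k) n (Y n \<omega>) i (2 * j)) / real (n choose j))
        \<longlonglongrightarrow> expected_homology_rank TYPE('k) (j - i - 1) j d p"
      by (simp add: expected_homology_rank_eq[OF p])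
  qed
qed

theorem theorem0p1:
  fixes d j :: nat and p :: real
    and M :: "'w measure" and Y :: "nat \<Rightarrow> 'w \<Rightarrow> nat set set"
  assumes "(\<forall>x::'k::idom. x \<noteq> 0 \<longrightarrow> x dvd 1) \<or> bij (of_int :: int \<Rightarrow> 'k)"
    and "d \<ge> 1" and "j \<ge> d + 1" and "0 < p" and "p < 1"
    and "prob_space M"
    and "\<And>n. n \<ge> j \<Longrightarrow> random_d_complex M n d p (Y n)"
  shows "(AE \<omega> in M. (\<lambda>n. real (bigraded_betti TYPE('k) n (Y n \<omega>) (j - d) (2 * j))
                            / real (n choose j))
              \<longlonglongrightarrow> expected_homology_rank TYPE('k) (d - 1) j d p) \<and>
         (AE \<omega> in M. (\<lambda>n. real (bigraded_betti TYPE('k) n (Y n \<omega>) (j - d - 1) (2 * j))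
                            / real (n choose j))
              \<longlonglongrightarrow> expected_homology_rank TYPE('k) d j d p) \<and>
         (\<exists>P :: real poly. degree P \<le> j choose (d + 1) \<and>
            (\<forall>q\<in>{0<..<1}. expected_homology_rank TYPE('k) (d - 1) j d q = poly P q)) \<and>
         (\<exists>Q :: real poly. degree Q \<le> j choose (d + 1) \<and>
            (\<forall>q\<in>{0<..<1}. expected_homology_rank TYPE('k) d j d q = poly Q q))"
proof (intro conjI expected_homology_rank_polynomial)
  \<comment> \<open>Both limits are instances of \<open>betti_tendsto\<close>, whose homology degree
    is \<open>j - i - 1\<close>: \<open>i = j - d\<close> gives \<open>d - 1\<close>, and
    \<open>i = j - d - 1\<close> gives \<open>d\<close>. The truncated subtractions are exact
    because \<open>j\<close> is at least \<open>d + 1\<close> and \<open>d\<close> is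
    positive.\<close>
  have eq: "j - (j - d) - 1 = d - 1" "j - (j - d - 1) - 1 = d" "j - d < j" "j - d - 1 < j"
    using assms(2,3) by auto
  note lim = betti_tendsto[where 'k = 'k, OF assms(2-7)]
  show "AE \<omega> in M. (\<lambda>n. real (bigraded_betti TYPE('k) n (Y n \<omega>) (j - d) (2 * j)) / real (n choose j))
      \<longlonglongrightarrow> expected_homology_rank TYPE('k) (d - 1) j d p"
    using lim[OF _ eq(3)] by (simp only: eq)
  show "AE \<omega> in M. (\<lambda>n. real (bigraded_betti TYPE('k) n (Y n \<omega>) (j - d - 1) (2 * j)) / real (n choose j))
      \<longlonglongrightarrow> expected_homology_rank TYPE('k) d j d p"
    using lim[OF _ eq(4)] by (simp only: eq)
qed

end
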